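(* Let $d\in\mathbb{N}$, let $\Omega$ be the $d$-dimensional flat torus, and let $\Delta$ be a summability polyhedron in $\mathbb{Z}^d$, with $N$-dilations $\Delta_N$ and associated operator systems $\mathcal{T}^d_N(PH)$ of polyhedral Toeplitz matrices. Then, as $N\to\infty$, the metric spaces $\mathcal{UCP}_{\mathcal{K}}(\mathcal{T}^d_N(PH))$ converge to $\mathcal{UCP}_{\mathcal{K}}(C(\Omega))$ in the Gromov-Hausdorff distance.
   Context: $\mathcal{K}$ is a complex separable Hilbert space and $\{k_p:p\in\mathbb{N}\}$ is a fixed dense subset of its closed unit ball. For a closed operator system $E$, $\mathcal{UCP}_{\mathcal{K}}(E)$ is the set of all unital completely positive maps $E\to\mathcal{B}(\mathcal{K})$. $\Omega=S^1\times\cdots\times S^1$ ($d$ times) is the flat torus; $\mathcal{H}=L^2(\Omega)\otimes V$ is the Hilbert space of $L^2$-sections of the (trivial) spinor bundle, with $V=\mathbb{C}^{2^{\lfloor d/2\rfloor}}$; $D=-i\sum_{\mu=1}^d\partial_\mu\otimes\gamma^\mu$ is the Dirac operator, where $\gamma^\mu$ are self-adjoint matrices on $V$ with $\gamma^\mu\gamma^\nu+\gamma^\nu\gamma^\mu=2\delta_{\mu\nu}$. Functions on $\Omega$ act on $\mathcal{H}$ by multiplication. Put $e_n(x)=e^{in\cdot x}$ for $n\in\mathbb{Z}^d$. A polyhedron $\tilde\Delta$ in $\mathbb{R}^d$ is the convex hull of a finite set $W=\{a_1,\dots,a_r\}\subset\mathbb{Z}^d$, with $W$ equal to the set of vertices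 of $\tilde\Delta$. The set $\Delta=\tilde\Delta\cap\mathbb{Z}^d$ is a summability polyhedron if $\tilde\Delta$ contains the origin strictly in its interior. For an integer $N\ge1$, the $N$-dilation is $\Delta_N=\tilde\Delta_N\cap\mathbb{Z}^d$, where $\tilde\Delta_N$ is the convex hull of $\{Na_1,\dots,Na_r\}$. $Q_N$ is the orthogonal projection of $\mathcal{H}$ onto $\mathcal{H}_N:=\mathrm{span}\{e_\lambda:\lambda\in\Delta_N\}\otimes V$, and $D_N=Q_ND|_{\mathcal{H}_N}$. $\mathcal{T}^d_N(PH)$ is the operator system of matrices $T=(t_{k-l})_{k,l\in\Delta_N}$ with $t_{k-l}=\langle e_k,Te_l\rangle\in\mathbb{C}$, acting on $\mathcal{H}_N$ as $T\otimes 1_V$. The metrics used are as follows. $\mathcal{UCP}_{\mathcal{K}}(E)$ carries the metric $$d_E(\phi,\psi)=\sup\Big\{\sum_{p=1}^\infty\frac{1}{2^p}|\langle(\phi-\psi)(f)k_p,k_p\rangle| : f\in\mathcal{E},\ \|f\|\le1,\ \|f\|_1\le1\Big\},$$ where for $E=C(\Omega)$ one takes $\mathcal{E}=C^\infty(\Omega)$ and $\|f\|_1=\|[D,f]\|$, and for $E=\mathcal{T}^d_N(PH)$ one takes $\mathcal{E}=\mathcal{T}^d_N(PH)$ and $\|T\|_1=\|[D_N,T]\|$. The Gromov-Hausdorff distance between compact metric spaces is the infimum of the Hausdorff distances between their images under isometric embeddings into a common compact metric space. *)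

theory Defs
  imports "HOL-Analysis.Analysis"
begin

section \<open>Complex Hilbert spaces\<close>

text \<open>The inner product is linear in the first and conjugate linear in the second argument.\<close>

class complex_hilbert_space = banach +
  fixes scaleC :: "complex \<Rightarrow> 'a \<Rightarrow> 'a" (infixr "*\<^sub>C" 75)
    and cinner :: "'a \<Rightarrow> 'a \<Rightarrow> complex"
  assumes scaleC_add_right: "a *\<^sub>C (x + y) = a *\<^sub>C x + a *\<^sub>C y"
    and scaleC_add_left: "(a + b) *\<^sub>C x = a *\<^sub>C x + b *\<^sub>C x"
    and scaleC_scaleC: "a *\<^sub>C b *\<^sub>C x = (a * b) *\<^sub>C x"
    and scaleC_of_real: "complex_of_real r *\<^sub>C x = r *\<^sub>R x"
    and cinner_commute: "cinner x y = cnj (cinner y x)"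
    and cinner_add_left: "cinner (x + y) z = cinner x z + cinner y z"
    and cinner_scaleC_left: "cinner (a *\<^sub>C x) y = a * cinner x y"
    and cinner_self: "cinner x x = complex_of_real ((norm x)\<^sup>2)"

instantiation complex :: complex_hilbert_space
begin
definition "scaleC_complex (a :: complex) (x :: complex) = a * x"
definition "cinner_complex (x :: complex) (y :: complex) = x * cnj y"
instance
  by standard
    (auto simp: scaleC_complex_def cinner_complex_def algebra_simps scaleR_conv_of_real
      complex_mult_cnj cmod_def simp flip: complex_norm_square)
end

text \<open>The algebra of bounded operators on a complex Hilbert space; the library type
  of bounded linear maps only requires real linearity.\<close>

definition bounded_operators :: "('k::complex_hilbert_space \<Rightarrow>\<^sub>L 'k) set" where
  "bounded_operators = {A. \<forall>c x. blinfun_apply A (c *\<^sub>C x) = c *\<^sub>C blinfun_apply A x}"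

section \<open>Functions and spinors on the torus\<close>

text \<open>Functions on the flat torus \<open>S\<^sup>1 \<times> \<dots> \<times> S\<^sup>1\<close> are functions on \<open>real^'d\<close> that are
  \<open>2\<pi>\<close>-periodic in every (angular) coordinate.  The torus carries its normalised Lebesgue
  measure, so that the characters are orthonormal.\<close>

definition periodic :: "(real^'d \<Rightarrow> 'b) \<Rightarrow> bool" where
  "periodic f \<longleftrightarrow> (\<forall>x i. f (x + axis i (2 * pi)) = f x)"

definition torus_measure :: "(real^'d) measure" where
  "torus_measure = uniform_measure lborel (cbox 0 (vec (2 * pi)))"

definition partial_deriv :: "'d \<Rightarrow> (real^'d \<Rightarrow> 'b::real_normed_vector) \<Rightarrow> real^'d \<Rightarrow> 'b" where
  "partial_deriv \<mu> f x = vector_derivative (\<lambda>t. f (x + t *\<^sub>R axis \<mu> 1)) (at 0)"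

definition smooth :: "(real^'d \<Rightarrow> 'b::real_normed_vector) \<Rightarrow> bool" where
  "smooth f \<longleftrightarrow> (\<forall>\<mu>s x. foldr partial_deriv \<mu>s f differentiable (at x))"

definition torus_continuous :: "(real^'d \<Rightarrow> complex) set" where
  "torus_continuous = {f. periodic f \<and> continuous_on UNIV f}"

definition torus_smooth :: "(real^'d \<Rightarrow> complex) set" where
  "torus_smooth = {f. periodic f \<and> smooth f}"

text \<open>A spinor is a section of the trivial bundle with fibre \<open>complex^'s\<close>.  Square integrable
  spinors are not identified when they agree almost everywhere; none of the notions
  below, which only use inner products and norms, is affected by this.\<close>

type_synonym ('d, 's) spinor = "real^'d \<Rightarrow> complex^'s"

definition L2_spinors :: "('d::finite, 's::finite) spinor set" where
  "L2_spinors = {\<psi>. periodic \<psi> \<and> \<psi> \<in> borel_measurable borel \<and>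
     integrable torus_measure (\<lambda>x. (norm (\<psi> x))\<^sup>2)}"

definition smooth_spinors :: "('d::finite, 's::finite) spinor set" where
  "smooth_spinors = {\<psi>. periodic \<psi> \<and> smooth \<psi>}"

definition spinor_inner :: "('d::finite, 's::finite) spinor \<Rightarrow> ('d::finite, 's::finite) spinor \<Rightarrow> complex" where
  "spinor_inner \<psi> \<phi> = (LINT x|torus_measure. (\<Sum>s\<in>UNIV. \<psi> x $ s * cnj (\<phi> x $ s)))"

definition spinor_norm :: "('d::finite, 's::finite) spinor \<Rightarrow> real" where
  "spinor_norm \<psi> = sqrt (Re (spinor_inner \<psi> \<psi>))"

text \<open>Operator norm of a (possibly only densely defined) operator with domain \<open>H\<close>;
  it is infinite if the operator is unbounded.\<close>

definition operator_norm :: "('d::finite, 's::finite) spinor set \<Rightarrow> (('d::finite, 's::finite) spinor \<Rightarrow> ('d::finite, 's::finite) spinor) \<Rightarrow> ennreal" where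
  "operator_norm H A = (SUP \<psi>\<in>{\<psi> \<in> H. spinor_norm \<psi> \<le> 1}. ennreal (spinor_norm (A \<psi>)))"

definition commutator :: "(('d::finite, 's::finite) spinor \<Rightarrow> ('d::finite, 's::finite) spinor) \<Rightarrow> (('d::finite, 's::finite) spinor \<Rightarrow> ('d::finite, 's::finite) spinor) \<Rightarrow>
    ('d::finite, 's::finite) spinor \<Rightarrow> ('d::finite, 's::finite) spinor" where
  "commutator A B \<psi> = (\<lambda>x. A (B \<psi>) x - B (A \<psi>) x)"

definition orthogonal_projection :: "('d::finite, 's::finite) spinor set \<Rightarrow> ('d::finite, 's::finite) spinor \<Rightarrow> ('d::finite, 's::finite) spinor" where
  "orthogonal_projection S \<psi> =
     (THE \<phi>. \<phi> \<in> S \<and> (\<forall>\<eta>\<in>S. spinor_inner (\<lambda>x. \<psi> x - \<phi> x) \<eta> = 0))"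

definition gamma_matrices :: "('d \<Rightarrow> complex^'s^'s) \<Rightarrow> bool" where
  "gamma_matrices \<gamma> \<longleftrightarrow>
     (\<forall>\<mu> i j. \<gamma> \<mu> $ i $ j = cnj (\<gamma> \<mu> $ j $ i)) \<and>
     (\<forall>\<mu> \<nu>. \<gamma> \<mu> ** \<gamma> \<nu> + \<gamma> \<nu> ** \<gamma> \<mu> = mat (if \<mu> = \<nu> then 2 else 0))"

definition Dirac :: "('d \<Rightarrow> complex^'s^'s) \<Rightarrow> ('d::finite, 's::finite) spinor \<Rightarrow> ('d::finite, 's::finite) spinor" where
  "Dirac \<gamma> \<psi> x = (- \<i>) *s (\<Sum>\<mu>\<in>UNIV. \<gamma> \<mu> *v partial_deriv \<mu> \<psi> x)"

definition mult_op :: "(real^'d \<Rightarrow> complex) \<Rightarrow> ('d::finite, 's::finite) spinor \<Rightarrow> ('d::finite, 's::finite) spinor" where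
  "mult_op f \<psi> x = f x *s \<psi> x"

section \<open>Polyhedral Toeplitz matrices\<close>

definition lattice_point :: "int^'d \<Rightarrow> real^'d" where
  "lattice_point n = (\<chi> i. real_of_int (n $ i))"

definition torus_char :: "int^'d \<Rightarrow> real^'d \<Rightarrow> complex" where
  "torus_char n x = exp (\<i> * complex_of_real (lattice_point n \<bullet> x))"

text \<open>\<open>W\<close> is the set of vertices of the polyhedron.\<close>

definition summability_polyhedron :: "(int^'d) set \<Rightarrow> bool" where
  "summability_polyhedron W \<longleftrightarrow> finite W \<and>
     {v. v extreme_point_of (convex hull (lattice_point ` W))} = lattice_point ` W \<and>
     0 \<in> interior (convex hull (lattice_point ` W))"

definition dilation :: "(int^'d) set \<Rightarrow> nat \<Rightarrow> (int^'d) set" where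
  "dilation W N = {n. lattice_point n \<in> convex hull ((\<lambda>a. real N *\<^sub>R lattice_point a) ` W)}"

text \<open>The span of the characters indexed by \<open>\<Delta>\<close>, tensored with the fibre.\<close>

definition trig_spinors :: "(int^'d) set \<Rightarrow> ('d::finite, 's::finite) spinor set" where
  "trig_spinors \<Delta> = {\<psi>. \<exists>v. \<psi> = (\<lambda>x. \<Sum>n\<in>\<Delta>. torus_char n x *s v n)}"

definition fourier_coeff :: "('d::finite, 's::finite) spinor \<Rightarrow> int^'d \<Rightarrow> complex^'s" where
  "fourier_coeff \<psi> n = (LINT x|torus_measure. cnj (torus_char n x) *s \<psi> x)"

definition Dirac_trunc :: "(int^'d) set \<Rightarrow> ('d \<Rightarrow> complex^'s^'s) \<Rightarrow> ('d::finite, 's::finite) spinor \<Rightarrow> ('d::finite, 's::finite) spinor" where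
  "Dirac_trunc \<Delta> \<gamma> \<psi> = orthogonal_projection (trig_spinors \<Delta>) (Dirac \<gamma> \<psi>)"

text \<open>Matrices with rows and columns indexed by \<open>\<Delta>\<close> are functions on pairs vanishing
  outside \<open>\<Delta> \<times> \<Delta>\<close>.\<close>

definition toeplitz :: "(int^'d) set \<Rightarrow> ((int^'d) \<times> (int^'d) \<Rightarrow> complex) set" where
  "toeplitz \<Delta> = {T. \<exists>t. \<forall>k l. T (k, l) = (if k \<in> \<Delta> \<and> l \<in> \<Delta> then t (k - l) else 0)}"

definition identity_matrix :: "(int^'d) set \<Rightarrow> (int^'d) \<times> (int^'d) \<Rightarrow> complex" where
  "identity_matrix \<Delta> = (\<lambda>(k, l). if k \<in> \<Delta> \<and> k = l then 1 else 0)"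

text \<open>\<open>T \<otimes> 1\<close> on the span of the characters indexed by \<open>\<Delta>\<close>, tensored with the fibre.\<close>

definition matrix_op :: "(int^'d) set \<Rightarrow> ((int^'d) \<times> (int^'d) \<Rightarrow> complex) \<Rightarrow> ('d::finite, 's::finite) spinor \<Rightarrow> ('d::finite, 's::finite) spinor" where
  "matrix_op \<Delta> T \<psi> x =
     (\<Sum>k\<in>\<Delta>. \<Sum>l\<in>\<Delta>. (T (k, l) * torus_char k x) *s fourier_coeff \<psi> l)"

section \<open>Unital completely positive maps\<close>

text \<open>An operator system is given by a linear space \<open>E\<close> of complex functions (the elements of
  the function algebra, or matrices), its unit \<open>u\<close>, and a representation \<open>\<pi>\<close> of \<open>E\<close> by operators
  on \<open>H\<close>.  A matrix over \<open>E\<close> is positive if it is positive as an operator on a finite direct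
  sum of copies of \<open>H\<close>.\<close>

definition matrix_positive ::
    "('e \<Rightarrow> ('d::finite, 's::finite) spinor \<Rightarrow> ('d::finite, 's::finite) spinor) \<Rightarrow> ('d::finite, 's::finite) spinor set \<Rightarrow> nat \<Rightarrow> (nat \<Rightarrow> nat \<Rightarrow> 'e) \<Rightarrow> bool" where
  "matrix_positive \<pi> H n a \<longleftrightarrow>
     (\<forall>\<xi>. (\<forall>i<n. \<xi> i \<in> H) \<longrightarrow>
        (\<Sum>i<n. \<Sum>j<n. spinor_inner (\<pi> (a i j) (\<xi> j)) (\<xi> i)) \<in> \<real>\<^sub>\<ge>\<^sub>0)"

definition operator_matrix_positive :: "nat \<Rightarrow> (nat \<Rightarrow> nat \<Rightarrow> 'k::complex_hilbert_space \<Rightarrow>\<^sub>L 'k) \<Rightarrow> bool" where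
  "operator_matrix_positive n b \<longleftrightarrow>
     (\<forall>\<eta>. (\<Sum>i<n. \<Sum>j<n. cinner (blinfun_apply (b i j) (\<eta> j)) (\<eta> i)) \<in> \<real>\<^sub>\<ge>\<^sub>0)"

definition ucp_maps ::
    "('i \<Rightarrow> complex) set \<Rightarrow> ('i \<Rightarrow> complex) \<Rightarrow> (('i \<Rightarrow> complex) \<Rightarrow> ('d::finite, 's::finite) spinor \<Rightarrow> ('d::finite, 's::finite) spinor) \<Rightarrow>
     ('d::finite, 's::finite) spinor set \<Rightarrow> (('i \<Rightarrow> complex) \<Rightarrow> 'k::complex_hilbert_space \<Rightarrow>\<^sub>L 'k) set" where
  "ucp_maps E u \<pi> H = {\<phi> \<in> E \<rightarrow>\<^sub>E bounded_operators.
     (\<forall>f\<in>E. \<forall>g\<in>E. \<forall>\<alpha> \<beta> x. blinfun_apply (\<phi> (\<lambda>i. \<alpha> * f i + \<beta> * g i)) x =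
        \<alpha> *\<^sub>C blinfun_apply (\<phi> f) x + \<beta> *\<^sub>C blinfun_apply (\<phi> g) x) \<and>
     \<phi> u = id_blinfun \<and>
     (\<forall>n a. (\<forall>i<n. \<forall>j<n. a i j \<in> E) \<longrightarrow> matrix_positive \<pi> H n a \<longrightarrow>
        operator_matrix_positive n (\<lambda>i j. \<phi> (a i j)))}"

text \<open>Only \<open>k 1, k 2, \<dots>\<close> are used; the value \<open>k 0\<close> is irrelevant.  If these vectors lie in the unit ball,
  the supremum is over a bounded set because unital completely positive maps are contractive.\<close>

definition ucp_dist ::
    "(nat \<Rightarrow> 'k::complex_hilbert_space) \<Rightarrow> 'e set \<Rightarrow> ('e \<Rightarrow> ennreal) \<Rightarrow> ('e \<Rightarrow> ennreal) \<Rightarrow>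
     ('e \<Rightarrow> 'k \<Rightarrow>\<^sub>L 'k) \<Rightarrow> ('e \<Rightarrow> 'k \<Rightarrow>\<^sub>L 'k) \<Rightarrow> real" where
  "ucp_dist k E nrm nrm1 \<phi> \<psi> =
     (SUP f\<in>{f \<in> E. nrm f \<le> 1 \<and> nrm1 f \<le> 1}.
        \<Sum>p. 1 / 2 ^ Suc p * cmod (cinner (blinfun_apply (\<phi> f - \<psi> f) (k (Suc p))) (k (Suc p))))"

definition UCP_torus ::
    "'s::finite itself \<Rightarrow> ((real^'d \<Rightarrow> complex) \<Rightarrow> 'k::complex_hilbert_space \<Rightarrow>\<^sub>L 'k) set" where
  "UCP_torus _ = ucp_maps torus_continuous (\<lambda>_. 1) mult_op (L2_spinors :: ('d::finite, 's::finite) spinor set)"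

text \<open>For smooth \<open>f\<close> the commutator is taken on the smooth spinors, a core of the Dirac operator
  that is invariant under multiplication by \<open>f\<close>; its bounded extension has the same norm.\<close>

definition dist_torus :: "('d \<Rightarrow> complex^'s^'s) \<Rightarrow> (nat \<Rightarrow> 'k::complex_hilbert_space) \<Rightarrow>
    ((real^'d \<Rightarrow> complex) \<Rightarrow> 'k \<Rightarrow>\<^sub>L 'k) \<Rightarrow> ((real^'d \<Rightarrow> complex) \<Rightarrow> 'k \<Rightarrow>\<^sub>L 'k) \<Rightarrow> real" where
  "dist_torus \<gamma> k = ucp_dist k torus_smooth
     (\<lambda>f. operator_norm (L2_spinors :: ('d::finite, 's::finite) spinor set) (mult_op f))
     (\<lambda>f. operator_norm smooth_spinors (commutator (Dirac \<gamma>) (mult_op f)))"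

definition UCP_toeplitz :: "'s::finite itself \<Rightarrow> (int^'d) set \<Rightarrow>
    (((int^'d) \<times> (int^'d) \<Rightarrow> complex) \<Rightarrow> 'k::complex_hilbert_space \<Rightarrow>\<^sub>L 'k) set" where
  "UCP_toeplitz _ \<Delta> = ucp_maps (toeplitz \<Delta>) (identity_matrix \<Delta>) (matrix_op \<Delta>)
     (trig_spinors \<Delta> :: ('d::finite, 's::finite) spinor set)"

definition dist_toeplitz :: "('d \<Rightarrow> complex^'s^'s) \<Rightarrow> (nat \<Rightarrow> 'k::complex_hilbert_space) \<Rightarrow> (int^'d) set \<Rightarrow>
    (((int^'d) \<times> (int^'d) \<Rightarrow> complex) \<Rightarrow> 'k \<Rightarrow>\<^sub>L 'k) \<Rightarrow> (((int^'d) \<times> (int^'d) \<Rightarrow> complex) \<Rightarrow> 'k \<Rightarrow>\<^sub>L 'k) \<Rightarrow> real" where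
  "dist_toeplitz \<gamma> k \<Delta> = ucp_dist k (toeplitz \<Delta>)
     (\<lambda>T. operator_norm (trig_spinors \<Delta> :: ('d::finite, 's::finite) spinor set) (matrix_op \<Delta> T))
     (\<lambda>T. operator_norm (trig_spinors \<Delta>) (commutator (Dirac_trunc \<Delta> \<gamma>) (matrix_op \<Delta> T)))"

section \<open>Gromov-Hausdorff distance\<close>

definition hausdorff_distance :: "('a \<Rightarrow> 'a \<Rightarrow> real) \<Rightarrow> 'a set \<Rightarrow> 'a set \<Rightarrow> ennreal" where
  "hausdorff_distance d A B =
     max (SUP a\<in>A. INF b\<in>B. ennreal (d a b)) (SUP b\<in>B. INF a\<in>A. ennreal (d a b))"

definition isometric_embedding ::
    "('a \<Rightarrow> 'b) \<Rightarrow> 'a set \<Rightarrow> ('a \<Rightarrow> 'a \<Rightarrow> real) \<Rightarrow> 'b set \<Rightarrow> ('b \<Rightarrow> 'b \<Rightarrow> real) \<Rightarrow> bool" where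
  "isometric_embedding f X dX Z dZ \<longleftrightarrow>
     f ` X \<subseteq> Z \<and> (\<forall>x\<in>X. \<forall>y\<in>X. dZ (f x) (f y) = dX x y) \<and> inj_on f X"

text \<open>The ambient compact metric space ranges over all metrics on subsets of \<open>nat \<Rightarrow> real\<close>.  This
  is no restriction: a compact metric space is separable, hence has at most the cardinality of the
  continuum, so it is isometric to one of these.  The value is infinite if there is
  no embedding into a common compact metric space.\<close>

definition gromov_hausdorff ::
    "'a set \<Rightarrow> ('a \<Rightarrow> 'a \<Rightarrow> real) \<Rightarrow> 'b set \<Rightarrow> ('b \<Rightarrow> 'b \<Rightarrow> real) \<Rightarrow> ennreal" where
  "gromov_hausdorff X dX Y dY =
     Inf {hausdorff_distance dZ (f ` X) (g ` Y) | (Z :: (nat \<Rightarrow> real) set) dZ f g.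
       Metric_space Z dZ \<and> compact_space (Metric_space.mtopology Z dZ) \<and>
       isometric_embedding f X dX Z dZ \<and> isometric_embedding g Y dY Z dZ}"

end

theory Submission
  imports Defs
begin

text \<open>Write \<open>X\<^sub>N\<close> and \<open>X\<close> for the spaces of unital completely positive maps on the Toeplitz matrices
  over \<open>\<Delta> = \<Delta>\<^sub>N\<close> and on \<open>C(\<Omega>)\<close>.  The two operator systems are related by two unital completely
  positive maps.  Compression \<open>R f = Q f Q\<close> turns a function into the matrix of its Fourier coefficients
  at \<open>k - l\<close>.  In the other direction \<open>S T (x) = \<langle>T \<psi>\<^sub>x, \<psi>\<^sub>x\<rangle>\<close>, where \<open>\<psi>\<^sub>x\<close> is the normalised
  sum, translated by \<open>x\<close>, of the characters in a cube \<open>{0..<m}\<^sup>d\<close> contained in \<open>\<Delta>\<close>.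

  Both composites are averages against the Fejer kernel of the cube, \<open>F = m\<^sup>-\<^sup>d |\<Sum>\<^sub>a e\<^sub>a|\<^sup>2\<close>: \<open>S R f\<close> is the
  convolution of \<open>F\<close> with \<open>f\<close>, and \<open>R S T\<close> is the mean of the conjugates of \<open>T\<close> by the unitaries
  \<open>diag(e\<^sub>k(y))\<close>, weighted by \<open>F(y)\<close>.  The kernel is a probability density, and the mean of
  \<open>|1 - e\<^sup>i\<^sup>y|\<^sup>2\<close> over each coordinate \<open>y\<close> is \<open>2 / m\<close>, because a cube translated by a unit vector loses one of
  its \<open>m\<close> slices.  So averaging moves a function with partial derivatives bounded by one by at most \<open>3 d / \<surd>m\<close>
  (\<open>fejer_sum_lipschitz\<close>).  The Dirac operator enters here: anticommuting \<open>[D, f]\<close> or \<open>[D\<^sub>N, T]\<close> with one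
  gamma matrix isolates one partial derivative, hence the Lipschitz norm bounds each of them
  (\<open>norm_coefficient_le_clifford\<close>, \<open>compress_symbol_approx\<close>).

  Moreover \<open>R\<close> and \<open>S\<close> contract the norm as well as the Lipschitz norm (\<open>compress_ball\<close>, \<open>symbol_ball\<close>).
  Precomposition with \<open>R\<close> and \<open>S\<close> therefore gives nonexpansive maps \<open>p : X\<^sub>N \<rightarrow> X\<close> and \<open>q : X \<rightarrow> X\<^sub>N\<close> that are
  inverse to each other up to \<open>3 d / \<surd>m\<close>.  Such a pair defines a metric on the disjoint union in which the two
  spaces are close (\<open>gromov_hausdorff_le_approximate_inverse\<close>), and a compact space containing the union
  is obtained by completing it.  For this the union has to be totally bounded.  \<open>X\<^sub>N\<close> is, as its maps live on a
  finite-dimensional space and the metric is controlled by finitely many bounded coordinates up to a small error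
  (\<open>totally_bounded_UCP_toeplitz\<close>); \<open>X\<close> inherits the property through \<open>p\<close> and \<open>q\<close>.

  The bound depends on \<open>\<Delta>\<close> only through \<open>m\<close>.  As the origin is an interior point of the polyhedron, the
  \<open>N\<close>-dilation contains any given cube as soon as \<open>N\<close> is large.\<close>

section \<open>Gromov-Hausdorff distance of totally bounded spaces\<close>

definition metric_on :: "'a set \<Rightarrow> ('a \<Rightarrow> 'a \<Rightarrow> real) \<Rightarrow> bool" where
  "metric_on X d \<longleftrightarrow>
     (\<forall>x\<in>X. \<forall>y\<in>X. 0 \<le> d x y \<and> d x y = d y x \<and> (d x y = 0 \<longleftrightarrow> x = y)) \<and>
     (\<forall>x\<in>X. \<forall>y\<in>X. \<forall>z\<in>X. d x z \<le> d x y + d y z)"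

definition totally_bounded_on :: "'a set \<Rightarrow> ('a \<Rightarrow> 'a \<Rightarrow> real) \<Rightarrow> bool" where
  "totally_bounded_on X d \<longleftrightarrow> (\<forall>e>0. \<exists>F. finite F \<and> F \<subseteq> X \<and> (\<forall>x\<in>X. \<exists>y\<in>F. d x y < e))"

text \<open>A uniformly Cauchy sequence of bounded continuous functions converges uniformly, whatever the
  topology of the domain; below the domain is the discrete space \<open>nat\<close>.\<close>

lemma complete_bcontfun: "complete (UNIV :: ('a::topological_space \<Rightarrow>\<^sub>C 'b::complete_space) set)"
  unfolding complete_def
proof (intro allI impI)
  fix f :: "nat \<Rightarrow> 'a \<Rightarrow>\<^sub>C 'b" assume "(\<forall>n. f n \<in> UNIV) \<and> Cauchy f"
  then have "Cauchy f" by simp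
  have "uniformly_Cauchy_on UNIV (\<lambda>n. apply_bcontfun (f n))"
  proof (rule uniformly_Cauchy_onI)
    fix e :: real assume "e > 0"
    with \<open>Cauchy f\<close> obtain M where "\<forall>m\<ge>M. \<forall>n\<ge>M. dist (f m) (f n) < e" unfolding Cauchy_def by blast
    then show "\<exists>M. \<forall>x\<in>UNIV. \<forall>m\<ge>M. \<forall>n\<ge>M. dist (f m x) (f n x) < e"
      using dist_fun_lt_imp_dist_val_lt by blast
  qed
  then obtain g where "uniform_limit UNIV f g sequentially"
    by (meson Cauchy_uniformly_convergent uniformly_convergent_on_def)
  then obtain l where "f \<longlonglongrightarrow> l"
    by (rule uniform_limit_bcontfunE[of f g sequentially]) simp
  then show "\<exists>l\<in>UNIV. f \<longlonglongrightarrow> l" by (intro bexI[of _ l]) auto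
qed

text \<open>Passes from a compact set of bounded sequences, regarded as a type, to a metric space on a set
  of functions \<open>nat \<Rightarrow> real\<close>, the form in which the Gromov-Hausdorff distance quantifies over compact spaces.\<close>

lemma compact_space_apply_bcontfun:
  fixes Z :: "(nat \<Rightarrow>\<^sub>C real) set"
  assumes "compact Z"
  defines "dZ \<equiv> \<lambda>u v. dist (Bcontfun u) (Bcontfun v)"
  shows "Metric_space (apply_bcontfun ` Z) dZ"
    and "compact_space (Metric_space.mtopology (apply_bcontfun ` Z) dZ)"
proof -
  have dZ: "dZ (apply_bcontfun u) (apply_bcontfun v) = dist u v" for u v
    by (simp add: dZ_def apply_bcontfun_inverse)
  show M: "Metric_space (apply_bcontfun ` Z) dZ"
    by unfold_locales (auto simp: dZ_def dist_commute dist_triangle apply_bcontfun_inverse)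
  interpret Metric_space "apply_bcontfun ` Z" dZ by (rule M)
  show "compact_space mtopology"
    unfolding compact_space_sequentially
  proof (intro allI impI)
    fix \<sigma> :: "nat \<Rightarrow> nat \<Rightarrow> real" assume "range \<sigma> \<subseteq> apply_bcontfun ` Z"
    then have "\<forall>n. \<exists>z\<in>Z. \<sigma> n = apply_bcontfun z" by auto
    then obtain s where s: "\<And>n. s n \<in> Z" "\<And>n. \<sigma> n = apply_bcontfun (s n)" by metis
    obtain l r where l: "l \<in> Z" "strict_mono r" "(s \<circ> r) \<longlonglongrightarrow> l"
      using \<open>compact Z\<close> s(1) unfolding compact_eq_seq_compact_metric seq_compact_def by metis
    have "limitin mtopology (\<sigma> \<circ> r) (apply_bcontfun l) sequentially"
      unfolding limitin_metric
    proof (intro conjI allI impI)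
      fix e :: real assume "e > 0"
      with l(3) have "\<forall>\<^sub>F n in sequentially. dist ((s \<circ> r) n) l < e" by (rule tendstoD)
      then show "\<forall>\<^sub>F n in sequentially. (\<sigma> \<circ> r) n \<in> apply_bcontfun ` Z \<and>
          dZ ((\<sigma> \<circ> r) n) (apply_bcontfun l) < e"
        by eventually_elim (use s in \<open>auto simp: dZ\<close>)
    qed (use l in auto)
    then show "\<exists>l r. l \<in> apply_bcontfun ` Z \<and> strict_mono r \<and> limitin mtopology (\<sigma> \<circ> r) l sequentially"
      using l by blast
  qed
qed

text \<open>The map \<open>x \<mapsto> (d x (s n))\<^sub>n\<close>, for a dense sequence \<open>s\<close>, is isometric into the bounded sequences:
  the triangle inequality gives one estimate and a point \<open>s n\<close> close to \<open>y\<close> the other.  The closure of the image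
  is complete and totally bounded.\<close>

lemma totally_bounded_embeds_in_compact:
  assumes X: "metric_on X d" and tb: "totally_bounded_on X d"
  obtains Z :: "(nat \<Rightarrow> real) set" and dZ f
    where "Metric_space Z dZ" "compact_space (Metric_space.mtopology Z dZ)"
      "isometric_embedding f X d Z dZ"
proof -
  have "\<forall>n. \<exists>F. finite F \<and> F \<subseteq> X \<and> (\<forall>x\<in>X. \<exists>y\<in>F. d x y < 1 / real (Suc n))"
    using tb unfolding totally_bounded_on_def by simp
  then obtain F where F: "\<And>n. finite (F n)" "\<And>n. F n \<subseteq> X"
      "\<And>n x. x \<in> X \<Longrightarrow> \<exists>y\<in>F n. d x y < 1 / real (Suc n)" by metis
  define A where "A = (\<Union>n. F n)"
  define s where "s = from_nat_into A"
  have cA: "countable A" unfolding A_def using F(1) by (auto intro: countable_finite)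
  have AX: "A \<subseteq> X" using F(2) A_def by auto
  have sX: "s n \<in> X" if "x \<in> X" for x n
  proof -
    have "A \<noteq> {}" using F(3)[OF that, of 0] A_def by auto
    then show ?thesis unfolding s_def using AX by (meson from_nat_into subsetD)
  qed
  have nonneg: "0 \<le> d x y" if "x \<in> X" "y \<in> X" for x y using X that by (auto simp: metric_on_def)
  have sym: "d x y = d y x" if "x \<in> X" "y \<in> X" for x y using X that unfolding metric_on_def by blast
  have zero: "d x y = 0 \<longleftrightarrow> x = y" if "x \<in> X" "y \<in> X" for x y
    using X that by (auto simp: metric_on_def)
  have tri: "d x z \<le> d x y + d y z" if "x \<in> X" "y \<in> X" "z \<in> X" for x y z
    using X that by (auto simp: metric_on_def)
  have dense: "\<exists>n. d x (s n) < e" if x: "x \<in> X" and "e > 0" for x e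
  proof -
    obtain n where n: "1 / real (Suc n) < e" using \<open>e > 0\<close> by (metis nat_approx_posE)
    obtain y where y: "y \<in> F n" "d x y < 1 / real (Suc n)" using F(3)[OF x] by blast
    then have "y \<in> A" by (auto simp: A_def)
    then obtain m where "s m = y" unfolding s_def using cA by (metis from_nat_into_surj)
    with y n show ?thesis by (intro exI[of _ m]) auto
  qed
  define g where "g x = Bcontfun (\<lambda>n. d x (s n))" for x
  have close: "\<bar>d x (s n) - d y (s n)\<bar> \<le> d x y" if "x \<in> X" "y \<in> X" for x y n
    using tri[of x y "s n"] tri[of y x "s n"] sym[of x y] sX[OF that(1)] that by auto
  have app: "apply_bcontfun (g x) = (\<lambda>n. d x (s n))" if x: "x \<in> X" for x
  proof -
    define B where "B = Max (insert 0 ((\<lambda>y. d x y) ` F 0))"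
    have "norm (d x (s n)) \<le> B + 1" for n
    proof -
      obtain y where y: "y \<in> F 0" "d (s n) y < 1" using F(3)[OF sX[OF x], of 0 n] by auto
      have "d x y \<le> B" unfolding B_def using F(1) y by (intro Max_ge) auto
      moreover have "d x (s n) \<le> d x y + d y (s n)" using tri x sX[OF x] y F(2) by blast
      moreover have "d y (s n) = d (s n) y" using sym sX[OF x] y F(2) by blast
      moreover have "0 \<le> d x (s n)" using nonneg x sX[OF x] by blast
      ultimately show ?thesis using y(2) by simp
    qed
    then have "(\<lambda>n. d x (s n)) \<in> bcontfun" by (intro bcontfun_normI) auto
    then show ?thesis unfolding g_def by (simp add: Bcontfun_inverse)
  qed
  have iso: "dist (g x) (g y) = d x y" if xy: "x \<in> X" "y \<in> X" for x y
  proof (rule antisym)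
    show "dist (g x) (g y) \<le> d x y"
      by (rule dist_bound) (use close that in \<open>simp add: app dist_real_def\<close>)
    show "d x y \<le> dist (g x) (g y)"
    proof (rule field_le_epsilon)
      fix e :: real assume "e > 0"
      obtain n where n: "d y (s n) < e / 2" using dense[of y "e / 2"] xy(2) \<open>e > 0\<close> half_gt_zero by blast
      have "d x y \<le> d x (s n) + d (s n) y" using tri that sX by blast
      moreover have "d (s n) y = d y (s n)" using sym that sX by blast
      moreover have "\<bar>d x (s n) - d y (s n)\<bar> \<le> dist (g x) (g y)"
        using dist_bounded[of "g x" n "g y"] that by (simp add: app dist_real_def)
      ultimately show "d x y \<le> dist (g x) (g y) + e" using n by linarith
    qed
  qed
  define Z where "Z = closure (g ` X)"
  have "compact Z"
    unfolding compact_eq_totally_bounded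
  proof (intro conjI allI impI)
    show "complete Z" unfolding Z_def by (rule complete_closed_subset[OF closed_closure subset_UNIV complete_bcontfun])
    fix e :: real assume "e > 0"
    then obtain G where G: "finite G" "G \<subseteq> X" "\<And>x. x \<in> X \<Longrightarrow> \<exists>y\<in>G. d x y < e / 2"
      using tb unfolding totally_bounded_on_def by (meson half_gt_zero)
    have "g ` X \<subseteq> (\<Union>y\<in>g ` G. cball y (e / 2))"
    proof clarify
      fix x assume x: "x \<in> X"
      then obtain y where y: "y \<in> G" "d x y < e / 2" using G(3) by blast
      then have "dist (g x) (g y) = d x y" using iso[OF x] G(2) by blast
      then have "dist (g y) (g x) \<le> e / 2" using y(2) by (simp only: dist_commute)
      then show "g x \<in> (\<Union>y\<in>g ` G. cball y (e / 2))" using y by auto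
    qed
    moreover have "closed (\<Union>y\<in>g ` G. cball y (e / 2))" using G(1) by auto
    ultimately have "Z \<subseteq> (\<Union>y\<in>g ` G. cball y (e / 2))" unfolding Z_def by (rule closure_minimal)
    also have "\<dots> \<subseteq> (\<Union>y\<in>g ` G. ball y e)" using \<open>e > 0\<close> by (auto simp: )
    finally show "\<exists>k. finite k \<and> Z \<subseteq> (\<Union>x\<in>k. ball x e)" using G(1) by blast
  qed
  from compact_space_apply_bcontfun[OF this] show ?thesis
  proof (rule that)
    show "isometric_embedding (apply_bcontfun \<circ> g) X d (apply_bcontfun ` Z)
       (\<lambda>u v. dist (Bcontfun u) (Bcontfun v))"
      unfolding isometric_embedding_def
    proof (intro conjI ballI)
      show "(apply_bcontfun \<circ> g) ` X \<subseteq> apply_bcontfun ` Z"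
        unfolding Z_def using closure_subset[of "g ` X"] by auto
      show "inj_on (apply_bcontfun \<circ> g) X"
      proof (rule inj_onI)
        fix x y assume "x \<in> X" "y \<in> X" "(apply_bcontfun \<circ> g) x = (apply_bcontfun \<circ> g) y"
        then have "g x = g y" by (simp add: apply_bcontfun_inject)
        with iso[of x y] zero[of x y] \<open>x \<in> X\<close> \<open>y \<in> X\<close> show "x = y" by simp
      qed
    qed (use iso in \<open>auto simp: apply_bcontfun_inverse\<close>)
  qed
qed

text \<open>The maps glue the spaces: put \<open>D x y = max (dY (p x) y) (dX x (q y)) + e\<close> for \<open>x\<close> in \<open>X\<close> and \<open>y\<close> in
  \<open>Y\<close>.  The triangle inequality holds since \<open>p\<close> and \<open>q\<close> are nonexpansive, the summand \<open>e\<close> keeps points of \<open>X\<close>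
  and \<open>Y\<close> apart, and \<open>x\<close> has distance at most \<open>2 * e\<close> from \<open>p x\<close>, as has \<open>y\<close> from \<open>q y\<close>.\<close>

lemma gromov_hausdorff_le_approximate_inverse:
  assumes X: "metric_on X dX" "totally_bounded_on X dX"
    and Y: "metric_on Y dY" "totally_bounded_on Y dY"
    and p: "\<And>x. x \<in> X \<Longrightarrow> p x \<in> Y" "\<And>x x'. x \<in> X \<Longrightarrow> x' \<in> X \<Longrightarrow> dY (p x) (p x') \<le> dX x x'"
    and q: "\<And>y. y \<in> Y \<Longrightarrow> q y \<in> X" "\<And>y y'. y \<in> Y \<Longrightarrow> y' \<in> Y \<Longrightarrow> dX (q y) (q y') \<le> dY y y'"
    and qp: "\<And>x. x \<in> X \<Longrightarrow> dX x (q (p x)) \<le> e"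
    and pq: "\<And>y. y \<in> Y \<Longrightarrow> dY (p (q y)) y \<le> e"
    and e: "e > 0"
  shows "gromov_hausdorff X dX Y dY \<le> ennreal (2 * e)"
proof -
  define D where "D u v = (case (u, v) of
      (Inl x, Inl x') \<Rightarrow> dX x x' | (Inr y, Inr y') \<Rightarrow> dY y y'
    | (Inl x, Inr y) \<Rightarrow> max (dY (p x) y) (dX x (q y)) + e
    | (Inr y, Inl x) \<Rightarrow> max (dY (p x) y) (dX x (q y)) + e)" for u v
  have D[simp]: "D (Inl x) (Inl x') = dX x x'" "D (Inr y) (Inr y') = dY y y'"
      "D (Inl x) (Inr y) = max (dY (p x) y) (dX x (q y)) + e"
      "D (Inr y) (Inl x) = max (dY (p x) y) (dX x (q y)) + e" for x x' y y'
    by (simp_all add: D_def)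
  let ?S = "Inl ` X \<union> Inr ` Y"
  have X1: "0 \<le> dX x y" "dX x y = dX y x" "dX x y = 0 \<longleftrightarrow> x = y" if "x \<in> X" "y \<in> X" for x y
    using X(1) that unfolding metric_on_def by blast+
  have X2: "dX x z \<le> dX x y + dX y z" if "x \<in> X" "y \<in> X" "z \<in> X" for x y z
    using X(1) that unfolding metric_on_def by blast
  have Y1: "0 \<le> dY x y" "dY x y = dY y x" "dY x y = 0 \<longleftrightarrow> x = y" if "x \<in> Y" "y \<in> Y" for x y
    using Y(1) that unfolding metric_on_def by blast+
  have Y2: "dY x z \<le> dY x y + dY y z" if "x \<in> Y" "y \<in> Y" "z \<in> Y" for x y z
    using Y(1) that unfolding metric_on_def by blast
  have t1: "max (dY (p x) y) (dX x (q y)) \<le> dX x x' + max (dY (p x') y) (dX x' (q y))"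
    if "x \<in> X" "x' \<in> X" "y \<in> Y" for x x' y
    using Y2[of "p x" "p x'" y] X2[of x x' "q y"] p(1)[of x] p(1)[of x'] p(2)[of x x'] q(1)[of y] that
    by auto
  have t2: "max (dY (p x) y) (dX x (q y)) \<le> max (dY (p x) y') (dX x (q y')) + dY y' y"
    if "x \<in> X" "y' \<in> Y" "y \<in> Y" for x y' y
    using Y2[of "p x" y' y] X2[of x "q y'" "q y"] p(1)[of x] q(1)[of y] q(1)[of y'] q(2)[of y' y] that
    by auto
  have t3: "dX x x' \<le> max (dY (p x) y) (dX x (q y)) + max (dY (p x') y) (dX x' (q y))"
    if "x \<in> X" "x' \<in> X" "y \<in> Y" for x x' y
    using X2[of x "q y" x'] X1(2)[of "q y" x'] q(1)[of y] that by auto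
  have t4: "dY y y' \<le> max (dY (p x) y) (dX x (q y)) + max (dY (p x) y') (dX x (q y'))"
    if "x \<in> X" "y' \<in> Y" "y \<in> Y" for x y' y
    using Y2[of y "p x" y'] Y1(2)[of "p x" y] p(1)[of x] that by auto
  have nn: "0 \<le> max (dY (p x) y) (dX x (q y))" if "x \<in> X" "y \<in> Y" for x y
    using Y1(1)[of "p x" y] p that by (simp add: le_max_iff_disj)
  have pos: "0 < max (dY (p x) y) (dX x (q y)) + e" if "x \<in> X" "y \<in> Y" for x y
    using nn[OF that] e by linarith
  have "metric_on ?S D"
    unfolding metric_on_def
  proof (intro conjI ballI)
    fix u v assume u: "u \<in> ?S" and v: "v \<in> ?S"
    show "0 \<le> D u v" using u v e by (elim UnE imageE; hypsubst) (simp_all only: D X1 Y1 less_imp_le pos)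
    show "D u v = D v u" using u v by (elim UnE imageE; hypsubst) (simp_all only: D X1(2) Y1(2))
    show "D u v = 0 \<longleftrightarrow> u = v"
      using u v by (elim UnE imageE; hypsubst)
        (simp_all only: D X1(3) Y1(3) pos[THEN less_imp_neq, symmetric] sum.inject sum.distinct)
    fix w assume w: "w \<in> ?S"
    show "D u w \<le> D u v + D v w"
      using u v w
    proof (elim UnE imageE; hypsubst)
      fix x x' y assume "x \<in> X" "x' \<in> X" "y \<in> Y"
      then show "D (Inl x) (Inr y) \<le> D (Inl x) (Inl x') + D (Inl x') (Inr y)" using t1 by auto
      show "D (Inl x) (Inl x') \<le> D (Inl x) (Inr y) + D (Inr y) (Inl x')"
        using t3[of x x' y] \<open>x \<in> X\<close> \<open>x' \<in> X\<close> \<open>y \<in> Y\<close> e by simp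
      show "D (Inr y) (Inl x') \<le> D (Inr y) (Inl x) + D (Inl x) (Inl x')"
        using t1[of x' x y] X1(2)[of x x'] \<open>x \<in> X\<close> \<open>x' \<in> X\<close> \<open>y \<in> Y\<close> by simp
    next
      fix x y y' assume "x \<in> X" "y \<in> Y" "y' \<in> Y"
      then show "D (Inl x) (Inr y') \<le> D (Inl x) (Inr y) + D (Inr y) (Inr y')" using t2[of x y y'] by auto
      show "D (Inr y) (Inr y') \<le> D (Inr y) (Inl x) + D (Inl x) (Inr y')"
        using t4[of x y' y] \<open>x \<in> X\<close> \<open>y \<in> Y\<close> \<open>y' \<in> Y\<close> e by simp
      show "D (Inr y) (Inl x) \<le> D (Inr y) (Inr y') + D (Inr y') (Inl x)"
        using t2[of x y' y] Y1(2)[of y y'] \<open>x \<in> X\<close> \<open>y \<in> Y\<close> \<open>y' \<in> Y\<close> by simp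
    next
      fix x x' x'' assume "x \<in> X" "x' \<in> X" "x'' \<in> X"
      then show "D (Inl x) (Inl x'') \<le> D (Inl x) (Inl x') + D (Inl x') (Inl x'')"
        unfolding D by (rule X2)
    next
      fix y y' y'' assume "y \<in> Y" "y' \<in> Y" "y'' \<in> Y"
      then show "D (Inr y) (Inr y'') \<le> D (Inr y) (Inr y') + D (Inr y') (Inr y'')"
        unfolding D by (rule Y2)
    qed
  qed
  moreover have "totally_bounded_on ?S D"
    unfolding totally_bounded_on_def
  proof (intro allI impI)
    fix r :: real assume "r > 0"
    obtain F where F: "finite F" "F \<subseteq> X" "\<And>x. x \<in> X \<Longrightarrow> \<exists>y\<in>F. dX x y < r"
      using X(2)[unfolded totally_bounded_on_def, rule_format, OF \<open>r > 0\<close>] by auto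
    obtain G where G: "finite G" "G \<subseteq> Y" "\<And>x. x \<in> Y \<Longrightarrow> \<exists>y\<in>G. dY x y < r"
      using Y(2)[unfolded totally_bounded_on_def, rule_format, OF \<open>r > 0\<close>] by auto
    have "\<exists>v\<in>Inl ` F \<union> Inr ` G. D u v < r" if "u \<in> ?S" for u
      using that
    proof (elim UnE imageE)
      fix x assume "u = Inl x" "x \<in> X"
      with F(3)[of x] obtain x' where "x' \<in> F" "D u (Inl x') < r" by auto
      then show ?thesis by blast
    next
      fix y assume "u = Inr y" "y \<in> Y"
      with G(3)[of y] obtain y' where "y' \<in> G" "D u (Inr y') < r" by auto
      then show ?thesis by blast
    qed
    moreover have "finite (Inl ` F \<union> Inr ` G)" "Inl ` F \<union> Inr ` G \<subseteq> ?S" using F(1,2) G(1,2) by auto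
    ultimately show "\<exists>F. finite F \<and> F \<subseteq> ?S \<and> (\<forall>u\<in>?S. \<exists>v\<in>F. D u v < r)"
      by (intro exI[of _ "Inl ` F \<union> Inr ` G"] conjI ballI)
  qed
  ultimately obtain Z :: "(nat \<Rightarrow> real) set" and dZ h
    where Z: "Metric_space Z dZ" "compact_space (Metric_space.mtopology Z dZ)"
      and h: "isometric_embedding h ?S D Z dZ"
    by (rule totally_bounded_embeds_in_compact)
  have hD: "dZ (h u) (h v) = D u v" if "u \<in> ?S" "v \<in> ?S" for u v
    using h that unfolding isometric_embedding_def by blast
  have "isometric_embedding (h \<circ> Inl) X dX Z dZ"
    unfolding isometric_embedding_def
  proof (intro conjI ballI)
    show "inj_on (h \<circ> Inl) X"
      using h unfolding isometric_embedding_def by (intro comp_inj_on) (auto intro: inj_on_subset)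
  qed (use h in \<open>auto simp: isometric_embedding_def\<close>)
  moreover have "isometric_embedding (h \<circ> Inr) Y dY Z dZ"
    unfolding isometric_embedding_def
  proof (intro conjI ballI)
    show "inj_on (h \<circ> Inr) Y"
      using h unfolding isometric_embedding_def by (intro comp_inj_on) (auto intro: inj_on_subset)
  qed (use h in \<open>auto simp: isometric_embedding_def\<close>)
  ultimately have "gromov_hausdorff X dX Y dY \<le> hausdorff_distance dZ ((h \<circ> Inl) ` X) ((h \<circ> Inr) ` Y)"
    unfolding gromov_hausdorff_def using Z by (intro Inf_lower) blast
  also have "\<dots> \<le> ennreal (2 * e)"
    unfolding hausdorff_distance_def
  proof (rule max.boundedI; rule SUP_least)
    fix a assume "a \<in> (h \<circ> Inl) ` X"
    then obtain x where x: "x \<in> X" "a = h (Inl x)" by auto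
    have px: "p x \<in> Y" by (rule p(1)[OF x(1)])
    have "dZ a (h (Inr (p x))) = max 0 (dX x (q (p x))) + e"
      unfolding x(2) using Y1(3)[OF px px] x(1) px by (subst hD) simp_all
    also have "\<dots> \<le> 2 * e" using qp[OF x(1)] e by simp
    finally have "ennreal (dZ a (h (Inr (p x)))) \<le> ennreal (2 * e)" by (rule ennreal_leI)
    moreover have "h (Inr (p x)) \<in> (h \<circ> Inr) ` Y" using px by simp
    ultimately show "(INF b\<in>(h \<circ> Inr) ` Y. ennreal (dZ a b)) \<le> ennreal (2 * e)"
      by (rule INF_lower2[rotated])
  next
    fix b assume "b \<in> (h \<circ> Inr) ` Y"
    then obtain y where y: "y \<in> Y" "b = h (Inr y)" by auto
    have qy: "q y \<in> X" by (rule q(1)[OF y(1)])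
    have "dZ (h (Inl (q y))) b = max (dY (p (q y)) y) 0 + e"
      unfolding y(2) using X1(3)[OF qy qy] y(1) qy by (subst hD) simp_all
    also have "\<dots> \<le> 2 * e" using pq[OF y(1)] e by simp
    finally have "ennreal (dZ (h (Inl (q y))) b) \<le> ennreal (2 * e)" by (rule ennreal_leI)
    moreover have "h (Inl (q y)) \<in> (h \<circ> Inl) ` X" using qy by simp
    ultimately show "(INF a\<in>(h \<circ> Inl) ` X. ennreal (dZ a b)) \<le> ennreal (2 * e)"
      by (rule INF_lower2[rotated])
  qed
  finally show ?thesis .
qed

text \<open>Pigeonhole principle: cover the bounded range of each of the finitely many coordinates by small
  balls and choose one point for every combination of balls that occurs.\<close>

lemma totally_bounded_onI_coordinates:
  assumes "\<And>e. e > 0 \<Longrightarrow> \<exists>J (c :: 'j \<Rightarrow> 'a \<Rightarrow> complex) \<delta>. finite J \<and> \<delta> > 0 \<and>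
      (\<forall>j\<in>J. bounded (c j ` X)) \<and>
      (\<forall>x\<in>X. \<forall>y\<in>X. (\<forall>j\<in>J. dist (c j x) (c j y) < \<delta>) \<longrightarrow> d x y < e)"
  shows "totally_bounded_on X d"
  unfolding totally_bounded_on_def
proof (intro allI impI)
  fix e :: real assume "e > 0"
  then obtain J and c :: "'j \<Rightarrow> 'a \<Rightarrow> complex" and \<delta> where J: "finite J" and \<delta>: "\<delta> > 0"
    and b: "\<And>j. j \<in> J \<Longrightarrow> bounded (c j ` X)"
    and c: "\<And>x y. x \<in> X \<Longrightarrow> y \<in> X \<Longrightarrow> (\<forall>j\<in>J. dist (c j x) (c j y) < \<delta>) \<Longrightarrow> d x y < e"
    using assms[of e] by metis
  have "\<forall>j. \<exists>K. j \<in> J \<longrightarrow> finite K \<and> c j ` X \<subseteq> (\<Union>z\<in>K. ball z (\<delta> / 2))"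
  proof (intro allI)
    fix j
    have "\<exists>K. finite K \<and> closure (c j ` X) \<subseteq> (\<Union>z\<in>K. ball z (\<delta> / 2))" if "j \<in> J"
      using b[OF that] \<delta> compact_eq_totally_bounded[of "closure (c j ` X)"] by (simp add: compact_closure)
    then show "\<exists>K. j \<in> J \<longrightarrow> finite K \<and> c j ` X \<subseteq> (\<Union>z\<in>K. ball z (\<delta> / 2))"
      using closure_subset[of "c j ` X"] by blast
  qed
  then obtain K where K: "\<And>j. j \<in> J \<Longrightarrow> finite (K j)"
      "\<And>j. j \<in> J \<Longrightarrow> c j ` X \<subseteq> (\<Union>z\<in>K j. ball z (\<delta> / 2))" by metis
  define cell where "cell x = (\<lambda>j\<in>J. SOME z. z \<in> K j \<and> dist z (c j x) < \<delta> / 2)" for x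
  have cell: "cell x j \<in> K j \<and> dist (cell x j) (c j x) < \<delta> / 2" if "x \<in> X" "j \<in> J" for x j
  proof -
    have "c j x \<in> (\<Union>z\<in>K j. ball z (\<delta> / 2))" using K(2)[OF that(2)] that(1) by blast
    then have "\<exists>z. z \<in> K j \<and> dist z (c j x) < \<delta> / 2" by (simp add: mem_ball Bex_def)
    from someI_ex[OF this] show ?thesis using that by (simp add: cell_def)
  qed
  have "cell ` X \<subseteq> Pi\<^sub>E J K" using cell by (auto simp: cell_def)
  then have fin: "finite (cell ` X)" using J K(1) by (meson finite_PiE finite_subset)
  define rep where "rep u = (SOME x. x \<in> X \<and> cell x = u)" for u
  have rep: "rep (cell x) \<in> X \<and> cell (rep (cell x)) = cell x" if "x \<in> X" for x
    unfolding rep_def by (rule someI[of _ x]) (use that in auto)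
  show "\<exists>F. finite F \<and> F \<subseteq> X \<and> (\<forall>x\<in>X. \<exists>y\<in>F. d x y < e)"
  proof (intro exI[of _ "rep ` cell ` X"] conjI ballI)
    fix x assume x: "x \<in> X"
    have "dist (c j x) (c j (rep (cell x))) < \<delta>" if "j \<in> J" for j
      using cell[OF x that] cell[of "rep (cell x)" j] rep[OF x] that
        dist_triangle_half_r[of "cell x j" "c j x" \<delta> "c j (rep (cell x))"] by (auto simp: dist_commute)
    then have "d x (rep (cell x)) < e" using c x rep by blast
    then show "\<exists>y\<in>rep ` cell ` X. d x y < e" using x by blast
  qed (use fin rep in auto)
qed

text \<open>An approximate inverse carries a net of \<open>Y\<close> to a net of \<open>X\<close>.\<close>

lemma finite_cover_of_approximation:
  assumes X: "metric_on X dX" and Y: "totally_bounded_on Y dY"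
    and p: "\<And>x. x \<in> X \<Longrightarrow> p x \<in> Y"
    and q: "\<And>y. y \<in> Y \<Longrightarrow> q y \<in> X" "\<And>y y'. y \<in> Y \<Longrightarrow> y' \<in> Y \<Longrightarrow> dX (q y) (q y') \<le> dY y y'"
    and qp: "\<And>x. x \<in> X \<Longrightarrow> dX x (q (p x)) \<le> e" and e: "e > 0"
  shows "\<exists>F. finite F \<and> F \<subseteq> X \<and> (\<forall>x\<in>X. \<exists>y\<in>F. dX x y < 2 * e)"
proof -
  obtain G where G: "finite G" "G \<subseteq> Y" "\<And>y. y \<in> Y \<Longrightarrow> \<exists>z\<in>G. dY y z < e"
    using Y[unfolded totally_bounded_on_def, rule_format, OF e] by auto
  have "\<exists>z\<in>q ` G. dX x z < 2 * e" if x: "x \<in> X" for x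
  proof -
    obtain z where z: "z \<in> G" "dY (p x) z < e" using G(3)[OF p[OF x]] by blast
    then have zY: "z \<in> Y" using G(2) by blast
    have "dX x (q z) \<le> dX x (q (p x)) + dX (q (p x)) (q z)"
      using X x q(1)[OF p[OF x]] q(1)[OF zY] unfolding metric_on_def by blast
    moreover have "dX (q (p x)) (q z) \<le> dY (p x) z" by (rule q(2)[OF p[OF x] zY])
    ultimately have "dX x (q z) < 2 * e" using qp[OF x] z(2) by linarith
    then show ?thesis using z(1) by blast
  qed
  moreover have "finite (q ` G)" "q ` G \<subseteq> X" using G q(1) by auto
  ultimately show ?thesis by blast
qed

section \<open>Quadratic forms on a complex Hilbert space\<close>

lemma cinner_add_right: "cinner x (y + z) = cinner x y + cinner x z"
  by (metis cinner_add_left cinner_commute complex_cnj_add)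

lemma cinner_scaleC_right: "cinner x (a *\<^sub>C y) = cnj a * cinner x y"
  by (metis cinner_scaleC_left cinner_commute complex_cnj_mult)

lemma scaleC_minus1: "(-1) *\<^sub>C x = - x"
  using scaleC_of_real[of "-1" x] by simp

lemma cinner_minus_left: "cinner (- x) y = - cinner x y"
  using cinner_scaleC_left[of "-1" x y] by (simp add: scaleC_minus1)

lemma cinner_minus_right: "cinner x (- y) = - cinner x y"
  using cinner_scaleC_right[of x "-1" y] by (simp add: scaleC_minus1)

lemma cinner_diff_left: "cinner (x - y) z = cinner x z - cinner y z"
  using cinner_add_left[of x "- y" z] by (simp add: cinner_minus_left)

lemma cinner_diff_right: "cinner x (y - z) = cinner x y - cinner x z"
  using cinner_add_right[of x y "- z"] by (simp add: cinner_minus_right)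

lemma cinner_zero_left [simp]: "cinner 0 y = 0"
  using cinner_diff_left[of y y y] by simp

lemma cinner_Cauchy_Schwarz: "cmod (cinner x y) \<le> norm x * norm y"
proof (cases "y = 0")
  case True
  then show ?thesis using cinner_diff_right[of x y y] by simp
next
  case False
  define a where "a = complex_of_real ((norm y)\<^sup>2)"
  define b where "b = cinner x y"
  have yy: "cinner y y = a" unfolding a_def by (rule cinner_self)
  have yx: "cinner y x = cnj b" unfolding b_def by (rule cinner_commute)
  have "cinner (a *\<^sub>C x - b *\<^sub>C y) (a *\<^sub>C x - b *\<^sub>C y)
      = a * cnj a * cinner x x - a * cnj b * b - b * cnj a * cnj b + b * cnj b * a"
    by (simp add: cinner_diff_left cinner_diff_right cinner_scaleC_left cinner_scaleC_right yx yy
        flip: b_def) (simp add: algebra_simps)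
  also have "\<dots> = complex_of_real ((norm y)\<^sup>2 * ((norm y)\<^sup>2 * (norm x)\<^sup>2 - (cmod b)\<^sup>2))"
    unfolding a_def cinner_self[of x] of_real_mult of_real_diff complex_norm_square
    by (simp add: algebra_simps)
  finally have "(norm (a *\<^sub>C x - b *\<^sub>C y))\<^sup>2 = (norm y)\<^sup>2 * ((norm y)\<^sup>2 * (norm x)\<^sup>2 - (cmod b)\<^sup>2)"
    unfolding cinner_self of_real_eq_iff .
  then have "0 \<le> (norm y)\<^sup>2 * ((norm y)\<^sup>2 * (norm x)\<^sup>2 - (cmod b)\<^sup>2)" by (metis zero_le_power2)
  then have "(cmod b)\<^sup>2 \<le> (norm x * norm y)\<^sup>2"
    using False by (simp add: zero_le_mult_iff power_mult_distrib mult.commute)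
  then show ?thesis unfolding b_def by (simp add: power2_le_iff_abs_le)
qed

lemma bounded_bilinear_cinner: "bounded_bilinear (cinner :: 'k::complex_hilbert_space \<Rightarrow> _)"
proof
  fix r :: real and a b :: 'k
  show "cinner (r *\<^sub>R a) b = r *\<^sub>R cinner a b"
    by (simp add: cinner_scaleC_left scaleR_conv_of_real flip: scaleC_of_real)
  show "cinner a (r *\<^sub>R b) = r *\<^sub>R cinner a b"
    by (simp add: cinner_scaleC_right scaleR_conv_of_real flip: scaleC_of_real)
  show "\<exists>K. \<forall>a b :: 'k. norm (cinner a b) \<le> norm a * norm b * K"
    using cinner_Cauchy_Schwarz by (intro exI[of _ 1]) auto
qed (simp_all add: cinner_add_left cinner_add_right)

abbreviation qform :: "('k::complex_hilbert_space \<Rightarrow>\<^sub>L 'k) \<Rightarrow> 'k \<Rightarrow> complex" where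
  "qform A x \<equiv> cinner (blinfun_apply A x) x"

lemma qform_bound: "cmod (qform A x) \<le> norm A * (norm x)\<^sup>2"
proof -
  have "cmod (qform A x) \<le> norm (blinfun_apply A x) * norm x" by (rule cinner_Cauchy_Schwarz)
  also have "\<dots> \<le> norm A * norm x * norm x" by (intro mult_right_mono norm_blinfun) simp
  finally show ?thesis by (simp add: power2_eq_square mult.assoc)
qed

lemma qform_diff: "qform (A - B) x = qform A x - qform B x"
  by (simp add: blinfun.diff_left cinner_diff_left)

text \<open>Polarisation.  Complex linearity is essential: replacing \<open>y\<close> by \<open>\<i> y\<close> separates the two mixed
  terms.\<close>

lemma operator_eqI_qform:
  assumes A: "A \<in> bounded_operators" and B: "B \<in> bounded_operators"
    and eq: "\<And>x. qform A x = qform B x"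
  shows "A = B"
proof (rule blinfun_eqI)
  fix x
  define C where "C = A - B"
  have lin: "blinfun_apply C (c *\<^sub>C x) = c *\<^sub>C blinfun_apply C x" for c x
  proof -
    have "c *\<^sub>C (u - v) = c *\<^sub>C u - c *\<^sub>C v" for u v :: 'a
      using scaleC_add_right[of c "u - v" v] by (simp add: algebra_simps)
    then show ?thesis using A B by (simp add: C_def blinfun.diff_left bounded_operators_def)
  qed
  have z: "qform C x = 0" for x using eq[of x] by (simp add: C_def qform_diff)
  define y where "y = blinfun_apply C x"
  have 1: "cinner (blinfun_apply C x) y + cinner (blinfun_apply C y) x = 0"
    using z[of "x + y"] by (simp add: blinfun.add_right cinner_add_left cinner_add_right z add.commute)
  have 2: "cnj \<i> * cinner (blinfun_apply C x) y + \<i> * cinner (blinfun_apply C y) x = 0"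
    using z[of "x + \<i> *\<^sub>C y"]
    by (simp add: blinfun.add_right lin cinner_add_left cinner_add_right z
        cinner_scaleC_left cinner_scaleC_right add.commute)
  have "cinner (blinfun_apply C x) y = 0" using 1 2 by (auto simp: complex_eq_iff)
  then have "blinfun_apply C x = 0" by (simp add: y_def cinner_self)
  then show "blinfun_apply A x = blinfun_apply B x" by (simp add: C_def blinfun.diff_left)
qed

lemma qform_eq_0_of_dense:
  assumes dense: "closure (k ` {1..}) = cball 0 1"
    and z: "\<And>p. p \<ge> (1::nat) \<Longrightarrow> qform A (k p) = 0"
  shows "qform A x = 0"
proof -
  interpret cinner: bounded_bilinear "cinner :: 'a \<Rightarrow> _" by (rule bounded_bilinear_cinner)
  have cont: "continuous_on UNIV (qform A)"
    by (intro cinner.continuous_on continuous_intros)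
  have ball: "qform A y = 0" if "norm y \<le> 1" for y
  proof -
    have y: "y \<in> closure (k ` {1..})" using dense that by simp
    have c: "continuous_on (closure (k ` {1..})) (qform A)"
      using cont by (rule continuous_on_subset) simp
    have e: "qform A w = 0" if w: "w \<in> k ` {1..}" for w
    proof -
      obtain p where "p \<ge> 1" "w = k p" using w by auto
      have "qform A (k p) = 0" by (rule z) fact
      then show ?thesis unfolding \<open>w = k p\<close> .
    qed
    show ?thesis by (rule continuous_constant_on_closure[OF c e y])
  qed
  define y where "y = inverse (norm x) *\<^sub>R x"
  have "norm y \<le> 1" by (cases "x = 0") (auto simp: y_def)
  have "x = norm x *\<^sub>R y" by (cases "x = 0") (auto simp: y_def)
  then have "qform A x = qform A (norm x *\<^sub>R y)" by (rule arg_cong)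
  also have "\<dots> = norm x *\<^sub>R norm x *\<^sub>R qform A y"
    unfolding blinfun.scaleR_right cinner.scaleR_left cinner.scaleR_right ..
  finally show ?thesis using ball[OF \<open>norm y \<le> 1\<close>] by simp
qed

text \<open>The contribution of one element of the operator system to the distance of two maps; \<open>A\<close> is the
  difference of their values there.\<close>

definition weighted_form :: "(nat \<Rightarrow> 'k::complex_hilbert_space) \<Rightarrow> ('k \<Rightarrow>\<^sub>L 'k) \<Rightarrow> real" where
  "weighted_form k A = (\<Sum>p. 1 / 2 ^ Suc p * cmod (qform A (k (Suc p))))"

context
  fixes k :: "nat \<Rightarrow> 'k::complex_hilbert_space"
  assumes k: "\<And>p. p \<ge> 1 \<Longrightarrow> norm (k p) \<le> 1"
begin

lemma qform_k_le:
  assumes "\<And>x. cmod (qform A x) \<le> M * (norm x)\<^sup>2" "0 \<le> M"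
  shows "cmod (qform A (k (Suc p))) \<le> M"
proof -
  have "(norm (k (Suc p)))\<^sup>2 \<le> 1" using k[of "Suc p"] by (simp add: power_le_one)
  then have "M * (norm (k (Suc p)))\<^sup>2 \<le> M" using assms(2) by (rule mult_left_le)
  with assms(1)[of "k (Suc p)"] show ?thesis by (rule order_trans)
qed

lemma summable_weighted_form: "summable (\<lambda>p. 1 / 2 ^ Suc p * cmod (qform A (k (Suc p))))"
proof (rule summable_comparison_test')
  show "summable (\<lambda>p. norm A * (1 / 2) ^ Suc p)"
    using power_half_series by (intro summable_mult) (auto simp: sums_iff)
  show "norm (1 / 2 ^ Suc p * cmod (qform A (k (Suc p)))) \<le> norm A * (1 / 2) ^ Suc p" if "0 \<le> p" for p
    using qform_k_le[OF qform_bound norm_ge_zero, of A p] by (simp add: power_divide divide_right_mono)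
qed

lemma weighted_form_nonneg: "0 \<le> weighted_form k A"
  unfolding weighted_form_def by (intro suminf_nonneg summable_weighted_form) simp

lemma weighted_form_le:
  assumes "\<And>x. cmod (qform A x) \<le> M * (norm x)\<^sup>2" "0 \<le> M"
  shows "weighted_form k A \<le> M"
proof -
  have "weighted_form k A \<le> (\<Sum>p. M * (1 / 2) ^ Suc p)"
    unfolding weighted_form_def
    using power_half_series qform_k_le[OF assms]
    by (intro suminf_le summable_weighted_form summable_mult)
      (auto simp: sums_iff power_divide divide_right_mono)
  also have "\<dots> = M" using power_half_series by (subst suminf_mult) (auto simp: sums_iff)
  finally show ?thesis .
qed

text \<open>Finitely many terms, and a geometric bound for the tail that is uniform in \<open>A\<close>.\<close>

lemma weighted_form_le_partial:
  assumes "\<And>x. cmod (qform A x) \<le> M * (norm x)\<^sup>2" "0 \<le> M"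
  shows "weighted_form k A \<le> (\<Sum>p<P. cmod (qform A (k (Suc p)))) + M / 2 ^ P"
proof -
  let ?t = "\<lambda>p. 1 / 2 ^ Suc p * cmod (qform A (k (Suc p)))"
  have "weighted_form k A = (\<Sum>p. ?t (p + P)) + (\<Sum>p<P. ?t p)"
    unfolding weighted_form_def by (rule suminf_split_initial_segment[OF summable_weighted_form])
  moreover have "(\<Sum>p. ?t (p + P)) \<le> (\<Sum>p. M / 2 ^ P * (1 / 2) ^ Suc p)"
  proof (rule suminf_le)
    show "?t (p + P) \<le> M / 2 ^ P * (1 / 2) ^ Suc p" for p
      using qform_k_le[OF assms, of "p + P"]
      by (simp add: power_add field_simps)
    show "summable (\<lambda>p. ?t (p + P))"
      using summable_weighted_form by (subst summable_iff_shift)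
    show "summable (\<lambda>p. M / 2 ^ P * (1 / 2) ^ Suc p)"
      using power_half_series by (intro summable_mult) (auto simp: sums_iff)
  qed
  moreover have "(\<Sum>p. M / 2 ^ P * (1 / 2) ^ Suc p) = M / 2 ^ P"
    using power_half_series by (subst suminf_mult) (auto simp: sums_iff)
  moreover have "(\<Sum>p<P. ?t p) \<le> (\<Sum>p<P. cmod (qform A (k (Suc p))))"
  proof (rule sum_mono)
    fix p
    have "(1::real) \<le> 2 ^ Suc p" by (rule one_le_power) simp
    then show "?t p \<le> cmod (qform A (k (Suc p)))"
      by (intro mult_left_le_one_le) (auto simp: field_simps simp del: power_Suc)
  qed
  ultimately show ?thesis by linarith
qed

lemma weighted_form_triangle: "weighted_form k (A - C) \<le> weighted_form k (A - B) + weighted_form k (B - C)"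
  unfolding weighted_form_def suminf_add[OF summable_weighted_form summable_weighted_form]
proof (intro suminf_le summable_weighted_form summable_add)
  fix p
  have "cmod (qform (A - C) (k (Suc p))) \<le> cmod (qform (A - B) (k (Suc p))) + cmod (qform (B - C) (k (Suc p)))"
    by (simp add: qform_diff) (metis diff_add_cancel add_diff_eq norm_triangle_ineq)
  then show "1 / 2 ^ Suc p * cmod (qform (A - C) (k (Suc p)))
      \<le> 1 / 2 ^ Suc p * cmod (qform (A - B) (k (Suc p))) + 1 / 2 ^ Suc p * cmod (qform (B - C) (k (Suc p)))"
    by (simp add: divide_right_mono flip: add_divide_distrib)
qed

lemma weighted_form_commute: "weighted_form k (A - B) = weighted_form k (B - A)"
  by (simp add: weighted_form_def qform_diff norm_minus_commute)

lemma weighted_form_eq_0D: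
  assumes "weighted_form k A = 0" "p \<ge> 1"
  shows "qform A (k p) = 0"
proof -
  obtain q where p: "p = Suc q" using \<open>p \<ge> 1\<close> by (cases p) auto
  have "\<forall>n. 1 / 2 ^ Suc n * cmod (qform A (k (Suc n))) = 0"
    using assms(1) unfolding weighted_form_def
    by (subst (asm) suminf_eq_zero_iff[OF summable_weighted_form]) auto
  then show ?thesis by (simp add: p)
qed

section \<open>The metric on unital completely positive maps\<close>

context
  fixes X :: "('e \<Rightarrow> 'k \<Rightarrow>\<^sub>L 'k) set" and E :: "'e set" and nrm nrm1 :: "'e \<Rightarrow> ennreal"
  assumes bound: "\<And>\<phi> f x. \<phi> \<in> X \<Longrightarrow> f \<in> E \<Longrightarrow> nrm f \<le> 1 \<Longrightarrow> cmod (qform (\<phi> f) x) \<le> (norm x)\<^sup>2"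
begin

lemma weighted_form_le_ucp_dist:
  assumes "\<phi> \<in> X" "\<psi> \<in> X" "f \<in> E" "nrm f \<le> 1" "nrm1 f \<le> 1"
  shows "weighted_form k (\<phi> f - \<psi> f) \<le> ucp_dist k E nrm nrm1 \<phi> \<psi>"
  unfolding ucp_dist_def weighted_form_def[symmetric]
proof (rule cSUP_upper)
  show "bdd_above ((\<lambda>f. weighted_form k (\<phi> f - \<psi> f)) ` {f \<in> E. nrm f \<le> 1 \<and> nrm1 f \<le> 1})"
  proof (rule bdd_aboveI2)
    fix f assume "f \<in> {f \<in> E. nrm f \<le> 1 \<and> nrm1 f \<le> 1}"
    then have "cmod (qform (\<phi> f - \<psi> f) x) \<le> 2 * (norm x)\<^sup>2" for x
      using bound[OF assms(1), of f x] bound[OF assms(2), of f x]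
        norm_triangle_ineq4[of "qform (\<phi> f) x" "qform (\<psi> f) x"] by (simp add: qform_diff)
    then show "weighted_form k (\<phi> f - \<psi> f) \<le> 2" by (rule weighted_form_le) simp
  qed
qed (use assms in auto)

end

end

lemma ucp_dist_least:
  assumes "f0 \<in> E" "nrm f0 \<le> 1" "nrm1 f0 \<le> 1"
    and "\<And>f. f \<in> E \<Longrightarrow> nrm f \<le> 1 \<Longrightarrow> nrm1 f \<le> 1 \<Longrightarrow> weighted_form k (\<phi> f - \<psi> f) \<le> e"
  shows "ucp_dist k E nrm nrm1 \<phi> \<psi> \<le> e"
  unfolding ucp_dist_def weighted_form_def[symmetric]
  by (rule cSUP_least) (use assms in auto)

text \<open>The maps are contractive, so the supremum is finite; it vanishes only for equal maps if the unit
  ball for the two norms is large enough to separate them.\<close>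

lemma metric_on_ucp_dist:
  fixes X :: "('e \<Rightarrow> 'k::complex_hilbert_space \<Rightarrow>\<^sub>L 'k) set"
  assumes k: "\<And>p. p \<ge> 1 \<Longrightarrow> norm (k p) \<le> 1"
    and bound: "\<And>\<phi> f x. \<phi> \<in> X \<Longrightarrow> f \<in> E \<Longrightarrow> nrm f \<le> 1 \<Longrightarrow> cmod (qform (\<phi> f) x) \<le> (norm x)\<^sup>2"
    and f0: "f0 \<in> E" "nrm f0 \<le> 1" "nrm1 f0 \<le> 1"
    and sep: "\<And>\<phi> \<psi>. \<phi> \<in> X \<Longrightarrow> \<psi> \<in> X \<Longrightarrow>
      (\<And>f. f \<in> E \<Longrightarrow> nrm f \<le> 1 \<Longrightarrow> nrm1 f \<le> 1 \<Longrightarrow> weighted_form k (\<phi> f - \<psi> f) = 0) \<Longrightarrow> \<phi> = \<psi>"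
  shows "metric_on X (ucp_dist k E nrm nrm1)"
proof -
  let ?d = "ucp_dist k E nrm nrm1"
  have upper: "weighted_form k (\<phi> f - \<psi> f) \<le> ?d \<phi> \<psi>"
    if "\<phi> \<in> X" "\<psi> \<in> X" "f \<in> E" "nrm f \<le> 1" "nrm1 f \<le> 1" for \<phi> \<psi> f
    by (rule weighted_form_le_ucp_dist[where X = X and E = E and nrm = nrm and ?nrm1.0 = nrm1, OF _ _ that])
      (erule k, erule (2) bound)
  have least: "?d \<phi> \<psi> \<le> e"
    if "\<And>f. f \<in> E \<Longrightarrow> nrm f \<le> 1 \<Longrightarrow> nrm1 f \<le> 1 \<Longrightarrow> weighted_form k (\<phi> f - \<psi> f) \<le> e" for \<phi> \<psi> e
    by (rule ucp_dist_least[where E = E and nrm = nrm and ?nrm1.0 = nrm1 and ?f0.0 = f0, OF f0 that])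
  have nn: "0 \<le> weighted_form k A" for A by (rule weighted_form_nonneg) (rule k)
  have nonneg: "0 \<le> ?d \<phi> \<psi>" if "\<phi> \<in> X" "\<psi> \<in> X" for \<phi> \<psi>
    using nn[of "\<phi> f0 - \<psi> f0"] upper[OF that f0] by linarith
  have self: "?d \<phi> \<phi> \<le> 0" for \<phi>
    by (rule least) (simp add: weighted_form_def)
  have sym: "?d \<phi> \<psi> = ?d \<psi> \<phi>" for \<phi> \<psi>
  proof -
    have "weighted_form k (\<phi> f - \<psi> f) = weighted_form k (\<psi> f - \<phi> f)" for f
      by (rule weighted_form_commute) (rule k)
    then show ?thesis unfolding ucp_dist_def weighted_form_def[symmetric] by (simp only:)
  qed
  have tri: "?d \<phi> \<omega> \<le> ?d \<phi> \<psi> + ?d \<psi> \<omega>" if "\<phi> \<in> X" "\<psi> \<in> X" "\<omega> \<in> X" for \<phi> \<psi> \<omega>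
  proof (rule least)
    fix f assume f: "f \<in> E" "nrm f \<le> 1" "nrm1 f \<le> 1"
    have "weighted_form k (\<phi> f - \<omega> f) \<le> weighted_form k (\<phi> f - \<psi> f) + weighted_form k (\<psi> f - \<omega> f)"
      by (rule weighted_form_triangle) (rule k)
    also have "\<dots> \<le> ?d \<phi> \<psi> + ?d \<psi> \<omega>"
      by (intro add_mono upper that f)
    finally show "weighted_form k (\<phi> f - \<omega> f) \<le> ?d \<phi> \<psi> + ?d \<psi> \<omega>" .
  qed
  have zero: "?d \<phi> \<psi> = 0 \<longleftrightarrow> \<phi> = \<psi>" if "\<phi> \<in> X" "\<psi> \<in> X" for \<phi> \<psi>
  proof
    assume z: "?d \<phi> \<psi> = 0"
    show "\<phi> = \<psi>"
    proof (rule sep[OF that])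
      fix f assume f: "f \<in> E" "nrm f \<le> 1" "nrm1 f \<le> 1"
      show "weighted_form k (\<phi> f - \<psi> f) = 0"
        using upper[OF that f] nn[of "\<phi> f - \<psi> f"] z by linarith
    qed
  next
    assume "\<phi> = \<psi>"
    then show "?d \<phi> \<psi> = 0" using self[of \<phi>] nonneg[OF that] by simp
  qed
  show ?thesis
    unfolding metric_on_def using nonneg sym zero tri by blast
qed

section \<open>Bounds for unital completely positive maps\<close>

definition lin_closed :: "('i \<Rightarrow> complex) set \<Rightarrow> bool" where
  "lin_closed E \<longleftrightarrow> (\<forall>f\<in>E. \<forall>g\<in>E. \<forall>\<alpha> \<beta>. (\<lambda>i. \<alpha> * f i + \<beta> * g i) \<in> E)"

lemma lin_closedD: "lin_closed E \<Longrightarrow> f \<in> E \<Longrightarrow> g \<in> E \<Longrightarrow> (\<lambda>i. \<alpha> * f i + \<beta> * g i) \<in> E"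
  unfolding lin_closed_def by blast

lemma ucp_maps_qform_lincomb:
  assumes "\<phi> \<in> ucp_maps E u \<pi> H" "f \<in> E" "g \<in> E"
  shows "qform (\<phi> (\<lambda>i. \<alpha> * f i + \<beta> * g i)) x = \<alpha> * qform (\<phi> f) x + \<beta> * qform (\<phi> g) x"
  using assms by (simp add: ucp_maps_def cinner_add_left cinner_scaleC_left)

lemma ucp_maps_qform_diff:
  assumes "\<phi> \<in> ucp_maps E u \<pi> H" "f \<in> E" "g \<in> E"
  shows "qform (\<phi> (\<lambda>i. f i - g i)) x = qform (\<phi> f) x - qform (\<phi> g) x"
  using ucp_maps_qform_lincomb[OF assms, of 1 "-1"] by simp

lemma ucp_maps_qform_sum:
  assumes \<phi>: "\<phi> \<in> ucp_maps E u \<pi> H" and E: "lin_closed E" "u \<in> E" and "finite J"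
    and g: "\<And>j. j \<in> J \<Longrightarrow> g j \<in> E"
  shows "(\<lambda>i. \<Sum>j\<in>J. c j * g j i) \<in> E \<and>
    qform (\<phi> (\<lambda>i. \<Sum>j\<in>J. c j * g j i)) x = (\<Sum>j\<in>J. c j * qform (\<phi> (g j)) x)"
  using \<open>finite J\<close> g
proof (induction J rule: finite_induct)
  case empty
  have "(\<lambda>i. 0 * u i + 0 * u i) \<in> E" by (rule lin_closedD[OF E(1,2,2)])
  moreover have "qform (\<phi> (\<lambda>i. 0 * u i + 0 * u i)) x = 0"
    using ucp_maps_qform_lincomb[OF \<phi> E(2) E(2), of 0 0 x] by simp
  ultimately show ?case by simp
next
  case (insert j J)
  let ?s = "\<lambda>i. \<Sum>j\<in>J. c j * g j i"
  have IH: "?s \<in> E" "qform (\<phi> ?s) x = (\<Sum>j\<in>J. c j * qform (\<phi> (g j)) x)" using insert by auto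
  have "(\<lambda>i. c j * g j i + 1 * ?s i) \<in> E" 
    by (rule lin_closedD[OF E(1) _ IH(1)]) (simp add: insert.prems)
  moreover have "qform (\<phi> (\<lambda>i. c j * g j i + 1 * ?s i)) x = c j * qform (\<phi> (g j)) x + 1 * qform (\<phi> ?s) x"
    using insert.prems IH by (intro ucp_maps_qform_lincomb[OF \<phi>]) auto
  ultimately show ?case using insert.hyps IH by simp
qed

text \<open>For \<open>|c| = 1\<close> the element \<open>2 M u - c f - cnj c f'\<close> is positive, where \<open>f'\<close> is the adjoint of \<open>f\<close>, and
  so is its image.  Reality of the image for \<open>c = 1\<close> and \<open>c = \<i>\<close> shows that the value at \<open>f'\<close> is the conjugate of
  the value \<open>F\<close> at \<open>f\<close>; then \<open>Re (c F) \<le> M \<parallel>x\<parallel>\<^sup>2\<close>, and \<open>c\<close> can be chosen to make \<open>c F = |F|\<close>.  The numbers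
  \<open>n \<xi>\<close> and \<open>z \<xi>\<close> stand for \<open>\<langle>\<xi>, \<xi>\<rangle>\<close> and \<open>\<langle>f \<xi>, \<xi>\<rangle>\<close>.\<close>

lemma ucp_maps_numerical_radius:
  assumes \<phi>: "\<phi> \<in> ucp_maps E u \<pi> H" and E: "lin_closed E" "u \<in> E" "f \<in> E" "f' \<in> E"
    and form: "\<And>\<xi> \<alpha> \<beta> \<gamma>. \<xi> \<in> H \<Longrightarrow> spinor_inner (\<pi> (\<lambda>i. \<alpha> * u i + 1 * (\<beta> * f i + \<gamma> * f' i)) \<xi>) \<xi>
        = \<alpha> * of_real (n \<xi>) + \<beta> * z \<xi> + \<gamma> * cnj (z \<xi>)"
    and le: "\<And>\<xi>. \<xi> \<in> H \<Longrightarrow> cmod (z \<xi>) \<le> M * n \<xi>"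
  shows "cmod (qform (\<phi> f) x) \<le> M * (norm x)\<^sup>2"
proof -
  define F where "F = qform (\<phi> f) x"
  define G where "G = qform (\<phi> f') x"
  define N where "N = M * (norm x)\<^sup>2"
  have pos: "complex_of_real (2 * N) - c * F - cnj c * G \<in> \<real>\<^sub>\<ge>\<^sub>0" if c: "cmod c = 1" for c
  proof -
    define b where "b = (\<lambda>i. (-c) * f i + (- cnj c) * f' i)"
    define a where "a = (\<lambda>i. complex_of_real (2 * M) * u i + 1 * b i)"
    have bE: "b \<in> E" unfolding b_def by (rule lin_closedD[OF E(1,3,4)])
    have aE: "a \<in> E" unfolding a_def by (rule lin_closedD[OF E(1,2) bE])
    have "matrix_positive \<pi> H 1 (\<lambda>_ _. a)"
      unfolding matrix_positive_def
    proof (intro allI impI)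
      fix \<xi> assume "\<forall>i<(1::nat). \<xi> i \<in> H"
      then have \<xi>: "\<xi> 0 \<in> H" by simp
      have "spinor_inner (\<pi> a (\<xi> 0)) (\<xi> 0) = complex_of_real (2 * M) * of_real (n (\<xi> 0))
          + (-c) * z (\<xi> 0) + (- cnj c) * cnj (z (\<xi> 0))"
        unfolding a_def b_def by (rule form[OF \<xi>])
      also have "\<dots> = complex_of_real (2 * M * n (\<xi> 0) - 2 * Re (c * z (\<xi> 0)))"
        by (simp add: complex_eq_iff)
      finally have eq: "spinor_inner (\<pi> a (\<xi> 0)) (\<xi> 0) = complex_of_real (2 * M * n (\<xi> 0) - 2 * Re (c * z (\<xi> 0)))" .
      have "Re (c * z (\<xi> 0)) \<le> cmod (c * z (\<xi> 0))" by (rule complex_Re_le_cmod)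
      also have "\<dots> \<le> M * n (\<xi> 0)" using le[OF \<xi>] c by (simp add: norm_mult)
      finally show "(\<Sum>i<1. \<Sum>j<1. spinor_inner (\<pi> a (\<xi> j)) (\<xi> i)) \<in> \<real>\<^sub>\<ge>\<^sub>0"
        by (simp add: eq complex_nonneg_Reals_iff)
    qed
    then have "operator_matrix_positive 1 (\<lambda>i j. \<phi> a)"
      using \<phi> aE unfolding ucp_maps_def by simp
    then have "qform (\<phi> a) x \<in> \<real>\<^sub>\<ge>\<^sub>0"
      unfolding operator_matrix_positive_def by (auto dest: spec[of _ "\<lambda>_. x"])
    also have "qform (\<phi> a) x = complex_of_real (2 * M) * qform (\<phi> u) x + 1 * qform (\<phi> b) x"
      unfolding a_def by (rule ucp_maps_qform_lincomb[OF \<phi> E(2) bE])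
    also have "qform (\<phi> b) x = (-c) * F + (- cnj c) * G"
      unfolding b_def F_def G_def by (rule ucp_maps_qform_lincomb[OF \<phi> E(3,4)])
    also have "qform (\<phi> u) x = complex_of_real ((norm x)\<^sup>2)"
      using \<phi> by (simp add: ucp_maps_def cinner_self)
    finally show ?thesis by (simp add: N_def algebra_simps)
  qed
  have G: "G = cnj F"
    using pos[of 1] pos[of \<i>] by (auto simp: complex_nonneg_Reals_iff complex_eq_iff)
  have re: "Re (c * F) \<le> N" if "cmod c = 1" for c
  proof -
    have "2 * Re (c * F) \<le> 2 * N" using pos[OF that] by (simp add: G complex_nonneg_Reals_iff algebra_simps)
    then show ?thesis by (subst (asm) mult_le_cancel_left_pos) simp_all
  qed
  have "cmod F \<le> N"
  proof (cases "F = 0")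
    case True
    then show ?thesis using re[of 1] by simp
  next
    case False
    have "cnj F / complex_of_real (cmod F) * F = complex_of_real (cmod F)"
      using False by (simp add: field_simps complex_norm_square[symmetric] power2_eq_square)
    moreover have "cmod (cnj F / complex_of_real (cmod F)) = 1" using False by (simp add: norm_divide)
    ultimately show ?thesis using re[of "cnj F / complex_of_real (cmod F)"] by simp
  qed
  then show ?thesis by (simp add: F_def N_def)
qed

section \<open>Integration on the torus\<close>

lemma space_torus_measure [simp]: "space torus_measure = UNIV"
  by (simp add: torus_measure_def)

lemma sets_torus_measure [measurable_cong, simp]: "sets torus_measure = sets borel"
  by (simp add: torus_measure_def)

lemma emeasure_torus_cube:
  "emeasure lborel (cbox 0 (vec (2 * pi)) :: (real^'d) set) \<noteq> 0"
  "emeasure lborel (cbox 0 (vec (2 * pi)) :: (real^'d) set) \<noteq> \<infinity>"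
proof -
  have "emeasure lborel (cbox 0 (vec (2 * pi)) :: (real^'d) set) = ennreal (\<Prod>b\<in>(Basis :: (real^'d) set). vec (2 * pi) \<bullet> b)"
    by (subst emeasure_lborel_cbox) (auto simp: Basis_vec_def inner_axis)
  also have "(\<Prod>b\<in>(Basis :: (real^'d) set). (vec (2 * pi) :: real^'d) \<bullet> b) = (\<Prod>b\<in>(Basis :: (real^'d) set). 2 * pi)"
    by (rule prod.cong) (auto simp: Basis_vec_def inner_axis)
  finally show "emeasure lborel (cbox 0 (vec (2 * pi)) :: (real^'d) set) \<noteq> 0"
    "emeasure lborel (cbox 0 (vec (2 * pi)) :: (real^'d) set) \<noteq> \<infinity>"
    by (simp_all add: prod_pos)
qed

lemma emeasure_torus_UNIV: "emeasure (torus_measure :: (real^'d) measure) UNIV = 1"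
proof -
  have "emeasure lborel (cbox 0 (vec (2 * pi)) :: (real^'d) set) / emeasure lborel (cbox 0 (vec (2 * pi)) :: (real^'d) set) = 1"
    by (rule ennreal_divide_self) (use emeasure_torus_cube[where 'd='d] in \<open>simp_all only: infinity_ennreal_def top.not_eq_extremum not_False_eq_True\<close>)
  then show ?thesis by (simp add: torus_measure_def)
qed

lemma measure_torus: "measure (torus_measure :: (real^'d) measure) UNIV = 1"
  by (simp add: measure_def emeasure_torus_UNIV)

lemma finite_measure_torus: "finite_measure (torus_measure :: (real^'d) measure)"
  by standard (simp add: emeasure_torus_UNIV)

lemma integral_torus_const [simp]: "(LINT x|(torus_measure :: (real^'d) measure). c) = (c :: 'b::{banach, second_countable_topology})"
proof -
  interpret finite_measure "torus_measure :: (real^'d) measure" by (rule finite_measure_torus)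
  show ?thesis by (simp add: measure_torus)
qed

lemma integrable_torus [intro]:
  fixes f :: "real^'d \<Rightarrow> 'b::{banach, second_countable_topology}"
  assumes f: "continuous_on UNIV f"
  shows "integrable torus_measure f"
proof -
  interpret finite_measure "torus_measure :: (real^'d) measure" by (rule finite_measure_torus)
  have "compact (f ` cbox 0 (vec (2 * pi)))"
    using f by (intro compact_continuous_image) (auto intro: continuous_on_subset)
  then have "bounded (f ` cbox 0 (vec (2 * pi)))" by (rule compact_imp_bounded)
  then obtain B where B: "\<forall>x\<in>cbox 0 (vec (2 * pi)). norm (f x) \<le> B"
    unfolding bounded_iff by (auto simp only: ball_simps)
  have "AE x in torus_measure. norm (f x) \<le> B"
    unfolding torus_measure_def by (rule AE_uniform_measureI) (use B in auto)
  moreover have "f \<in> borel_measurable torus_measure"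
    using borel_measurable_continuous_onI[OF f] by simp
  ultimately show ?thesis by (intro integrable_const_bound)
qed

lemma integral_torus:
  fixes f :: "real^'d \<Rightarrow> complex"
  assumes [measurable]: "f \<in> borel_measurable borel"
  shows "(LINT x|torus_measure. f x) =
     (1 / measure lborel (cbox 0 (vec (2 * pi)) :: (real^'d) set)) *\<^sub>R
     (LINT x|lborel. indicator (cbox 0 (vec (2 * pi))) x *\<^sub>R f x)"
proof -
  let ?A = "cbox 0 (vec (2 * pi)) :: (real^'d) set"
  let ?c = "measure lborel ?A"
  have c: "emeasure lborel ?A = ennreal ?c"
    using emeasure_torus_cube by (subst emeasure_eq_ennreal_measure) auto
  have "?c \<noteq> 0" using emeasure_torus_cube(1) c by (metis ennreal_0)
  then have "?c > 0" by (simp add: less_le)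
  have dens: "torus_measure = density lborel (\<lambda>x. ennreal (indicator ?A x / ?c))"
    unfolding torus_measure_def uniform_measure_def c using \<open>?c > 0\<close>
    using divide_ennreal[of 1 ?c] by (intro density_cong) (auto simp: indicator_def)
  have "(LINT x|torus_measure. f x) = (LINT x|lborel. (indicator ?A x / ?c) *\<^sub>R f x)"
    unfolding dens by (rule integral_density) auto
  also have "\<dots> = (LINT x|lborel. complex_of_real (1 / ?c) * (indicator ?A x *\<^sub>R f x))"
    by (intro Bochner_Integration.integral_cong refl) (simp add: scaleR_conv_of_real)
  also have "\<dots> = complex_of_real (1 / ?c) * (LINT x|lborel. indicator ?A x *\<^sub>R f x)"
    by (rule integral_mult_right_zero)
  finally show ?thesis by (simp only: scaleR_conv_of_real)
qed

section \<open>Characters\<close>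

lemma lattice_point_add: "lattice_point (m + n) = lattice_point m + lattice_point n"
  by (simp add: lattice_point_def vec_eq_iff)

lemma lattice_point_uminus: "lattice_point (- n) = - lattice_point n"
  by (simp add: lattice_point_def vec_eq_iff)

lemma lattice_point_diff: "lattice_point (m - n) = lattice_point m - lattice_point n"
  by (simp add: lattice_point_def vec_eq_iff)

lemma lattice_point_0 [simp]: "lattice_point 0 = 0"
  by (simp add: lattice_point_def vec_eq_iff)

lemma lattice_point_axis: "lattice_point (axis \<mu> 1) = axis \<mu> 1"
  by (simp add: lattice_point_def vec_eq_iff axis_def)

lemma torus_char_0 [simp]: "torus_char 0 x = 1" "torus_char n 0 = 1"
  by (simp_all add: torus_char_def)

lemma torus_char_add: "torus_char (m + n) x = torus_char m x * torus_char n x"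
  by (simp add: torus_char_def lattice_point_add inner_add_left ring_distribs exp_add)

lemma cnj_torus_char: "cnj (torus_char n x) = torus_char (- n) x"
  by (simp add: torus_char_def lattice_point_uminus exp_cnj)

lemma torus_char_diff: "torus_char (m - n) x = torus_char m x * cnj (torus_char n x)"
  using torus_char_add[of m "- n" x] by (simp add: cnj_torus_char)

lemma norm_torus_char [simp]: "cmod (torus_char n x) = 1"
  by (simp add: torus_char_def)

lemma torus_char_add_right: "torus_char n (x + y) = torus_char n x * torus_char n y"
  by (simp add: torus_char_def inner_add_right ring_distribs exp_add)

lemma torus_char_minus_right: "torus_char n (- x) = cnj (torus_char n x)"
  by (simp add: torus_char_def exp_cnj)

lemma torus_char_diff_right: "torus_char n (x - y) = torus_char n x * cnj (torus_char n y)"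
  using torus_char_add_right[of n x "- y"] by (simp add: torus_char_minus_right)

lemma torus_char_mult_cnj [simp]: "torus_char n x * cnj (torus_char n x) = 1"
  by (simp flip: torus_char_diff)

lemma continuous_on_torus_char [continuous_intros]:
  "continuous_on S f \<Longrightarrow> continuous_on S (\<lambda>x. torus_char n (f x))"
  unfolding torus_char_def by (intro continuous_intros)

lemma periodic_torus_char: "periodic (torus_char n)"
proof -
  have "torus_char n (axis i (2 * pi)) = 1" for i
  proof -
    have "torus_char n (axis i (2 * pi)) = exp (2 * of_int (n $ i) * pi * \<i>)"
      by (simp add: torus_char_def inner_axis lattice_point_def algebra_simps)
    also have "\<dots> = 1" by (rule exp_integer_2pi) simp
    finally show ?thesis .
  qed
  then show ?thesis by (simp add: periodic_def torus_char_add_right)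
qed

lemma has_derivative_torus_char:
  "(torus_char n has_derivative (\<lambda>h. \<i> * complex_of_real (lattice_point n \<bullet> h) * torus_char n x)) (at x)"
proof -
  have "((\<lambda>x. \<i> * complex_of_real (lattice_point n \<bullet> x)) has_derivative
      (\<lambda>h. \<i> * complex_of_real (lattice_point n \<bullet> h))) (at x)"
    by (intro bounded_linear_imp_has_derivative bounded_linear_const_mult
        bounded_linear_compose[OF bounded_linear_of_real] bounded_linear_inner_right)
  moreover have "(exp has_derivative (\<lambda>h. exp z * h)) (at z)" for z :: complex
    using DERIV_exp[of z] by (simp add: has_field_derivative_def)
  ultimately have "((\<lambda>x. exp (\<i> * complex_of_real (lattice_point n \<bullet> x))) has_derivative
      (\<lambda>h. exp (\<i> * complex_of_real (lattice_point n \<bullet> x)) * (\<i> * complex_of_real (lattice_point n \<bullet> h)))) (at x)"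
    by (rule has_derivative_compose)
  then show ?thesis unfolding torus_char_def by (simp add: mult.commute)
qed

lemma integral_exp_circle:
  assumes "a \<in> \<int>" "a \<noteq> 0"
  shows "(LINT t|lborel. indicator {0..2 * pi} t *\<^sub>R exp (\<i> * complex_of_real (a * t))) = 0"
proof -
  let ?F = "\<lambda>t. exp (\<i> * complex_of_real (a * t)) / (\<i> * complex_of_real a)"
  have "(LINT t|lborel. indicator {0..2 * pi} t *\<^sub>R exp (\<i> * complex_of_real (a * t))) = ?F (2 * pi) - ?F 0"
  proof (rule integral_FTC_Icc)
    fix t :: real
    have "((\<lambda>z. exp (\<i> * of_real a * z) / (\<i> * of_real a)) has_field_derivative exp (\<i> * of_real a * of_real t))
        (at (complex_of_real t))"
      using assms(2) by (auto intro!: derivative_eq_intros)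
    from has_vector_derivative_real_field[OF this]
    show "(?F has_vector_derivative exp (\<i> * complex_of_real (a * t))) (at t within {0..2 * pi})"
      by (simp add: mult.assoc)
  qed (auto intro!: continuous_intros)
  also have "exp (\<i> * complex_of_real (a * (2 * pi))) = exp (2 * of_real a * pi * \<i>)"
    by (simp add: algebra_simps)
  also have "\<dots> = 1" using assms(1) by (intro exp_integer_2pi) (auto elim!: Ints_cases)
  finally show ?thesis by simp
qed

lemma integral_lborel_prod:
  fixes g :: "'a::euclidean_space \<Rightarrow> real \<Rightarrow> complex"
  assumes g: "\<And>b. b \<in> Basis \<Longrightarrow> integrable lborel (g b)"
  shows "(LINT x|lborel. (\<Prod>b\<in>Basis. g b (x \<bullet> b))) = (\<Prod>b\<in>Basis. LINT t|lborel. g b t)"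
proof -
  interpret product_sigma_finite "\<lambda>_ :: 'a. lborel :: real measure" by standard
  have [measurable]: "g b \<in> borel_measurable borel" if "b \<in> Basis" for b
    using borel_measurable_integrable[OF g[OF that]] by simp
  have "(LINT x|lborel. (\<Prod>b\<in>Basis. g b (x \<bullet> b)))
      = (LINT f|(\<Pi>\<^sub>M b\<in>Basis. lborel). (\<Prod>b\<in>Basis. g b ((\<Sum>c\<in>Basis. f c *\<^sub>R c) \<bullet> b)))"
    by (subst lborel_eq, subst integral_distr) simp_all
  also have "\<dots> = (LINT f|(\<Pi>\<^sub>M b\<in>Basis. lborel). (\<Prod>b\<in>Basis. g b (f b)))"
    by (intro Bochner_Integration.integral_cong refl prod.cong)
      (simp add: inner_sum_left inner_Basis if_distrib cong: if_cong)
  also have "\<dots> = (\<Prod>b\<in>Basis. LINT t|lborel. g b t)"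
    by (rule product_integral_prod) (use g in auto)
  finally show ?thesis .
qed

text \<open>Lebesgue measure is a product measure, and a nonzero coordinate of \<open>n\<close> contributes the factor
  \<open>\<integral> e\<^sup>i\<^sup>a\<^sup>t dt = 0\<close>.\<close>

lemma integral_torus_char:
  "(LINT x|torus_measure. torus_char n x) = (if n = 0 then 1 else 0)"
proof (cases "n = 0")
  case False
  then obtain \<mu> where \<mu>: "n $ \<mu> \<noteq> 0" by (auto simp: vec_eq_iff)
  define g where "g b t = indicator {0..2 * pi} t *\<^sub>R exp (\<i> * complex_of_real ((lattice_point n \<bullet> b) * t))"
    for b :: "real^'a" and t :: real
  have ind: "indicator (cbox 0 (vec (2 * pi))) x *\<^sub>R torus_char n x = (\<Prod>b\<in>Basis. g b (x \<bullet> b))" for x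
  proof -
    have "(\<Prod>b\<in>Basis. exp (\<i> * complex_of_real ((lattice_point n \<bullet> b) * (x \<bullet> b)))) = torus_char n x"
      unfolding torus_char_def
      by (simp add: exp_sum[symmetric] euclidean_inner[of "lattice_point n" x] sum_distrib_left)
    moreover have "(\<Prod>b\<in>Basis. indicator {0..2 * pi} (x \<bullet> b)) = (indicator (cbox 0 (vec (2 * pi))) x :: real)"
    proof -
      have v: "vec (2 * pi) \<bullet> b = 2 * pi" if "b \<in> Basis" for b :: "real^'a"
        using that by (auto simp: Basis_vec_def inner_axis)
      show ?thesis
      proof (cases "x \<in> cbox 0 (vec (2 * pi))")
        case True
        then show ?thesis by (auto simp: mem_box v intro!: prod.neutral)
      next
        case False
        then obtain b where "b \<in> Basis" "\<not> (0 \<le> x \<bullet> b \<and> x \<bullet> b \<le> 2 * pi)" by (auto simp: mem_box v)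
        then have "\<exists>b\<in>Basis. indicator {0..2 * pi} (x \<bullet> b) = (0 :: real)" by (intro bexI[of _ b]) auto
        then have "(\<Prod>b\<in>Basis. indicator {0..2 * pi} (x \<bullet> b)) = (0 :: real)"
          by (intro prod_zero) auto
        with False show ?thesis by simp
      qed
    qed
    ultimately show ?thesis
      by (simp add: g_def scaleR_conv_of_real prod.distrib flip: of_real_prod)
  qed
  have "integrable lborel (g b)" for b
    unfolding g_def by (rule borel_integrable_compact) (auto intro!: continuous_intros)
  then have "(LINT x|lborel. indicator (cbox 0 (vec (2 * pi))) x *\<^sub>R torus_char n x)
      = (\<Prod>b\<in>Basis. LINT t|lborel. g b t)"
    unfolding ind by (intro integral_lborel_prod)
  also have "\<dots> = 0"
  proof (rule prod_zero)
    have "lattice_point n \<bullet> axis \<mu> 1 = real_of_int (n $ \<mu>)" by (simp add: inner_axis lattice_point_def)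
    then have "(LINT t|lborel. g (axis \<mu> 1) t) = 0"
      unfolding g_def using \<mu> by (subst integral_exp_circle) auto
    then show "\<exists>b\<in>Basis. (LINT t|lborel. g b t) = 0" by (intro bexI[of _ "axis \<mu> 1"]) auto
  qed simp
  finally show ?thesis
    using False by (subst integral_torus) (auto intro!: borel_measurable_continuous_onI continuous_intros)
qed (simp add: measure_torus)

section \<open>Periodic functions\<close>

lemma periodic_lattice:
  fixes f :: "real^'d \<Rightarrow> 'b"
  assumes "periodic f"
  shows "f (x + (2 * pi) *\<^sub>R lattice_point n) = f x"
proof -
  have nat: "f (x + axis i (2 * pi * real m)) = f x" for x i m
  proof (induction m)
    case (Suc m)
    have "x + axis i (2 * pi * real (Suc m)) = (x + axis i (2 * pi * real m)) + axis i (2 * pi)"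
      by (simp add: vec_eq_iff axis_def algebra_simps)
    then have "f (x + axis i (2 * pi * real (Suc m))) = f (x + axis i (2 * pi * real m))"
      using assms by (simp only: periodic_def)
    with Suc show ?case by simp
  next
    case 0
    have "axis i (0 :: real) = 0" by (simp add: axis_def vec_eq_iff)
    then show ?case by (simp only: of_nat_0 mult_zero_right add_0_right)
  qed
  have int: "f (x + axis i (2 * pi * real_of_int m)) = f x" for x i m
  proof (cases "0 \<le> m")
    case True
    then show ?thesis using nat[of x i "nat m"] by simp
  next
    case False
    have e: "x + axis i (2 * pi * real_of_int m) + axis i (2 * pi * real (nat (- m))) = x"
      using False by (simp add: vec_eq_iff axis_def)
    show ?thesis using nat[of "x + axis i (2 * pi * real_of_int m)" i "nat (- m)"] unfolding e by simp
  qed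
  have "f (x + (\<Sum>i\<in>I. axis i (2 * pi * real_of_int (n $ i)))) = f x" if "finite I" for I
    using that
  proof (induction I rule: finite_induct)
    case (insert i I)
    then show ?case
      using int[of "x + (\<Sum>i\<in>I. axis i (2 * pi * real_of_int (n $ i)))" i "n $ i"]
      by (simp add: add.commute add.left_commute)
  qed simp
  moreover have "(\<Sum>i\<in>UNIV. axis i (2 * pi * real_of_int (n $ i))) = (2 * pi) *\<^sub>R lattice_point n"
    by (simp add: vec_eq_iff axis_def lattice_point_def if_distrib cong: if_cong)
  ultimately show ?thesis by (metis finite)
qed

lemma reduce_mod_lattice:
  fixes x :: "real^'d"
  shows "\<exists>n. \<forall>i. \<bar>(x + (2 * pi) *\<^sub>R lattice_point n) $ i\<bar> \<le> pi"
proof (intro exI allI)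
  define n :: "int^'d" where "n = (\<chi> i. - round (x $ i / (2 * pi)))"
  fix i
  have "\<bar>x $ i / (2 * pi) - of_int (round (x $ i / (2 * pi)))\<bar> \<le> 1 / 2"
    using of_int_round_abs_le[of "x $ i / (2 * pi)"] by (simp add: abs_minus_commute)
  then have "2 * pi * \<bar>x $ i / (2 * pi) - of_int (round (x $ i / (2 * pi)))\<bar> \<le> 2 * pi * (1 / 2)"
    by (rule mult_left_mono) simp
  also have "2 * pi * \<bar>x $ i / (2 * pi) - of_int (round (x $ i / (2 * pi)))\<bar>
      = \<bar>2 * pi * (x $ i / (2 * pi) - of_int (round (x $ i / (2 * pi))))\<bar>" by (simp add: abs_mult)
  also have "2 * pi * (x $ i / (2 * pi) - of_int (round (x $ i / (2 * pi)))) = (x + (2 * pi) *\<^sub>R lattice_point n) $ i"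
    by (simp add: n_def lattice_point_def algebra_simps)
  finally show "\<bar>(x + (2 * pi) *\<^sub>R lattice_point n) $ i\<bar> \<le> pi" by simp
qed

lemma continuous_periodic_bounded:
  fixes f :: "real^'d \<Rightarrow> 'b::real_normed_vector"
  assumes f: "continuous_on UNIV f" "periodic f"
  shows "\<exists>B>0. \<forall>x. norm (f x) \<le> B"
proof -
  have "compact (f ` cbox (- vec pi) (vec pi))"
    using f by (intro compact_continuous_image) (auto intro: continuous_on_subset)
  then have "bounded (f ` cbox (- vec pi) (vec pi))" by (rule compact_imp_bounded)
  then obtain B where B: "B > 0" "\<forall>x\<in>cbox (- vec pi) (vec pi). norm (f x) \<le> B"
    unfolding bounded_pos by (auto simp only: ball_simps)
  have "norm (f x) \<le> B" for x
  proof -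
    obtain n where n: "\<forall>i. \<bar>(x + (2 * pi) *\<^sub>R lattice_point n) $ i\<bar> \<le> pi"
      using reduce_mod_lattice[of x] by blast
    have "x + (2 * pi) *\<^sub>R lattice_point n \<in> cbox (- vec pi) (vec pi)"
      unfolding mem_box_cart
    proof (intro allI conjI)
      fix i
      show "(- vec pi) $ i \<le> (x + (2 * pi) *\<^sub>R lattice_point n) $ i"
        "(x + (2 * pi) *\<^sub>R lattice_point n) $ i \<le> vec pi $ i"
        using n[rule_format, of i] unfolding vec_component uminus_vec_def vec_lambda_beta by linarith+
    qed
    then have "norm (f (x + (2 * pi) *\<^sub>R lattice_point n)) \<le> B" by (rule B(2)[rule_format])
    then show ?thesis by (simp add: periodic_lattice[OF f(2)])
  qed
  with B(1) show ?thesis by blast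
qed

text \<open>The length of the chord between two points of the unit circle that differ by the angle \<open>x $ \<mu>\<close>.  Its
  square is a trigonometric polynomial, so it can be integrated against the Fejer kernel.\<close>

definition chord :: "'d \<Rightarrow> real^'d \<Rightarrow> real" where
  "chord \<mu> x = cmod (1 - torus_char (axis \<mu> 1) x)"

lemma chord_nonneg [simp]: "0 \<le> chord \<mu> x" by (simp add: chord_def)

lemma chord_lattice: "chord \<mu> (x + (2 * pi) *\<^sub>R lattice_point n) = chord \<mu> x"
  unfolding chord_def by (simp only: periodic_lattice[OF periodic_torus_char])

text \<open>With \<open>u = |t| / 4 \<le> \<pi> / 4\<close> the chord is \<open>4 sin u cos u\<close>, and \<open>sin u \<ge> u cos (\<pi> / 4)\<close> by the mean
  value theorem.\<close>

lemma abs_le_chord: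
  assumes "\<bar>x $ \<mu>\<bar> \<le> pi"
  shows "\<bar>x $ \<mu>\<bar> \<le> 2 * chord \<mu> x"
proof -
  define t where "t = x $ \<mu>"
  define u where "u = \<bar>t\<bar> / 4"
  have u: "0 \<le> u" "u \<le> pi / 4" using assms by (auto simp: u_def t_def)
  have "chord \<mu> x = cmod (exp (\<i> * of_real t) - 1)"
    by (simp add: chord_def torus_char_def lattice_point_axis inner_axis' t_def norm_minus_commute)
  also have "\<dots> = 2 * \<bar>sin (t / 2)\<bar>" by (rule dist_exp_i_1)
  also have "\<bar>sin (t / 2)\<bar> = \<bar>sin (2 * u)\<bar>" by (cases "0 \<le> t") (simp_all add: u_def)
  also have "\<dots> = 2 * \<bar>sin u\<bar> * \<bar>cos u\<bar>" by (simp add: sin_double abs_mult)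
  finally have c: "chord \<mu> x = 4 * \<bar>sin u\<bar> * \<bar>cos u\<bar>" by simp
  have cos: "sqrt 2 / 2 \<le> cos v" if "0 \<le> v" "v \<le> pi / 4" for v
    using cos_monotone_0_pi_le[of v "pi / 4"] that by (simp add: cos_45)
  have "u * (sqrt 2 / 2) \<le> sin u"
  proof (cases "u = 0")
    case False
    then obtain z where z: "0 < z" "z < u" "sin u - sin 0 = (u - 0) * cos z"
      using u MVT2[of 0 u sin cos] by (auto intro: DERIV_sin)
    then show ?thesis using cos[of z] u by (auto intro!: mult_left_mono)
  qed simp
  moreover have "sqrt 2 / 2 \<le> cos u" by (rule cos[OF u])
  moreover have "0 \<le> u * (sqrt 2 / 2)" using u by simp
  ultimately have "(u * (sqrt 2 / 2)) * (sqrt 2 / 2) \<le> \<bar>sin u\<bar> * \<bar>cos u\<bar>"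
    by (intro mult_mono) auto
  also have "(u * (sqrt 2 / 2)) * (sqrt 2 / 2) = u / 2" by (simp add: mult.assoc)
  finally have "2 * u \<le> chord \<mu> x" unfolding c by linarith
  then show ?thesis by (simp add: u_def t_def)
qed

section \<open>Partial derivatives\<close>

lemma has_vector_derivative_line:
  assumes "(f has_derivative f') (at (x + t *\<^sub>R v))"
  shows "((\<lambda>t. f (x + t *\<^sub>R v)) has_vector_derivative f' v) (at t)"
proof -
  have "((\<lambda>t. x + t *\<^sub>R v) has_derivative (\<lambda>s. s *\<^sub>R v)) (at t)"
    by (auto intro!: derivative_eq_intros)
  from has_derivative_compose[OF this assms]
  show ?thesis
    using has_derivative_bounded_linear[OF assms] by (simp add: has_vector_derivative_def linear_simps)
qed

lemma partial_deriv_eq: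
  assumes "(f has_derivative f') (at x)"
  shows "partial_deriv \<mu> f x = f' (axis \<mu> 1)"
  unfolding partial_deriv_def
  using has_vector_derivative_line[of f f' x 0 "axis \<mu> 1"] assms by (intro vector_derivative_at) simp

lemma partial_deriv_frechet:
  "f differentiable (at x) \<Longrightarrow> partial_deriv \<mu> f x = frechet_derivative f (at x) (axis \<mu> 1)"
  by (rule partial_deriv_eq) (simp add: frechet_derivative_works)

lemma vec_eq_sum_axis: "v = (\<Sum>\<mu>\<in>UNIV. (v $ \<mu>) *\<^sub>R (axis \<mu> 1 :: real^'d))"
  by (simp add: vec_eq_iff axis_def if_distrib cong: if_cong)

lemma has_derivative_partial_derivs:
  fixes f :: "real^'d \<Rightarrow> 'b::real_normed_vector"
  assumes "f differentiable (at x)"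
  shows "(f has_derivative (\<lambda>v. \<Sum>\<mu>\<in>UNIV. (v $ \<mu>) *\<^sub>R partial_deriv \<mu> f x)) (at x)"
proof -
  let ?f' = "frechet_derivative f (at x)"
  have f': "(f has_derivative ?f') (at x)" using assms by (simp add: frechet_derivative_works)
  then interpret f': bounded_linear ?f' by (rule has_derivative_bounded_linear)
  have "?f' v = (\<Sum>\<mu>\<in>UNIV. (v $ \<mu>) *\<^sub>R partial_deriv \<mu> f x)" for v
  proof -
    have "?f' v = ?f' (\<Sum>\<mu>\<in>UNIV. (v $ \<mu>) *\<^sub>R axis \<mu> 1)" by (subst vec_eq_sum_axis[of v]) simp
    then show ?thesis by (simp add: f'.sum f'.scaleR partial_deriv_frechet[OF assms])
  qed
  then have "?f' = (\<lambda>v. \<Sum>\<mu>\<in>UNIV. (v $ \<mu>) *\<^sub>R partial_deriv \<mu> f x)" by (rule ext)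
  with f' show ?thesis by simp
qed

lemma partial_deriv_torus_char:
  "partial_deriv \<mu> (torus_char n) x = \<i> * of_int (n $ \<mu>) * torus_char n x"
  by (subst partial_deriv_eq[OF has_derivative_torus_char]) (simp add: inner_axis lattice_point_def)

lemma differentiable_torus_char: "torus_char n differentiable (at x)"
  using has_derivative_torus_char by (rule differentiableI)

lemma partial_deriv_mult:
  fixes f g :: "real^'d \<Rightarrow> complex"
  assumes "f differentiable (at x)" "g differentiable (at x)"
  shows "partial_deriv \<mu> (\<lambda>x. f x * g x) x = partial_deriv \<mu> f x * g x + f x * partial_deriv \<mu> g x"
proof -
  obtain f' g' where "(f has_derivative f') (at x)" "(g has_derivative g') (at x)"
    using assms by (auto simp: differentiable_def)
  then show ?thesis by (simp add: partial_deriv_eq[OF has_derivative_mult] partial_deriv_eq)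
qed

lemma periodic_partial_deriv:
  assumes "periodic f"
  shows "periodic (partial_deriv \<mu> f)"
proof -
  have "f (x + axis i (2 * pi) + t *\<^sub>R axis \<mu> 1) = f (x + t *\<^sub>R axis \<mu> 1)" for x i t
    using assms unfolding periodic_def by (metis add.assoc add.commute)
  then show ?thesis by (simp add: periodic_def partial_deriv_def)
qed

lemma differentiable_imp_continuous:
  "(\<And>x. f differentiable (at x)) \<Longrightarrow> continuous_on UNIV f"
  by (simp add: continuous_at_imp_continuous_on differentiable_imp_continuous_within)

text \<open>Two points of the torus are joined by a segment whose sides have length at most \<open>\<pi>\<close>, and such
  sides are comparable to chords.\<close>

lemma periodic_lipschitz_chord:
  fixes f :: "real^'d \<Rightarrow> complex"
  assumes per: "periodic f" and diff: "\<And>x. f differentiable (at x)"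
    and L: "\<And>\<mu> x. cmod (partial_deriv \<mu> f x) \<le> L"
  shows "cmod (f y - f x) \<le> 2 * L * (\<Sum>\<mu>\<in>UNIV. chord \<mu> (x - y))"
proof -
  have "0 \<le> L" using L[of undefined x] norm_ge_zero order_trans by blast
  obtain n where n: "\<forall>i. \<bar>(x - y + (2 * pi) *\<^sub>R lattice_point n) $ i\<bar> \<le> pi"
    using reduce_mod_lattice[of "x - y"] by blast
  define v where "v = x - y + (2 * pi) *\<^sub>R lattice_point n"
  have fx: "f x = f (y + 1 *\<^sub>R v)"
    using periodic_lattice[OF per, of x n] by (simp add: v_def algebra_simps)
  have chord: "\<bar>v $ \<mu>\<bar> \<le> 2 * chord \<mu> (x - y)" for \<mu>
    using abs_le_chord[of v \<mu>] n by (simp add: v_def chord_lattice)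
  let ?B = "\<Sum>\<mu>\<in>UNIV. \<bar>v $ \<mu>\<bar> * L"
  let ?D = "\<lambda>t. \<Sum>\<mu>\<in>UNIV. (v $ \<mu>) *\<^sub>R partial_deriv \<mu> f (y + t *\<^sub>R v)"
  have "cmod (f (y + 0 *\<^sub>R v) - f (y + 1 *\<^sub>R v)) \<le> ?B * norm (0 - 1 :: real)"
  proof (rule differentiable_bound[of UNIV _ "\<lambda>t s. s *\<^sub>R ?D t"])
    fix t :: real
    have "((\<lambda>t. f (y + t *\<^sub>R v)) has_vector_derivative ?D t) (at t)"
      by (rule has_vector_derivative_line[OF has_derivative_partial_derivs[OF diff]])
    then show "((\<lambda>t. f (y + t *\<^sub>R v)) has_derivative (\<lambda>s. s *\<^sub>R ?D t)) (at t)"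
      by (simp add: has_vector_derivative_def)
    have "norm (?D t) \<le> ?B"
      by (intro sum_norm_le) (auto intro: mult_left_mono L)
    then show "onorm (\<lambda>s. s *\<^sub>R ?D t) \<le> ?B"
      using \<open>0 \<le> L\<close> by (intro onorm_bound) (auto intro: sum_nonneg mult_left_mono simp: mult.commute)
  qed auto
  also have "?B \<le> (\<Sum>\<mu>\<in>UNIV. 2 * chord \<mu> (x - y) * L)"
    by (intro sum_mono mult_right_mono chord \<open>0 \<le> L\<close>)
  finally show ?thesis by (simp add: fx sum_distrib_left sum_distrib_right mult_ac)
qed

section \<open>The Fejer kernel of a cube\<close>

definition cube :: "nat \<Rightarrow> (int^'d) set" where
  "cube m = {a. \<forall>i. 0 \<le> a $ i \<and> a $ i < int m}"

lemma finite_int_box: "finite {n :: int^'d. \<forall>i. n $ i \<in> {a..b}}"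
proof -
  have "{n :: int^'d. \<forall>i. n $ i \<in> {a..b}} \<subseteq> vec_lambda ` (PiE UNIV (\<lambda>_ :: 'd. {a..b}))"
  proof
    fix n :: "int^'d" assume "n \<in> {n. \<forall>i. n $ i \<in> {a..b}}"
    then show "n \<in> vec_lambda ` (PiE UNIV (\<lambda>_ :: 'd. {a..b}))"
      by (intro image_eqI[of _ _ "vec_nth n"]) (auto simp: vec_nth_inverse)
  qed
  then show ?thesis by (rule finite_subset) (intro finite_imageI finite_PiE, auto)
qed

lemma finite_cube [simp]: "finite (cube m :: (int^'d) set)"
  by (rule finite_subset[OF _ finite_int_box[of 0 "int m"]]) (auto simp: cube_def less_imp_le)

lemma zero_in_cube: "m > 0 \<Longrightarrow> 0 \<in> cube m"
  by (simp add: cube_def)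

lemma card_cube_pos: "m > 0 \<Longrightarrow> card (cube m) > 0"
  using zero_in_cube by (auto simp: card_gt_0_iff)

text \<open>The \<open>m\<close> slices of the cube orthogonal to an axis are translates of one another.\<close>

lemma card_cube_slice:
  fixes \<mu> :: "'d::finite"
  assumes "0 \<le> j" "j < int m"
  shows "m * card {a \<in> cube m. a $ \<mu> = j} = card (cube m :: (int^'d) set)"
proof -
  define S where "S i = {a \<in> cube m :: (int^'d) set. a $ \<mu> = i}" for i
  have same: "card (S i) = card (S j)" if "i \<in> {0..<int m}" for i
    by (rule bij_betw_same_card[of "\<lambda>a. a + axis \<mu> (j - i)"],
        rule bij_betw_byWitness[where f' = "\<lambda>a. a - axis \<mu> (j - i)"])
      (use that assms in \<open>auto simp: S_def cube_def axis_def\<close>)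
  have "cube m = (\<Union>i\<in>{0..<int m}. S i)" by (auto simp: S_def cube_def)
  then have "card (cube m :: (int^'d) set) = card (\<Union>i\<in>{0..<int m}. S i)" by simp
  also have "\<dots> = (\<Sum>i\<in>{0..<int m}. card (S i))"
    by (rule card_UN_disjoint) (auto simp: S_def)
  also have "\<dots> = (\<Sum>i\<in>{0..<int m}. card (S j))" by (rule sum.cong) (use same in auto)
  finally show ?thesis by (simp add: S_def)
qed

text \<open>The proportion of the cube that a translation keeps inside the cube; these numbers are the Fourier
  coefficients of the Fejer kernel.\<close>

definition overlap :: "nat \<Rightarrow> int^'d \<Rightarrow> real" where
  "overlap m n = real (card {a \<in> cube m. a + n \<in> cube m}) / real (card (cube m :: (int^'d) set))"

lemma overlap_0: "m > 0 \<Longrightarrow> overlap m 0 = 1"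
  using zero_in_cube[of m] by (auto simp: overlap_def)

lemma overlap_minus_slice:
  fixes \<mu> :: "'d::finite"
  assumes "m > 0" "0 \<le> j" "j < int m"
    and "{a \<in> cube m. a + n \<in> cube m} = cube m - {a \<in> cube m. a $ \<mu> = j}"
  shows "overlap m (n :: int^'d) = 1 - 1 / real m"
proof -
  let ?s = "card {a \<in> cube m :: (int^'d) set. a $ \<mu> = j}"
  have "card {a \<in> cube m. a + n \<in> cube m} = card (cube m :: (int^'d) set) - ?s"
    unfolding assms(4) by (rule card_Diff_subset) auto
  moreover have "?s \<le> card (cube m :: (int^'d) set)" by (rule card_mono) auto
  moreover have s: "real m * real ?s = real (card (cube m :: (int^'d) set))"
    using card_cube_slice[OF assms(2,3), of \<mu>] by (metis of_nat_mult)
  ultimately have "overlap m n = (real m * real ?s - real ?s) / (real m * real ?s)"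
    by (simp add: overlap_def of_nat_diff)
  moreover have "real ?s \<noteq> 0"
    using s card_cube_pos[OF assms(1), where 'a='d] by (metis mult_zero_right of_nat_0_less_iff less_irrefl)
  moreover have "(p * q - q) / (p * q) = 1 - 1 / p" if "p \<noteq> 0" "q \<noteq> 0" for p q :: real
    using that by (simp add: field_simps)
  ultimately show ?thesis using assms(1) by simp
qed

lemma overlap_axis:
  fixes \<mu> :: "'d::finite"
  assumes "m > 0"
  shows "overlap m (axis \<mu> 1 :: int^'d) = 1 - 1 / real m"
    and "overlap m (- axis \<mu> 1 :: int^'d) = 1 - 1 / real m"
proof -
  have "a + axis \<mu> 1 \<in> cube m \<longleftrightarrow> a $ \<mu> \<noteq> int m - 1" if "a \<in> cube m" for a :: "int^'d"
  proof
    assume "a + axis \<mu> 1 \<in> cube m"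
    then have "(a + axis \<mu> 1) $ \<mu> < int m" unfolding cube_def by blast
    then show "a $ \<mu> \<noteq> int m - 1" by simp
  next
    assume ne: "a $ \<mu> \<noteq> int m - 1"
    have "0 \<le> (a + axis \<mu> 1) $ i \<and> (a + axis \<mu> 1) $ i < int m" for i
    proof -
      have "0 \<le> a $ i" "a $ i < int m" using that by (auto simp: cube_def)
      then show ?thesis using ne by (cases "i = \<mu>") (auto simp: axis_def)
    qed
    then show "a + axis \<mu> 1 \<in> cube m" unfolding cube_def by blast
  qed
  then show "overlap m (axis \<mu> 1 :: int^'d) = 1 - 1 / real m"
    using assms by (intro overlap_minus_slice[of m "int m - 1" _ \<mu>]) auto
  have "a + - axis \<mu> 1 \<in> cube m \<longleftrightarrow> a $ \<mu> \<noteq> 0" if "a \<in> cube m" for a :: "int^'d"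
  proof
    assume "a + - axis \<mu> 1 \<in> cube m"
    then have "0 \<le> (a + - axis \<mu> 1) $ \<mu>" unfolding cube_def by blast
    then show "a $ \<mu> \<noteq> 0" by simp
  next
    assume ne: "a $ \<mu> \<noteq> 0"
    have "0 \<le> (a + - axis \<mu> 1) $ i \<and> (a + - axis \<mu> 1) $ i < int m" for i
    proof -
      have "0 \<le> a $ i" "a $ i < int m" using that by (auto simp: cube_def)
      then show ?thesis using ne by (cases "i = \<mu>") (auto simp: axis_def)
    qed
    then show "a + - axis \<mu> 1 \<in> cube m" unfolding cube_def by blast
  qed
  then show "overlap m (- axis \<mu> 1 :: int^'d) = 1 - 1 / real m"
    using assms by (intro overlap_minus_slice[of m 0 _ \<mu>]) auto
qed

definition fejer_kernel :: "nat \<Rightarrow> real^'d \<Rightarrow> real" where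
  "fejer_kernel m z = (cmod (\<Sum>a\<in>cube m. torus_char a z))\<^sup>2 / real (card (cube m :: (int^'d) set))"

definition fourier :: "(real^'d \<Rightarrow> complex) \<Rightarrow> int^'d \<Rightarrow> complex" where
  "fourier f n = (LINT x|torus_measure. f x * cnj (torus_char n x))"

text \<open>Applied to the Fourier coefficients of \<open>f\<close> this is the convolution of \<open>f\<close> with the Fejer kernel;
  applied to the entries of a Toeplitz matrix it is the symbol of the matrix.\<close>

definition fejer_sum :: "nat \<Rightarrow> (int^'d \<Rightarrow> complex) \<Rightarrow> real^'d \<Rightarrow> complex" where
  "fejer_sum m c x = (\<Sum>a\<in>cube m. \<Sum>b\<in>cube m. c (a - b) * torus_char (a - b) x) / of_nat (card (cube m :: (int^'d) set))"

lemma fejer_kernel_nonneg [simp]: "0 \<le> fejer_kernel m z"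
  by (simp add: fejer_kernel_def)

lemma fejer_kernel_eq:
  "complex_of_real (fejer_kernel m z) =
     (\<Sum>a\<in>cube m. \<Sum>b\<in>cube m. torus_char (a - b) z) / of_nat (card (cube m :: (int^'d) set))"
  for z :: "real^'d"
  unfolding fejer_kernel_def of_real_divide complex_norm_square cnj_sum sum_product torus_char_diff of_real_of_nat_eq ..

lemma continuous_fejer_kernel [continuous_intros]:
  "continuous_on S f \<Longrightarrow> continuous_on S (\<lambda>x. fejer_kernel m (f x))"
  unfolding fejer_kernel_def divide_inverse by (intro continuous_intros)

lemma integral_double_sum:
  fixes F :: "'i \<Rightarrow> 'j \<Rightarrow> real^'d \<Rightarrow> complex"
  assumes "\<And>a b. continuous_on UNIV (F a b)"
  shows "(LINT y|torus_measure. (\<Sum>a\<in>A. \<Sum>b\<in>B. F a b y) / c) = (\<Sum>a\<in>A. \<Sum>b\<in>B. (LINT y|torus_measure. F a b y)) / c"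
proof -
  have "(LINT y|torus_measure. (\<Sum>a\<in>A. \<Sum>b\<in>B. F a b y)) = (\<Sum>a\<in>A. (LINT y|torus_measure. (\<Sum>b\<in>B. F a b y)))"
    by (rule Bochner_Integration.integral_sum) (intro integrable_torus continuous_on_sum assms)
  also have "\<dots> = (\<Sum>a\<in>A. \<Sum>b\<in>B. (LINT y|torus_measure. F a b y))"
    by (intro sum.cong refl Bochner_Integration.integral_sum integrable_torus assms)
  finally show ?thesis by simp
qed

lemma fejer_sum_eq_integral:
  fixes f :: "real^'d \<Rightarrow> complex"
  assumes [continuous_intros]: "continuous_on UNIV f"
  shows "fejer_sum m (fourier f) x = (LINT y|torus_measure. f y * of_real (fejer_kernel m (x - y)))"
proof -
  have "(LINT y|torus_measure. f y * of_real (fejer_kernel m (x - y)))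
      = (LINT y|torus_measure. (\<Sum>a\<in>cube m. \<Sum>b\<in>cube m.
          torus_char (a - b) x * (f y * cnj (torus_char (a - b) y))) / of_nat (card (cube m :: (int^'d) set)))"
    by (simp add: fejer_kernel_eq torus_char_diff_right sum_distrib_left mult_ac)
  also have "\<dots> = (\<Sum>a\<in>cube m. \<Sum>b\<in>cube m. torus_char (a - b) x * fourier f (a - b)) / of_nat (card (cube m :: (int^'d) set))"
    unfolding fourier_def
    by (subst integral_double_sum) (intro continuous_intros, simp)
  finally show ?thesis by (simp add: fejer_sum_def mult.commute)
qed

text \<open>By orthogonality only the pairs \<open>b = a + n\<close> contribute.\<close>

lemma fejer_kernel_moment:
  fixes x :: "real^'d"
  shows "(LINT y|torus_measure. of_real (fejer_kernel m (x - y)) * torus_char n (x - y)) = of_real (overlap m n)"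
proof -
  let ?C = "cube m :: (int^'d) set"
  have "(LINT y|torus_measure. of_real (fejer_kernel m (x - y)) * torus_char n (x - y))
      = (LINT y|torus_measure. (\<Sum>a\<in>?C. \<Sum>b\<in>?C.
          torus_char (a - b + n) x * torus_char (b - (a + n)) y) / of_nat (card ?C))"
  proof (rule Bochner_Integration.integral_cong[OF refl])
    fix y
    have "torus_char (a - b) (x - y) * torus_char n (x - y) = torus_char (a - b + n) x * torus_char (b - (a + n)) y" for a b
      by (simp flip: torus_char_add add: torus_char_diff_right cnj_torus_char algebra_simps)
    then show "of_real (fejer_kernel m (x - y)) * torus_char n (x - y) =
        (\<Sum>a\<in>?C. \<Sum>b\<in>?C. torus_char (a - b + n) x * torus_char (b - (a + n)) y) / of_nat (card ?C)"
      by (simp add: fejer_kernel_eq sum_distrib_right)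
  qed
  also have "\<dots> = (\<Sum>a\<in>?C. \<Sum>b\<in>?C. torus_char (a - b + n) x *
      (LINT y|torus_measure. torus_char (b - (a + n)) y)) / of_nat (card ?C)"
    by (subst integral_double_sum) (intro continuous_intros, simp)
  also have "(\<Sum>a\<in>?C. \<Sum>b\<in>?C. torus_char (a - b + n) x * (LINT y|torus_measure. torus_char (b - (a + n)) y))
      = (\<Sum>a\<in>?C. \<Sum>b\<in>?C. if b = a + n then 1 else 0)"
    by (intro sum.cong refl) (auto simp: integral_torus_char)
  also have "\<dots> = of_nat (card {a \<in> ?C. a + n \<in> ?C})"
    by (simp add: sum.delta' flip: sum.inter_filter)
  finally show ?thesis by (simp add: overlap_def)
qed

lemma fejer_kernel_integral:
  assumes "m > 0"
  shows "(LINT y|torus_measure. fejer_kernel m (x - y)) = 1"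
proof -
  have "complex_of_real (LINT y|torus_measure. fejer_kernel m (x - y)) = 1"
    using fejer_kernel_moment[of m x 0] overlap_0[OF assms] by simp
  then show ?thesis by simp
qed

text \<open>The square of the chord is \<open>2 - e - cnj e\<close> for the character \<open>e\<close> of a unit vector, and the coefficients of
  the kernel at \<open>\<plusminus> axis \<mu> 1\<close> are \<open>1 - 1 / m\<close>.\<close>

lemma fejer_kernel_chord:
  fixes x :: "real^'d"
  assumes "m > 0"
  shows "(LINT y|torus_measure. fejer_kernel m (x - y) * (chord \<mu> (x - y))\<^sup>2) = 2 / real m"
proof -
  let ?K = "\<lambda>y. complex_of_real (fejer_kernel m (x - y))"
  let ?e = "axis \<mu> 1 :: int^'d"
  have eq: "complex_of_real (fejer_kernel m (x - y) * (chord \<mu> (x - y))\<^sup>2)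
      = 2 * (?K y * torus_char 0 (x - y)) - ?K y * torus_char ?e (x - y) - ?K y * torus_char (- ?e) (x - y)" for y
    unfolding chord_def of_real_mult complex_norm_square
    by (simp add: cnj_torus_char[symmetric]) (simp add: algebra_simps)
  have "complex_of_real (LINT y|torus_measure. fejer_kernel m (x - y) * (chord \<mu> (x - y))\<^sup>2)
      = (LINT y|torus_measure. 2 * (?K y * torus_char 0 (x - y)) - ?K y * torus_char ?e (x - y) - ?K y * torus_char (- ?e) (x - y))"
    by (simp only: eq integral_complex_of_real[symmetric])
  also have "\<dots> = 2 * (LINT y|torus_measure. ?K y * torus_char 0 (x - y))
      - (LINT y|torus_measure. ?K y * torus_char ?e (x - y)) - (LINT y|torus_measure. ?K y * torus_char (- ?e) (x - y))"
    by (subst Bochner_Integration.integral_diff Bochner_Integration.integral_diff integral_mult_right_zero,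
        (intro integrable_torus continuous_intros; fail)+)+ simp
  also have "\<dots> = complex_of_real (2 / real m)"
    unfolding fejer_kernel_moment overlap_axis[OF assms] overlap_0[OF assms] by simp
  finally show ?thesis by (simp only: of_real_eq_iff)
qed

text \<open>The kernel is a probability density whose second chordal moments are \<open>2 / m\<close>, so a bound for the
  increments that is affine in the squares of the chords can be integrated.\<close>

lemma fejer_sum_approx:
  fixes f :: "real^'d \<Rightarrow> complex"
  assumes m: "m > 0" and cont [continuous_intros]: "continuous_on UNIV f"
    and le: "\<And>y. cmod (f y - f x) \<le> \<alpha> + \<beta> * (\<Sum>\<mu>\<in>UNIV. (chord \<mu> (x - y))\<^sup>2)"
  shows "cmod (fejer_sum m (fourier f) x - f x) \<le> \<alpha> + \<beta> * (real CARD('d) * (2 / real m))"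
proof -
  let ?K = "\<lambda>y. fejer_kernel m (x - y)"
  have chord [continuous_intros]: "continuous_on UNIV (\<lambda>y. chord \<mu> (x - y))" for \<mu>
    unfolding chord_def by (intro continuous_intros)
  have "f x = (LINT y|torus_measure. f x * of_real (?K y))"
    by (subst integral_mult_right_zero, subst integral_complex_of_real) (simp add: fejer_kernel_integral[OF m])
  then have "fejer_sum m (fourier f) x - f x
      = (LINT y|torus_measure. f y * of_real (?K y)) - (LINT y|torus_measure. f x * of_real (?K y))"
    by (simp only: fejer_sum_eq_integral[OF cont])
  also have "\<dots> = (LINT y|torus_measure. f y * of_real (?K y) - f x * of_real (?K y))"
    by (subst Bochner_Integration.integral_diff) (auto intro!: integrable_torus continuous_intros)
  also have "cmod \<dots> \<le> (LINT y|torus_measure. \<alpha> * ?K y + \<beta> * (\<Sum>\<mu>\<in>UNIV. ?K y * (chord \<mu> (x - y))\<^sup>2))"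
  proof (rule Bochner_Integration.integral_norm_bound_integral)
    fix y
    have "cmod (f y * of_real (?K y) - f x * of_real (?K y)) = cmod (f y - f x) * ?K y"
      by (simp add: norm_mult flip: left_diff_distrib)
    also have "\<dots> \<le> (\<alpha> + \<beta> * (\<Sum>\<mu>\<in>UNIV. (chord \<mu> (x - y))\<^sup>2)) * ?K y"
      by (intro mult_right_mono le) simp
    finally show "cmod (f y * of_real (?K y) - f x * of_real (?K y))
        \<le> \<alpha> * ?K y + \<beta> * (\<Sum>\<mu>\<in>UNIV. ?K y * (chord \<mu> (x - y))\<^sup>2)"
      by (simp add: algebra_simps sum_distrib_left)
  qed (auto intro!: integrable_torus continuous_intros)
  also have "\<dots> = \<alpha> * (LINT y|torus_measure. ?K y) + \<beta> * (\<Sum>\<mu>\<in>UNIV. (LINT y|torus_measure. ?K y * (chord \<mu> (x - y))\<^sup>2))"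
  proof -
    have "(LINT y|torus_measure. (\<Sum>\<mu>\<in>UNIV. ?K y * (chord \<mu> (x - y))\<^sup>2))
        = (\<Sum>\<mu>\<in>UNIV. (LINT y|torus_measure. ?K y * (chord \<mu> (x - y))\<^sup>2))"
      by (rule Bochner_Integration.integral_sum) (intro integrable_torus continuous_intros)
    then show ?thesis
      by (subst Bochner_Integration.integral_add) (auto intro!: integrable_torus continuous_intros)
  qed
  also have "\<dots> = \<alpha> + \<beta> * (real CARD('d) * (2 / real m))"
    by (simp add: fejer_kernel_integral[OF m] fejer_kernel_chord[OF m])
  finally show ?thesis .
qed

lemma fejer_sum_lipschitz:
  fixes f :: "real^'d \<Rightarrow> complex"
  assumes m: "m > 0" and per: "periodic f" and diff: "\<And>x. f differentiable (at x)"
    and L: "\<And>\<mu> x. cmod (partial_deriv \<mu> f x) \<le> L"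
  shows "cmod (fejer_sum m (fourier f) x - f x) \<le> L * (3 * real CARD('d) / sqrt (real m))"
proof -
  let ?r = "sqrt (real m)"
  have r: "?r > 0" "?r * ?r = real m" using m by auto
  have "0 \<le> L" using L[of undefined x] norm_ge_zero order_trans by blast
  have "cmod (fejer_sum m (fourier f) x - f x) \<le> L * real CARD('d) / ?r + L * ?r * (real CARD('d) * (2 / real m))"
  proof (rule fejer_sum_approx[OF m differentiable_imp_continuous[OF diff]])
    fix y
    (* trades a chord for its square; the weight ?r balances the two error terms *)
    have amgm: "2 * c \<le> 1 / ?r + ?r * c\<^sup>2" for c
    proof -
      have "0 \<le> (?r * c - 1)\<^sup>2 / ?r" using r(1) by simp
      also have "(?r * c - 1)\<^sup>2 / ?r = ?r * c\<^sup>2 - 2 * c + 1 / ?r"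
        using r(1) by (simp add: power2_eq_square field_simps)
      finally show ?thesis by simp
    qed
    have "cmod (f y - f x) \<le> L * (\<Sum>\<mu>\<in>UNIV. 2 * chord \<mu> (x - y))"
      using periodic_lipschitz_chord[OF per diff L, of y x] by (simp add: sum_distrib_left mult_ac)
    also have "\<dots> \<le> L * (\<Sum>\<mu>\<in>UNIV. 1 / ?r + ?r * (chord \<mu> (x - y))\<^sup>2)"
      by (intro mult_left_mono sum_mono amgm \<open>0 \<le> L\<close>)
    also have "\<dots> = L * real CARD('d) / ?r + L * ?r * (\<Sum>\<mu>\<in>UNIV. (chord \<mu> (x - y))\<^sup>2)"
      by (simp add: sum.distrib algebra_simps flip: sum_distrib_left)
    finally show "cmod (f y - f x) \<le> L * real CARD('d) / ?r + L * ?r * (\<Sum>\<mu>\<in>UNIV. (chord \<mu> (x - y))\<^sup>2)" .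
  qed
  also have "\<dots> = L * (3 * real CARD('d) / ?r)"
    using r m by (simp add: field_simps)
  finally show ?thesis .
qed

text \<open>Fejer's theorem.  Uniform continuity bounds the increments at small distances; at large distances some
  chord is bounded below, and a multiple of its square dominates twice the supremum of \<open>f\<close>.\<close>

lemma fejer_sum_uniform:
  fixes f :: "real^'d \<Rightarrow> complex"
  assumes per: "periodic f" and cont: "continuous_on UNIV f" and \<epsilon>: "\<epsilon> > 0"
  shows "\<exists>m0>0. \<forall>m\<ge>m0. \<forall>x. cmod (fejer_sum m (fourier f) x - f x) \<le> \<epsilon>"
proof -
  obtain B where B: "B > 0" "\<And>x. cmod (f x) \<le> B"
    using continuous_periodic_bounded[OF cont per] by blast
  let ?Q = "cbox (- vec (2 * pi)) (vec (2 * pi)) :: (real^'d) set"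
  have "uniformly_continuous_on ?Q f"
    by (intro compact_uniformly_continuous continuous_on_subset[OF cont]) auto
  then obtain \<delta> where \<delta>: "\<delta> > 0" "\<And>u v. u \<in> ?Q \<Longrightarrow> v \<in> ?Q \<Longrightarrow> dist v u < \<delta> \<Longrightarrow> dist (f v) (f u) < \<epsilon> / 2"
    unfolding uniformly_continuous_on_def using \<epsilon> by (meson half_gt_zero)
  define \<eta> where "\<eta> = \<delta> / (2 * real CARD('d))"
  have \<eta>: "\<eta> > 0" using \<delta>(1) by (simp add: \<eta>_def)
  define \<beta> where "\<beta> = 2 * B / (\<eta> / 2)\<^sup>2"
  have "\<beta> > 0" using B(1) \<eta> by (simp add: \<beta>_def)
  (* \<beta> is chosen so that one coordinate of size \<eta>, whose chord is at least \<eta> / 2, dominates 2 * B *)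
  have le: "cmod (f y - f x) \<le> \<epsilon> / 2 + \<beta> * (\<Sum>\<mu>\<in>UNIV. (chord \<mu> (x - y))\<^sup>2)" for x y
  proof -
    obtain n where n: "\<forall>i. \<bar>(x + (2 * pi) *\<^sub>R lattice_point n) $ i\<bar> \<le> pi"
      using reduce_mod_lattice[of x] by blast
    obtain n' where n': "\<forall>i. \<bar>(x - y + (2 * pi) *\<^sub>R lattice_point n') $ i\<bar> \<le> pi"
      using reduce_mod_lattice[of "x - y"] by blast
    define u where "u = x + (2 * pi) *\<^sub>R lattice_point n"
    define w where "w = x - y + (2 * pi) *\<^sub>R lattice_point n'"
    have fu: "f u = f x" by (simp add: u_def periodic_lattice[OF per])
    have "u - w = y + (2 * pi) *\<^sub>R lattice_point (n - n')"
      by (simp add: u_def w_def lattice_point_diff algebra_simps)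
    then have fv: "f (u - w) = f y" by (simp add: periodic_lattice[OF per])
    have chord: "\<bar>w $ \<mu>\<bar> \<le> 2 * chord \<mu> (x - y)" for \<mu>
      using abs_le_chord[of w \<mu>] n' by (simp add: w_def chord_lattice)
    have ui: "\<bar>u $ i\<bar> \<le> pi" and wi: "\<bar>w $ i\<bar> \<le> pi" for i using n n' by (simp_all add: u_def w_def)
    have uQ: "u \<in> ?Q" "u - w \<in> ?Q"
      unfolding mem_box_cart using ui wi pi_gt_zero
      by (auto simp: abs_le_iff) (smt (verit))+
    show ?thesis
    proof (cases "\<forall>i. \<bar>w $ i\<bar> < \<eta>")
      case True
      have "norm w \<le> (\<Sum>i\<in>UNIV. \<bar>w $ i\<bar>)" by (rule norm_le_l1_cart)
      also have "\<dots> \<le> (\<Sum>i\<in>(UNIV :: 'd set). \<eta>)" using True by (intro sum_mono) (auto simp: less_imp_le)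
      also have "\<dots> < \<delta>" using \<delta>(1) by (simp add: \<eta>_def)
      finally have "dist (f (u - w)) (f u) < \<epsilon> / 2" by (intro \<delta>(2) uQ) (simp add: dist_norm)
      moreover have "0 \<le> \<beta> * (\<Sum>\<mu>\<in>UNIV. (chord \<mu> (x - y))\<^sup>2)"
        using \<open>\<beta> > 0\<close> by (simp add: sum_nonneg)
      ultimately show ?thesis by (simp add: fu fv dist_norm)
    next
      case False
      then obtain i where "\<eta> \<le> \<bar>w $ i\<bar>" by (auto simp: not_less)
      with chord[of i] have "\<eta> / 2 \<le> chord i (x - y)" by simp
      then have "(\<eta> / 2)\<^sup>2 \<le> (chord i (x - y))\<^sup>2" using \<eta> by (intro power_mono) auto
      also have "\<dots> \<le> (\<Sum>\<mu>\<in>UNIV. (chord \<mu> (x - y))\<^sup>2)" by (rule member_le_sum) auto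
      finally have "\<beta> * (\<eta> / 2)\<^sup>2 \<le> \<beta> * (\<Sum>\<mu>\<in>UNIV. (chord \<mu> (x - y))\<^sup>2)"
        using \<open>\<beta> > 0\<close> by (intro mult_left_mono) auto
      moreover have "\<beta> * (\<eta> / 2)\<^sup>2 = 2 * B" using \<eta> by (simp add: \<beta>_def)
      moreover have "cmod (f y - f x) \<le> 2 * B"
        using norm_triangle_ineq4[of "f y" "f x"] B(2)[of x] B(2)[of y] by linarith
      ultimately show ?thesis using \<epsilon> by linarith
    qed
  qed
  obtain m0 :: nat where m0: "4 * \<beta> * real CARD('d) / \<epsilon> < real m0" using reals_Archimedean2 by blast
  have "0 < 4 * \<beta> * real CARD('d) / \<epsilon>" using \<open>\<beta> > 0\<close> \<epsilon> by simp
  with m0 have "m0 > 0" by (metis gr0I of_nat_0 order_less_trans less_irrefl)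
  moreover have "cmod (fejer_sum m (fourier f) x - f x) \<le> \<epsilon>" if "m \<ge> m0" for m x
  proof -
    have m: "m > 0" using that \<open>m0 > 0\<close> by simp
    have "4 * \<beta> * real CARD('d) / \<epsilon> < real m" using m0 that by (simp add: less_le_trans)
    then have "\<beta> * (real CARD('d) * (2 / real m)) \<le> \<epsilon> / 2" using \<epsilon> m by (simp add: field_simps)
    with fejer_sum_approx[OF m cont le, of x] show ?thesis by simp
  qed
  ultimately show ?thesis by blast
qed

section \<open>Fourier coefficients of a derivative\<close>

lemma integral_fejer_sum:
  assumes "m > 0"
  shows "(LINT x|torus_measure. fejer_sum m c (x + v)) = c 0"
proof -
  let ?C = "cube m :: (int^'a) set"
  have "(LINT x|torus_measure. fejer_sum m c (x + v))
      = (\<Sum>a\<in>?C. \<Sum>b\<in>?C. c (a - b) * torus_char (a - b) v * (LINT x|torus_measure. torus_char (a - b) x)) / of_nat (card ?C)"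
    unfolding fejer_sum_def torus_char_add_right
    by (subst integral_double_sum) (intro continuous_intros, simp add: mult_ac)
  also have "(\<Sum>a\<in>?C. \<Sum>b\<in>?C. c (a - b) * torus_char (a - b) v * (LINT x|torus_measure. torus_char (a - b) x))
      = (\<Sum>a\<in>?C. \<Sum>b\<in>?C. if a = b then c 0 else 0)"
    by (intro sum.cong refl) (auto simp: integral_torus_char)
  also have "\<dots> = of_nat (card ?C) * c 0" by simp
  finally show ?thesis using zero_in_cube[OF assms, where 'a='a] by auto
qed

text \<open>For Fejer sums a translation multiplies each coefficient by a phase and fixes the one at zero; uniform
  approximation extends this to continuous functions.\<close>

lemma integral_translate:
  fixes f :: "real^'d \<Rightarrow> complex"
  assumes per: "periodic f" and cont: "continuous_on UNIV f"
  shows "(LINT x|torus_measure. f (x + v)) = (LINT x|torus_measure. f x)"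
proof -
  have contv [continuous_intros]: "continuous_on UNIV (\<lambda>x. f (x + v))"
    by (intro continuous_on_compose2[OF cont] continuous_intros) auto
  have bound: "cmod ((LINT x|torus_measure. f (x + v)) - fourier f 0) \<le> \<epsilon>" if \<epsilon>: "\<epsilon> > 0" for \<epsilon>
  proof -
    obtain m where m: "m > 0" "\<And>x. cmod (fejer_sum m (fourier f) x - f x) \<le> \<epsilon>"
      using fejer_sum_uniform[OF per cont \<epsilon>] by blast
    have "fourier f 0 = (LINT x|torus_measure. fejer_sum m (fourier f) (x + v))"
      by (simp only: integral_fejer_sum[OF m(1)])
    moreover have int: "integrable torus_measure (\<lambda>x. fejer_sum m (fourier f) (x + v))"
      unfolding fejer_sum_def divide_inverse by (intro integrable_torus continuous_intros)
    ultimately have "(LINT x|torus_measure. f (x + v)) - fourier f 0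
        = (LINT x|torus_measure. f (x + v) - fejer_sum m (fourier f) (x + v))"
      using integrable_torus[OF contv] by simp
    also have "cmod \<dots> \<le> (LINT x|(torus_measure :: (real^'d) measure). \<epsilon>)"
      using m(2) integrable_torus[OF contv] int
      by (intro Bochner_Integration.integral_norm_bound_integral)
        (auto simp: norm_minus_commute intro!: integrable_torus continuous_intros)
    finally show ?thesis by (simp add: measure_torus)
  qed
  have "cmod ((LINT x|torus_measure. f (x + v)) - fourier f 0) \<le> 0"
    by (rule field_le_epsilon) (simp only: add_0_left bound)
  then show ?thesis by (simp add: fourier_def)
qed

text \<open>The difference quotients have mean zero by translation invariance, and they are dominated by the
  supremum of the derivative.\<close>

lemma integral_partial_deriv:
  fixes g :: "real^'d \<Rightarrow> complex"
  assumes per: "periodic g" and diff: "\<And>x. g differentiable (at x)"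
    and cont: "continuous_on UNIV (partial_deriv \<mu> g)"
  shows "(LINT x|torus_measure. partial_deriv \<mu> g x) = 0"
proof -
  note contg = differentiable_imp_continuous[OF diff]
  obtain B where B: "B > 0" "\<And>x. cmod (partial_deriv \<mu> g x) \<le> B"
    using continuous_periodic_bounded[OF cont periodic_partial_deriv[OF per]] by blast
  define h where "h n = 1 / real (Suc n)" for n
  define q where "q n x = (g (x + h n *\<^sub>R axis \<mu> 1) - g x) /\<^sub>R h n" for n x
  have h0: "h n > 0" for n by (simp add: h_def)
  have hlim: "h \<longlonglongrightarrow> 0" unfolding h_def using LIMSEQ_inverse_real_of_nat by (simp add: inverse_eq_divide)
  have line: "((\<lambda>t. g (x + t *\<^sub>R axis \<mu> 1)) has_vector_derivative partial_deriv \<mu> g (x + t *\<^sub>R axis \<mu> 1)) (at t)" for x t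
  proof -
    have "(g has_derivative frechet_derivative g (at (x + t *\<^sub>R axis \<mu> 1))) (at (x + t *\<^sub>R axis \<mu> 1))"
      using diff by (simp add: frechet_derivative_works)
    from has_vector_derivative_line[OF this] show ?thesis by (simp add: partial_deriv_frechet[OF diff])
  qed
  have contq: "continuous_on UNIV (\<lambda>x. g (x + v))" for v
    by (intro continuous_on_compose2[OF contg] continuous_intros) auto
  have zero: "(LINT x|torus_measure. q n x) = 0" for n
    unfolding q_def using integrable_torus[OF contq] integrable_torus[OF contg]
    by (simp add: integral_translate[OF per contg])
  have "(\<lambda>n. LINT x|torus_measure. q n x) \<longlonglongrightarrow> (LINT x|torus_measure. partial_deriv \<mu> g x)"
  proof (rule integral_dominated_convergence[where w = "\<lambda>_. B"])
    show "partial_deriv \<mu> g \<in> borel_measurable torus_measure"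
      using borel_measurable_continuous_onI[OF cont] by simp
    show "q n \<in> borel_measurable torus_measure" for n
    proof -
      have "continuous_on UNIV (\<lambda>x. q n x)" unfolding q_def by (intro continuous_intros contq contg)
      from borel_measurable_continuous_onI[OF this] show ?thesis by simp
    qed
    show "integrable (torus_measure :: (real^'d) measure) (\<lambda>_. B)" by (intro integrable_torus continuous_intros)
    show "AE x in torus_measure. (\<lambda>n. q n x) \<longlonglongrightarrow> partial_deriv \<mu> g x"
    proof (rule AE_I2)
      fix x
      have "((\<lambda>t. (g (x + t *\<^sub>R axis \<mu> 1) - g x) /\<^sub>R t) \<longlongrightarrow> partial_deriv \<mu> g x) (at 0)"
      proof (rule LIM_zero_cancel, rule tendsto_norm_zero_cancel, rule Lim_transform_eventually)
        show "((\<lambda>t. norm (g (x + t *\<^sub>R axis \<mu> 1) - g x - t *\<^sub>R partial_deriv \<mu> g x) / norm t) \<longlongrightarrow> 0) (at 0)"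
          using line[of x 0] by (simp add: has_vector_derivative_def has_derivative_at)
        have "norm (g (x + t *\<^sub>R axis \<mu> 1) - g x - t *\<^sub>R partial_deriv \<mu> g x) / norm t
            = norm ((g (x + t *\<^sub>R axis \<mu> 1) - g x) /\<^sub>R t - partial_deriv \<mu> g x)" if "t \<noteq> 0" for t
        proof -
          have "(g (x + t *\<^sub>R axis \<mu> 1) - g x) /\<^sub>R t - partial_deriv \<mu> g x
              = (g (x + t *\<^sub>R axis \<mu> 1) - g x - t *\<^sub>R partial_deriv \<mu> g x) /\<^sub>R t"
            using that by (simp add: scaleR_diff_right)
          then show ?thesis by (simp add: divide_inverse mult.commute)
        qed
        then show "\<forall>\<^sub>F t in at 0. norm (g (x + t *\<^sub>R axis \<mu> 1) - g x - t *\<^sub>R partial_deriv \<mu> g x) / norm t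
            = norm ((g (x + t *\<^sub>R axis \<mu> 1) - g x) /\<^sub>R t - partial_deriv \<mu> g x)"
          by (simp add: eventually_at_filter)
      qed
      moreover have "filterlim h (at 0) sequentially"
        using hlim h0 by (auto simp: filterlim_at eventually_sequentially less_imp_neq[symmetric])
      ultimately show "(\<lambda>n. q n x) \<longlonglongrightarrow> partial_deriv \<mu> g x"
        unfolding q_def by (rule filterlim_compose)
    qed
    show "AE x in torus_measure. norm (q n x) \<le> B" for n
    proof (rule AE_I2)
      fix x
      have "cmod (g (x + h n *\<^sub>R axis \<mu> 1) - g (x + 0 *\<^sub>R axis \<mu> 1)) \<le> B * norm (h n - 0)"
      proof (rule differentiable_bound[of UNIV _ "\<lambda>t s. s *\<^sub>R partial_deriv \<mu> g (x + t *\<^sub>R axis \<mu> 1)"])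
        fix t
        show "((\<lambda>t. g (x + t *\<^sub>R axis \<mu> 1)) has_derivative (\<lambda>s. s *\<^sub>R partial_deriv \<mu> g (x + t *\<^sub>R axis \<mu> 1))) (at t)"
          using line[of x t] by (simp add: has_vector_derivative_def)
        show "onorm (\<lambda>s. s *\<^sub>R partial_deriv \<mu> g (x + t *\<^sub>R axis \<mu> 1)) \<le> B"
        proof (rule onorm_bound)
          fix s :: real
          show "norm (s *\<^sub>R partial_deriv \<mu> g (x + t *\<^sub>R axis \<mu> 1)) \<le> B * norm s"
            using mult_right_mono[OF B(2)[of "x + t *\<^sub>R axis \<mu> 1"], of "\<bar>s\<bar>"] by (simp add: mult.commute)
        qed (use B in simp)
      qed auto
      moreover have "norm (q n x) = cmod (g (x + h n *\<^sub>R axis \<mu> 1) - g x) / h n"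
        using h0[of n] by (simp add: q_def divide_inverse mult.commute)
      ultimately show "norm (q n x) \<le> B"
        using h0[of n] by (simp add: pos_divide_le_eq)
    qed
  qed
  then show ?thesis unfolding zero by (simp add: LIMSEQ_const_iff)
qed

text \<open>Integration by parts: the derivative of \<open>f\<close> times a character has mean zero.\<close>

lemma fourier_partial_deriv:
  fixes f :: "real^'d \<Rightarrow> complex"
  assumes per: "periodic f" and diff: "\<And>x. f differentiable (at x)"
    and cont [continuous_intros]: "continuous_on UNIV (partial_deriv \<mu> f)"
  shows "fourier (partial_deriv \<mu> f) n = \<i> * of_int (n $ \<mu>) * fourier f n"
proof -
  note contf [continuous_intros] = differentiable_imp_continuous[OF diff]
  let ?g = "\<lambda>x. f x * torus_char (- n) x"
  have d: "partial_deriv \<mu> ?g = (\<lambda>x. partial_deriv \<mu> f x * torus_char (- n) x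
      + (- \<i> * of_int (n $ \<mu>)) * (f x * torus_char (- n) x))"
    by (rule ext) (simp add: partial_deriv_mult[OF diff differentiable_torus_char] partial_deriv_torus_char)
  have "(LINT x|torus_measure. partial_deriv \<mu> ?g x) = 0"
  proof (rule integral_partial_deriv)
    show "periodic ?g" using per periodic_torus_char[of "- n"] by (simp add: periodic_def)
    show "?g differentiable (at x)" for x using diff differentiable_torus_char by (rule differentiable_mult)
    show "continuous_on UNIV (partial_deriv \<mu> ?g)" unfolding d by (intro continuous_intros)
  qed
  also have "(LINT x|torus_measure. partial_deriv \<mu> ?g x)
      = fourier (partial_deriv \<mu> f) n + (- \<i> * of_int (n $ \<mu>)) * fourier f n"
    unfolding d fourier_def cnj_torus_char
    by (subst Bochner_Integration.integral_add, (intro integrable_torus continuous_intros)+,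
        subst integral_mult_right_zero) simp
  finally show ?thesis by simp
qed

section \<open>The fibre of the spinor bundle\<close>

definition hdot :: "complex^'s::finite \<Rightarrow> complex^'s \<Rightarrow> complex" where
  "hdot v w = (\<Sum>s\<in>UNIV. v $ s * cnj (w $ s))"

lemma hdot_add_left: "hdot (u + v) w = hdot u w + hdot v w"
  by (simp add: hdot_def ring_distribs sum.distrib)

lemma hdot_add_right: "hdot w (u + v) = hdot w u + hdot w v"
  by (simp add: hdot_def ring_distribs sum.distrib)

lemma hdot_scale_left: "hdot (c *s v) w = c * hdot v w"
  by (simp add: hdot_def sum_distrib_left mult.assoc)

lemma hdot_scale_right: "hdot v (c *s w) = cnj c * hdot v w"
  by (simp add: hdot_def sum_distrib_left mult_ac)

lemma hdot_zero [simp]: "hdot 0 w = 0" "hdot w 0 = 0"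
  by (simp_all add: hdot_def)

lemma hdot_sum_left: "hdot (\<Sum>i\<in>I. v i) w = (\<Sum>i\<in>I. hdot (v i) w)"
  by (induction I rule: infinite_finite_induct) (simp_all add: hdot_add_left)

lemma hdot_sum_right: "hdot w (\<Sum>i\<in>I. v i) = (\<Sum>i\<in>I. hdot w (v i))"
  by (induction I rule: infinite_finite_induct) (simp_all add: hdot_add_right)

lemma hdot_commute: "hdot v w = cnj (hdot w v)"
  by (simp add: hdot_def mult.commute)

lemma hdot_self: "hdot v v = complex_of_real ((norm v)\<^sup>2)"
  by (simp add: hdot_def norm_vec_def L2_set_def sum_nonneg complex_norm_square del: of_real_power)

lemma hdot_Cauchy_Schwarz: "cmod (hdot v w) \<le> norm v * norm w"
proof -
  have "cmod (hdot v w) \<le> (\<Sum>s\<in>UNIV. \<bar>norm (v $ s)\<bar> * \<bar>norm (w $ s)\<bar>)"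
    unfolding hdot_def by (rule order_trans[OF norm_sum]) (simp add: norm_mult)
  also have "\<dots> \<le> norm v * norm w" unfolding norm_vec_def by (rule L2_set_mult_ineq)
  finally show ?thesis .
qed

lemma hdot_amgm: "cmod (hdot v w) \<le> ((norm v)\<^sup>2 + (norm w)\<^sup>2) / 2"
  using hdot_Cauchy_Schwarz[of v w] sum_squares_bound[of "norm v" "norm w"] by simp

lemma norm_scale: "norm (c *s (v :: complex^'s)) = cmod c * norm v"
proof -
  have "complex_of_real ((norm (c *s v))\<^sup>2) = complex_of_real ((cmod c * norm v)\<^sup>2)"
    unfolding hdot_self[symmetric] power_mult_distrib of_real_mult complex_norm_square
    by (simp add: hdot_scale_left hdot_scale_right)
  then have "(norm (c *s v))\<^sup>2 = (cmod c * norm v)\<^sup>2" by (simp only: of_real_eq_iff)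
  then show ?thesis by (simp add: power2_eq_iff_nonneg)
qed

lemma bounded_bilinear_scale: "bounded_bilinear ((*s) :: complex \<Rightarrow> complex^'s::finite \<Rightarrow> complex^'s)"
proof
  show "\<exists>K. \<forall>a b. norm (a *s b :: complex^'s) \<le> norm a * norm b * K"
    by (intro exI[of _ 1]) (simp add: norm_scale)
qed (simp_all add: vec_eq_iff algebra_simps scaleR_conv_of_real[where 'a=complex])

lemma bounded_linear_matrix: "bounded_linear ((*v) (A :: complex^'s^'s::finite))"
  by (rule linear_conv_bounded_linear[THEN iffD1])
    (auto simp: linear_iff matrix_vector_mult_def vec_eq_iff ring_distribs sum.distrib
      scaleR_conv_of_real[where 'a=complex] sum_distrib_left mult_ac)

lemma matrix_scale: "A *v (c *s v) = c *s (A *v (v :: complex^'s::finite))"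
  by (simp add: matrix_vector_mult_def vec_eq_iff sum_distrib_left mult_ac)

lemma matrix_sum: "A *v (\<Sum>i\<in>I. v i) = (\<Sum>i\<in>I. A *v (v i :: complex^'s::finite))"
  by (induction I rule: infinite_finite_induct) (simp_all add: matrix_vector_right_distrib)

lemma scale_sum_right: "c *s (\<Sum>i\<in>I. v i) = (\<Sum>i\<in>I. c *s (v i :: complex^'s))"
  by (induction I rule: infinite_finite_induct) (simp_all add: vector_ssub_ldistrib vector_add_ldistrib)

lemma continuous_on_scale [continuous_intros]:
  "continuous_on S f \<Longrightarrow> continuous_on S g \<Longrightarrow> continuous_on S (\<lambda>x. f x *s (g x :: complex^'s::finite))"
  by (rule bounded_bilinear.continuous_on[OF bounded_bilinear_scale])

lemma continuous_on_hdot [continuous_intros]: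
  "continuous_on S f \<Longrightarrow> continuous_on S g \<Longrightarrow> continuous_on S (\<lambda>x. hdot (f x) (g x))"
  unfolding hdot_def by (intro continuous_intros)

context
  fixes \<gamma> :: "'d::finite \<Rightarrow> complex^'s^'s::finite"
  assumes \<gamma>: "gamma_matrices \<gamma>"
begin

lemma hdot_gamma: "hdot (\<gamma> \<mu> *v v) w = hdot v (\<gamma> \<mu> *v w)"
proof -
  have sym: "\<gamma> \<mu> $ i $ j = cnj (\<gamma> \<mu> $ j $ i)" for i j using \<gamma> unfolding gamma_matrices_def by blast
  have "hdot (\<gamma> \<mu> *v v) w = (\<Sum>i\<in>UNIV. \<Sum>j\<in>UNIV. \<gamma> \<mu> $ i $ j * v $ j * cnj (w $ i))"
    by (simp add: hdot_def matrix_vector_mult_def sum_distrib_right)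
  also have "\<dots> = (\<Sum>j\<in>UNIV. \<Sum>i\<in>UNIV. \<gamma> \<mu> $ i $ j * v $ j * cnj (w $ i))" by (rule sum.swap)
  also have "\<dots> = (\<Sum>j\<in>UNIV. \<Sum>i\<in>UNIV. v $ j * cnj (\<gamma> \<mu> $ j $ i * w $ i))"
    by (intro sum.cong refl) (subst sym, simp)
  finally show ?thesis by (simp add: hdot_def matrix_vector_mult_def sum_distrib_left)
qed

lemma gamma_anticommute: "\<gamma> \<nu> *v (\<gamma> \<mu> *v v) + \<gamma> \<mu> *v (\<gamma> \<nu> *v v) = (if \<mu> = \<nu> then 2 else 0) *s v"
proof -
  have "\<gamma> \<nu> ** \<gamma> \<mu> + \<gamma> \<mu> ** \<gamma> \<nu> = mat (if \<mu> = \<nu> then 2 else 0)"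
    using \<gamma> unfolding gamma_matrices_def by (metis)
  then have "(\<gamma> \<nu> ** \<gamma> \<mu> + \<gamma> \<mu> ** \<gamma> \<nu>) *v v = mat (if \<mu> = \<nu> then 2 else 0) *v v" by simp
  moreover have "mat c *v v = c *s v" for c :: complex
    by (simp add: mat_def matrix_vector_mult_def vec_eq_iff if_distrib[of "\<lambda>x. x * _"] cong: if_cong)
  ultimately show ?thesis by (simp add: matrix_vector_mult_add_rdistrib matrix_vector_mul_assoc)
qed

lemma norm_gamma: "norm (\<gamma> \<mu> *v v) = norm v"
proof -
  have "2 * hdot (\<gamma> \<mu> *v v) (\<gamma> \<mu> *v v) = hdot (\<gamma> \<mu> *v (\<gamma> \<mu> *v v) + \<gamma> \<mu> *v (\<gamma> \<mu> *v v)) v"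
    unfolding hdot_add_left hdot_gamma[of \<mu> "\<gamma> \<mu> *v v" v] by simp
  also have "\<dots> = 2 * hdot v v" by (simp add: gamma_anticommute hdot_scale_left)
  finally have "(norm (\<gamma> \<mu> *v v))\<^sup>2 = (norm v)\<^sup>2" by (simp add: hdot_self flip: of_real_power)
  then show ?thesis by simp
qed

text \<open>Move \<open>\<gamma> \<nu>\<close> to the other side of the inner product and use the anticommutation relations: all
  terms but the one with index \<open>\<nu>\<close> cancel.\<close>

lemma gamma_extract:
  "hdot (\<Sum>\<mu>\<in>UNIV. c \<mu> *s (\<gamma> \<mu> *v v)) (\<gamma> \<nu> *v w) + hdot (\<Sum>\<mu>\<in>UNIV. c \<mu> *s (\<gamma> \<mu> *v (\<gamma> \<nu> *v v))) w
     = 2 * c \<nu> * hdot v w"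
proof -
  have "hdot (\<Sum>\<mu>\<in>UNIV. c \<mu> *s (\<gamma> \<mu> *v v)) (\<gamma> \<nu> *v w) + hdot (\<Sum>\<mu>\<in>UNIV. c \<mu> *s (\<gamma> \<mu> *v (\<gamma> \<nu> *v v))) w
      = (\<Sum>\<mu>\<in>UNIV. c \<mu> * hdot (\<gamma> \<nu> *v (\<gamma> \<mu> *v v) + \<gamma> \<mu> *v (\<gamma> \<nu> *v v)) w)"
    by (simp only: hdot_sum_left hdot_scale_left hdot_add_left distrib_left sum.distrib hdot_gamma[of \<nu>])
  also have "\<dots> = (\<Sum>\<mu>\<in>UNIV. if \<mu> = \<nu> then 2 * c \<nu> * hdot v w else 0)"
    by (intro sum.cong refl) (simp add: gamma_anticommute hdot_scale_left)
  finally show ?thesis by simp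
qed

end

section \<open>Trigonometric polynomials\<close>

definition trig_poly :: "'j set \<Rightarrow> ('j \<Rightarrow> int^'d) \<Rightarrow> ('j \<Rightarrow> complex) \<Rightarrow> real^'d \<Rightarrow> complex" where
  "trig_poly J \<nu> c x = (\<Sum>j\<in>J. c j * torus_char (\<nu> j) x)"

lemma has_derivative_trig_poly:
  "(trig_poly J \<nu> c has_derivative (\<lambda>h. \<Sum>j\<in>J. c j * (\<i> * complex_of_real (lattice_point (\<nu> j) \<bullet> h) * torus_char (\<nu> j) x))) (at x)"
  unfolding trig_poly_def by (intro has_derivative_sum has_derivative_mult_right has_derivative_torus_char)

lemma partial_deriv_trig_poly:
  "partial_deriv \<mu> (trig_poly J \<nu> c) = trig_poly J \<nu> (\<lambda>j. \<i> * of_int (\<nu> j $ \<mu>) * c j)"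
  by (rule ext) (simp add: partial_deriv_eq[OF has_derivative_trig_poly] trig_poly_def inner_axis
      lattice_point_def mult_ac)

lemma periodic_trig_poly: "periodic (trig_poly J \<nu> c)"
  using periodic_torus_char unfolding periodic_def trig_poly_def by (metis (no_types, lifting) sum.cong)

lemma smooth_trig_poly: "smooth (trig_poly J \<nu> c)"
proof -
  have "\<exists>c'. foldr partial_deriv \<mu>s (trig_poly J \<nu> c) = trig_poly J \<nu> c'" for \<mu>s
    by (induction \<mu>s) (auto simp: partial_deriv_trig_poly)
  then show ?thesis
    unfolding smooth_def using differentiableI[OF has_derivative_trig_poly[of J \<nu>]] by metis
qed

lemma trig_poly_torus_smooth: "trig_poly J \<nu> c \<in> torus_smooth"
  by (simp add: torus_smooth_def periodic_trig_poly smooth_trig_poly)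

lemma torus_smoothD:
  assumes "f \<in> torus_smooth"
  shows "periodic f" "f differentiable (at x)" "continuous_on UNIV f"
    "partial_deriv \<mu> f differentiable (at x)" "continuous_on UNIV (partial_deriv \<mu> f)"
proof -
  have s: "foldr partial_deriv \<mu>s f differentiable (at x)" for \<mu>s x
    using assms by (simp add: torus_smooth_def smooth_def)
  show "periodic f" using assms by (simp add: torus_smooth_def)
  show d: "f differentiable (at x)" for x using s[of "[]" x] by simp
  show e: "partial_deriv \<mu> f differentiable (at x)" for x using s[of "[\<mu>]" x] by simp
  show "continuous_on UNIV f" "continuous_on UNIV (partial_deriv \<mu> f)"
    by (intro differentiable_imp_continuous d e)+
qed

lemma torus_smooth_continuous: "f \<in> torus_smooth \<Longrightarrow> f \<in> torus_continuous"
  using torus_smoothD(1,3) by (auto simp: torus_continuous_def)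

lemma fourier_trig_poly:
  assumes "finite J"
  shows "fourier (trig_poly J \<nu> c) n = (\<Sum>j\<in>J. if \<nu> j = n then c j else 0)"
proof -
  have "fourier (trig_poly J \<nu> c) n = (LINT x|torus_measure. (\<Sum>j\<in>J. c j * torus_char (\<nu> j - n) x))"
    unfolding fourier_def trig_poly_def sum_distrib_right torus_char_diff by (simp only: mult.assoc)
  also have "\<dots> = (\<Sum>j\<in>J. (LINT x|torus_measure. c j * torus_char (\<nu> j - n) x))"
    by (rule Bochner_Integration.integral_sum) (intro integrable_torus continuous_intros)
  also have "\<dots> = (\<Sum>j\<in>J. if \<nu> j = n then c j else 0)"
    by (intro sum.cong refl) (simp add: integral_torus_char)
  finally show ?thesis .
qed

section \<open>Spinors with finitely many modes\<close>

definition trig :: "(int^'d) set \<Rightarrow> (int^'d \<Rightarrow> complex^'s) \<Rightarrow> ('d::finite, 's::finite) spinor" where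
  "trig \<Delta> v = (\<lambda>x. \<Sum>n\<in>\<Delta>. torus_char n x *s v n)"

lemma trig_spinors_eq: "trig_spinors \<Delta> = range (trig \<Delta>)"
  by (auto simp: trig_spinors_def trig_def)

lemma trig_in_trig_spinors [simp]: "trig \<Delta> v \<in> trig_spinors \<Delta>"
  by (simp add: trig_spinors_eq)

lemma continuous_on_trig [continuous_intros]: "continuous_on UNIV (trig \<Delta> v)"
  unfolding trig_def by (intro continuous_intros)

lemma periodic_trig: "periodic (trig \<Delta> v)"
  using periodic_torus_char unfolding periodic_def trig_def by (metis (no_types, lifting) sum.cong)

lemma trig_cong: "(\<And>n. n \<in> \<Delta> \<Longrightarrow> v n = w n) \<Longrightarrow> trig \<Delta> v = trig \<Delta> w"
  unfolding trig_def by (intro ext sum.cong) auto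

lemma trig_diff: "trig \<Delta> v x - trig \<Delta> w x = trig \<Delta> (\<lambda>n. v n - w n) x"
  by (simp add: trig_def vector_ssub_ldistrib sum_subtractf)

lemma has_derivative_trig:
  "(trig \<Delta> v has_derivative (\<lambda>h. \<Sum>n\<in>\<Delta>. (\<i> * complex_of_real (lattice_point n \<bullet> h) * torus_char n x) *s v n)) (at x)"
  unfolding trig_def
  by (intro has_derivative_sum bounded_linear.has_derivative[OF bounded_bilinear.bounded_linear_left[OF bounded_bilinear_scale]]
      has_derivative_torus_char)

lemma partial_deriv_trig: "partial_deriv \<mu> (trig \<Delta> v) = trig \<Delta> (\<lambda>n. (\<i> * of_int (n $ \<mu>)) *s v n)"
  by (rule ext, subst partial_deriv_eq[OF has_derivative_trig])
    (simp add: trig_def inner_axis lattice_point_def vector_smult_assoc mult_ac)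

lemma smooth_trig: "smooth (trig \<Delta> v)"
proof -
  have "\<exists>v'. foldr partial_deriv \<mu>s (trig \<Delta> v) = trig \<Delta> v'" for \<mu>s
    by (induction \<mu>s) (auto simp: partial_deriv_trig)
  then show ?thesis
    unfolding smooth_def using differentiableI[OF has_derivative_trig[of \<Delta>]] by metis
qed

lemma trig_smooth_spinor: "trig \<Delta> v \<in> smooth_spinors"
  by (simp add: smooth_spinors_def periodic_trig smooth_trig)

lemma continuous_spinor_L2:
  assumes [continuous_intros]: "continuous_on UNIV \<psi>" and "periodic \<psi>"
  shows "\<psi> \<in> L2_spinors"
  using assms by (auto simp: L2_spinors_def intro!: borel_measurable_continuous_onI integrable_torus continuous_intros)

lemma trig_L2: "trig \<Delta> v \<in> L2_spinors"
  by (intro continuous_spinor_L2 continuous_intros periodic_trig)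

lemma spinor_inner_hdot: "spinor_inner \<psi> \<phi> = (LINT x|torus_measure. hdot (\<psi> x) (\<phi> x))"
  by (simp add: spinor_inner_def hdot_def)

lemma Re_spinor_inner_self: "Re (spinor_inner \<psi> \<psi>) = (LINT x|torus_measure. (norm (\<psi> x))\<^sup>2)"
  by (simp add: spinor_inner_hdot hdot_self del: of_real_power)

lemma spinor_inner_self: "spinor_inner \<psi> \<psi> = complex_of_real (LINT x|torus_measure. (norm (\<psi> x))\<^sup>2)"
  by (simp add: spinor_inner_hdot hdot_self del: of_real_power)

lemma hdot_trig:
  "hdot (trig \<Delta> v x) (trig \<Delta> w x) = (\<Sum>k\<in>\<Delta>. \<Sum>l\<in>\<Delta>. cnj (torus_char (k - l) x) * hdot (v l) (w k))"
  unfolding trig_def hdot_sum_right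
  by (simp add: hdot_sum_left hdot_scale_left hdot_scale_right torus_char_diff sum_distrib_left mult_ac)

lemma spinor_inner_mult_trig:
  assumes f [continuous_intros]: "continuous_on UNIV f"
  shows "(LINT x|torus_measure. f x * hdot (trig \<Delta> v x) (trig \<Delta> w x))
    = (\<Sum>k\<in>\<Delta>. \<Sum>l\<in>\<Delta>. fourier f (k - l) * hdot (v l) (w k))"
proof -
  have "(LINT x|torus_measure. f x * hdot (trig \<Delta> v x) (trig \<Delta> w x))
      = (LINT x|torus_measure. (\<Sum>k\<in>\<Delta>. \<Sum>l\<in>\<Delta>. hdot (v l) (w k) * (f x * cnj (torus_char (k - l) x))) / 1)"
    by (simp add: hdot_trig sum_distrib_left mult_ac)
  also have "\<dots> = (\<Sum>k\<in>\<Delta>. \<Sum>l\<in>\<Delta>. hdot (v l) (w k) * fourier f (k - l))"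
    unfolding fourier_def by (subst integral_double_sum) (intro continuous_intros, simp)
  finally show ?thesis by (simp add: mult.commute)
qed

lemma fourier_one: "fourier (\<lambda>_. 1) n = (if n = 0 then 1 else 0)"
  by (simp add: fourier_def cnj_torus_char integral_torus_char)

lemma spinor_inner_trig:
  assumes "finite \<Delta>"
  shows "spinor_inner (trig \<Delta> v) (trig \<Delta> w) = (\<Sum>n\<in>\<Delta>. hdot (v n) (w n))"
proof -
  have "spinor_inner (trig \<Delta> v) (trig \<Delta> w) = (\<Sum>k\<in>\<Delta>. \<Sum>l\<in>\<Delta>. fourier (\<lambda>_. 1) (k - l) * hdot (v l) (w k))"
    using spinor_inner_mult_trig[of "\<lambda>_. 1" \<Delta> v w] by (simp add: spinor_inner_hdot continuous_on_const)
  also have "\<dots> = (\<Sum>k\<in>\<Delta>. \<Sum>l\<in>\<Delta>. if l = k then hdot (v k) (w k) else 0)"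
    by (intro sum.cong refl) (simp add: fourier_one)
  finally show ?thesis using assms by simp
qed

lemma norm_trig:
  assumes "finite \<Delta>"
  shows "(LINT x|torus_measure. (norm (trig \<Delta> v x))\<^sup>2) = (\<Sum>n\<in>\<Delta>. (norm (v n))\<^sup>2)"
proof -
  have "complex_of_real (LINT x|torus_measure. (norm (trig \<Delta> v x))\<^sup>2) = complex_of_real (\<Sum>n\<in>\<Delta>. (norm (v n))\<^sup>2)"
    using spinor_inner_trig[OF assms, of v v] by (simp only: spinor_inner_self hdot_self of_real_sum)
  then show ?thesis by (simp only: of_real_eq_iff)
qed

lemma fourier_coeff_trig:
  assumes "finite \<Delta>" "n \<in> \<Delta>"
  shows "fourier_coeff (trig \<Delta> v) n = v n"
proof -
  interpret s: bounded_bilinear "(*s) :: complex \<Rightarrow> complex^'b \<Rightarrow> _" by (rule bounded_bilinear_scale)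
  have "fourier_coeff (trig \<Delta> v) n = (LINT x|torus_measure. (\<Sum>l\<in>\<Delta>. torus_char (l - n) x *s v l))"
    by (simp add: fourier_coeff_def trig_def scale_sum_right torus_char_diff mult.commute)
  also have "\<dots> = (\<Sum>l\<in>\<Delta>. (LINT x|torus_measure. torus_char (l - n) x *s v l))"
    by (rule Bochner_Integration.integral_sum) (intro integrable_torus continuous_intros)
  also have "\<dots> = (\<Sum>l\<in>\<Delta>. (LINT x|torus_measure. torus_char (l - n) x) *s v l)"
    by (intro sum.cong refl integral_bounded_linear[OF s.bounded_linear_left] integrable_torus continuous_intros)
  also have "\<dots> = (\<Sum>l\<in>\<Delta>. if l = n then v l else 0)"
    by (intro sum.cong refl) (simp add: integral_torus_char)
  finally show ?thesis using assms by simp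
qed

lemma matrix_op_trig:
  assumes "finite \<Delta>"
  shows "matrix_op \<Delta> T (trig \<Delta> v) = trig \<Delta> (\<lambda>k. \<Sum>l\<in>\<Delta>. T (k, l) *s v l)"
proof
  fix x
  have "matrix_op \<Delta> T (trig \<Delta> v) x = (\<Sum>k\<in>\<Delta>. \<Sum>l\<in>\<Delta>. (T (k, l) * torus_char k x) *s v l)"
    unfolding matrix_op_def by (intro sum.cong refl) (simp add: fourier_coeff_trig assms)
  then show "matrix_op \<Delta> T (trig \<Delta> v) x = trig \<Delta> (\<lambda>k. \<Sum>l\<in>\<Delta>. T (k, l) *s v l) x"
    by (simp add: trig_def scale_sum_right mult.commute)
qed

lemma Dirac_trig: "Dirac \<gamma> (trig \<Delta> v) = trig \<Delta> (\<lambda>n. \<Sum>\<mu>\<in>UNIV. of_int (n $ \<mu>) *s (\<gamma> \<mu> *v v n))"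
proof
  fix x
  have "Dirac \<gamma> (trig \<Delta> v) x = (\<Sum>\<mu>\<in>UNIV. \<Sum>n\<in>\<Delta>. (torus_char n x * of_int (n $ \<mu>)) *s (\<gamma> \<mu> *v v n))"
    by (simp add: Dirac_def partial_deriv_trig) (simp add: trig_def matrix_sum matrix_scale scale_sum_right mult_ac sum_negf)
  also have "\<dots> = (\<Sum>n\<in>\<Delta>. \<Sum>\<mu>\<in>UNIV. (torus_char n x * of_int (n $ \<mu>)) *s (\<gamma> \<mu> *v v n))"
    by (rule sum.swap)
  finally show "Dirac \<gamma> (trig \<Delta> v) x = trig \<Delta> (\<lambda>n. \<Sum>\<mu>\<in>UNIV. of_int (n $ \<mu>) *s (\<gamma> \<mu> *v v n)) x"
    by (simp add: trig_def scale_sum_right)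
qed

text \<open>The Dirac operator preserves these spinors, so the projection in the truncated operator acts as the
  identity on all vectors that occur.\<close>

lemma orthogonal_projection_trig:
  assumes "finite \<Delta>"
  shows "orthogonal_projection (trig_spinors \<Delta>) (trig \<Delta> v) = trig \<Delta> v"
  unfolding orthogonal_projection_def
proof (rule the_equality)
  show "trig \<Delta> v \<in> trig_spinors \<Delta> \<and> (\<forall>\<eta>\<in>trig_spinors \<Delta>. spinor_inner (\<lambda>x. trig \<Delta> v x - trig \<Delta> v x) \<eta> = 0)"
    by (simp add: spinor_inner_hdot)
  fix \<phi> assume \<phi>: "\<phi> \<in> trig_spinors \<Delta> \<and> (\<forall>\<eta>\<in>trig_spinors \<Delta>. spinor_inner (\<lambda>x. trig \<Delta> v x - \<phi> x) \<eta> = 0)"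
  then obtain w where w: "\<phi> = trig \<Delta> w" by (auto simp: trig_spinors_eq)
  have eq: "(\<lambda>x. trig \<Delta> v x - \<phi> x) = trig \<Delta> (\<lambda>n. v n - w n)" by (rule ext) (simp add: w trig_diff)
  have "spinor_inner (trig \<Delta> (\<lambda>n. v n - w n)) (trig \<Delta> (\<lambda>n. v n - w n)) = 0"
    using \<phi> eq by (metis trig_in_trig_spinors)
  then have "complex_of_real (\<Sum>n\<in>\<Delta>. (norm (v n - w n))\<^sup>2) = 0"
    by (simp only: spinor_inner_trig[OF assms] hdot_self of_real_sum)
  then have "(\<Sum>n\<in>\<Delta>. (norm (v n - w n))\<^sup>2) = 0" by (simp only: of_real_eq_0_iff)
  then have "\<forall>n\<in>\<Delta>. v n = w n" using assms by (subst (asm) sum_nonneg_eq_0_iff) auto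
  then show "\<phi> = trig \<Delta> v" unfolding w by (intro trig_cong) simp
qed

lemma commutator_trig:
  assumes "finite \<Delta>"
  shows "commutator (Dirac_trunc \<Delta> \<gamma>) (matrix_op \<Delta> T) (trig \<Delta> v)
    = trig \<Delta> (\<lambda>k. \<Sum>l\<in>\<Delta>. T (k, l) *s (\<Sum>\<mu>\<in>UNIV. of_int (k $ \<mu> - l $ \<mu>) *s (\<gamma> \<mu> *v v l)))"
proof -
  have "commutator (Dirac_trunc \<Delta> \<gamma>) (matrix_op \<Delta> T) (trig \<Delta> v)
      = trig \<Delta> (\<lambda>k. (\<Sum>\<mu>\<in>UNIV. of_int (k $ \<mu>) *s (\<gamma> \<mu> *v (\<Sum>l\<in>\<Delta>. T (k, l) *s v l)))
          - (\<Sum>l\<in>\<Delta>. T (k, l) *s (\<Sum>\<mu>\<in>UNIV. of_int (l $ \<mu>) *s (\<gamma> \<mu> *v v l))))"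
    by (rule ext) (simp add: commutator_def Dirac_trunc_def matrix_op_trig[OF assms] Dirac_trig
        orthogonal_projection_trig[OF assms] trig_diff)
  also have "\<dots> = trig \<Delta> (\<lambda>k. \<Sum>l\<in>\<Delta>. T (k, l) *s (\<Sum>\<mu>\<in>UNIV. of_int (k $ \<mu> - l $ \<mu>) *s (\<gamma> \<mu> *v v l)))"
  proof (rule trig_cong)
    fix k
    have "(\<Sum>\<mu>\<in>UNIV. of_int (k $ \<mu>) *s (\<gamma> \<mu> *v (\<Sum>l\<in>\<Delta>. T (k, l) *s v l)))
        = (\<Sum>\<mu>\<in>UNIV. \<Sum>l\<in>\<Delta>. T (k, l) *s (of_int (k $ \<mu>) *s (\<gamma> \<mu> *v v l)))"
      by (simp add: matrix_sum matrix_scale scale_sum_right mult.commute)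
    also have "\<dots> = (\<Sum>l\<in>\<Delta>. T (k, l) *s (\<Sum>\<mu>\<in>UNIV. of_int (k $ \<mu>) *s (\<gamma> \<mu> *v v l)))"
      unfolding scale_sum_right by (rule sum.swap)
    finally show "(\<Sum>\<mu>\<in>UNIV. of_int (k $ \<mu>) *s (\<gamma> \<mu> *v (\<Sum>l\<in>\<Delta>. T (k, l) *s v l)))
          - (\<Sum>l\<in>\<Delta>. T (k, l) *s (\<Sum>\<mu>\<in>UNIV. of_int (l $ \<mu>) *s (\<gamma> \<mu> *v v l)))
        = (\<Sum>l\<in>\<Delta>. T (k, l) *s (\<Sum>\<mu>\<in>UNIV. of_int (k $ \<mu> - l $ \<mu>) *s (\<gamma> \<mu> *v v l)))"
      by (simp add: vector_ssub_ldistrib[symmetric] sum_subtractf[symmetric] vector_sub_rdistrib)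
  qed
  finally show ?thesis .
qed

section \<open>Operator norms and Lipschitz norms\<close>

definition clifford :: "('d \<Rightarrow> complex^'s^'s) \<Rightarrow> ('d::finite \<Rightarrow> complex) \<Rightarrow> complex^'s::finite \<Rightarrow> complex^'s" where
  "clifford \<gamma> c v = (\<Sum>\<mu>\<in>UNIV. c \<mu> *s (\<gamma> \<mu> *v v))"

lemma clifford_scale: "clifford \<gamma> c (a *s v) = a *s clifford \<gamma> c v"
  by (simp add: clifford_def matrix_scale scale_sum_right vector_smult_assoc mult.commute)

lemma operator_norm_leI:
  assumes "\<And>\<psi>. \<psi> \<in> H \<Longrightarrow> Re (spinor_inner (A \<psi>) (A \<psi>)) \<le> Re (spinor_inner \<psi> \<psi>)"
  shows "operator_norm H A \<le> 1"
  unfolding operator_norm_def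
proof (rule SUP_least)
  fix \<psi> assume "\<psi> \<in> {\<psi> \<in> H. spinor_norm \<psi> \<le> 1}"
  then have "spinor_norm (A \<psi>) \<le> spinor_norm \<psi>" "spinor_norm \<psi> \<le> 1"
    using assms[of \<psi>] unfolding spinor_norm_def by auto
  then show "ennreal (spinor_norm (A \<psi>)) \<le> 1" by (simp add: ennreal_le_1)
qed

text \<open>The operator norm sees only spinors of norm at most one.  If \<open>Q > S\<close>, then \<open>t\<^sup>2 = 2 / (S + Q)\<close> gives a
  spinor of norm at most one with an image of norm greater than one, also in the case \<open>S = 0\<close>.\<close>

lemma operator_norm_leD:
  assumes A: "operator_norm H A \<le> 1"
    and \<psi>: "\<And>t :: real. \<psi> t \<in> H" "\<And>t. Re (spinor_inner (\<psi> t) (\<psi> t)) = t\<^sup>2 * S"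
      "\<And>t. Re (spinor_inner (A (\<psi> t)) (A (\<psi> t))) = t\<^sup>2 * Q"
    and S: "0 \<le> S"
  shows "Q \<le> S"
proof (rule ccontr)
  assume "\<not> Q \<le> S"
  define r where "r = (S + Q) / 2"
  have r: "S \<le> r" "r < Q" "0 < r" using \<open>\<not> Q \<le> S\<close> S by (auto simp: r_def)
  define t where "t = 1 / sqrt r"
  have t: "t\<^sup>2 = 1 / r" using r by (simp add: t_def power_divide)
  have "spinor_norm (\<psi> t) \<le> 1" using r by (simp add: spinor_norm_def \<psi>(2) t)
  then have "ennreal (spinor_norm (A (\<psi> t))) \<le> operator_norm H A"
    unfolding operator_norm_def using \<psi>(1) by (intro SUP_upper) auto
  with A have "ennreal (spinor_norm (A (\<psi> t))) \<le> 1" by (rule order_trans[rotated])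
  then have "spinor_norm (A (\<psi> t)) \<le> 1" by (simp add: ennreal_le_1)
  then have "Q / r \<le> 1" by (simp add: spinor_norm_def \<psi>(3) t)
  with r show False by (simp add: field_simps)
qed

definition sqnorm :: "(int^'d) set \<Rightarrow> (int^'d \<Rightarrow> complex^'s::finite) \<Rightarrow> real" where
  "sqnorm \<Delta> v = (\<Sum>n\<in>\<Delta>. (norm (v n))\<^sup>2)"

lemma sqnorm_nonneg [simp]: "0 \<le> sqnorm \<Delta> v"
  by (simp add: sqnorm_def sum_nonneg)

lemma Re_spinor_inner_trig:
  "finite \<Delta> \<Longrightarrow> Re (spinor_inner (trig \<Delta> v) (trig \<Delta> v)) = sqnorm \<Delta> v"
  by (simp add: Re_spinor_inner_self norm_trig sqnorm_def)

lemma operator_norm_trig_iff: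
  fixes B :: "(int^'d \<Rightarrow> complex^'s) \<Rightarrow> int^'d \<Rightarrow> complex^'s::finite"
  assumes fin: "finite \<Delta>" and A: "\<And>v. A (trig \<Delta> v) = trig \<Delta> (B v)"
    and B: "\<And>(c::complex) v k. B (\<lambda>l. c *s v l) k = c *s B v k"
  shows "operator_norm (trig_spinors \<Delta>) A \<le> 1 \<longleftrightarrow> (\<forall>v. sqnorm \<Delta> (B v) \<le> sqnorm \<Delta> v)"
proof (intro iffI allI)
  fix v :: "int^'d \<Rightarrow> complex^'s" assume norm: "operator_norm (trig_spinors \<Delta>) A \<le> 1"
  let ?\<psi> = "\<lambda>t. trig \<Delta> (\<lambda>l. complex_of_real t *s v l)"
  show "sqnorm \<Delta> (B v) \<le> sqnorm \<Delta> v"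
  proof (rule operator_norm_leD[OF norm, of ?\<psi>])
    fix t
    show "Re (spinor_inner (?\<psi> t) (?\<psi> t)) = t\<^sup>2 * sqnorm \<Delta> v"
      by (simp add: Re_spinor_inner_trig[OF fin] sqnorm_def norm_scale power_mult_distrib sum_distrib_left)
    have "A (?\<psi> t) = trig \<Delta> (\<lambda>k. complex_of_real t *s B v k)"
      unfolding A by (rule trig_cong) (rule B)
    then show "Re (spinor_inner (A (?\<psi> t)) (A (?\<psi> t))) = t\<^sup>2 * sqnorm \<Delta> (B v)"
      by (simp add: Re_spinor_inner_trig[OF fin] sqnorm_def norm_scale power_mult_distrib sum_distrib_left)
  qed simp_all
next
  assume le: "\<forall>v :: int^'d \<Rightarrow> complex^'s. sqnorm \<Delta> (B v) \<le> sqnorm \<Delta> v"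
  show "operator_norm (trig_spinors \<Delta>) A \<le> 1"
  proof (rule operator_norm_leI)
    fix \<psi> :: "('d, 's) spinor" assume "\<psi> \<in> trig_spinors \<Delta>"
    then obtain v where v: "\<psi> = trig \<Delta> v" by (auto simp: trig_spinors_eq)
    show "Re (spinor_inner (A \<psi>) (A \<psi>)) \<le> Re (spinor_inner \<psi> \<psi>)"
      using le by (simp add: v A Re_spinor_inner_trig[OF fin])
  qed
qed

definition mat_apply :: "(int^'d) set \<Rightarrow> ((int^'d) \<times> (int^'d) \<Rightarrow> complex) \<Rightarrow> (int^'d \<Rightarrow> complex^'s) \<Rightarrow> int^'d \<Rightarrow> complex^'s" where
  "mat_apply \<Delta> T v k = (\<Sum>l\<in>\<Delta>. T (k, l) *s v l)"

text \<open>The coefficients of \<open>[D, T]\<close> applied to a spinor: \<open>D\<close> is diagonal, so the commutator multiplies the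
  entry at \<open>(k, l)\<close> by the Clifford action of \<open>k - l\<close>.\<close>

definition mat_commutator :: "('d \<Rightarrow> complex^'s^'s) \<Rightarrow> (int^'d) set \<Rightarrow> ((int^'d) \<times> (int^'d) \<Rightarrow> complex) \<Rightarrow>
    (int^'d \<Rightarrow> complex^'s::finite) \<Rightarrow> int^'d::finite \<Rightarrow> complex^'s" where
  "mat_commutator \<gamma> \<Delta> T v k = (\<Sum>l\<in>\<Delta>. T (k, l) *s clifford \<gamma> (\<lambda>\<mu>. of_int (k $ \<mu> - l $ \<mu>)) (v l))"

lemma operator_norm_matrix_iff:
  assumes "finite \<Delta>"
  shows "operator_norm (trig_spinors \<Delta> :: ('d::finite, 's::finite) spinor set) (matrix_op \<Delta> T) \<le> 1
    \<longleftrightarrow> (\<forall>v :: int^'d \<Rightarrow> complex^'s. sqnorm \<Delta> (mat_apply \<Delta> T v) \<le> sqnorm \<Delta> v)"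
  by (rule operator_norm_trig_iff[OF assms])
    (simp_all add: matrix_op_trig[OF assms] mat_apply_def[abs_def] scale_sum_right vector_smult_assoc mult.commute)

lemma operator_norm_matrix_commutator_iff:
  fixes \<gamma> :: "'d::finite \<Rightarrow> complex^'s^'s::finite"
  assumes "finite \<Delta>"
  shows "operator_norm (trig_spinors \<Delta>) (commutator (Dirac_trunc \<Delta> \<gamma>) (matrix_op \<Delta> T)) \<le> 1
    \<longleftrightarrow> (\<forall>v. sqnorm \<Delta> (mat_commutator \<gamma> \<Delta> T v) \<le> sqnorm \<Delta> v)"
proof (rule operator_norm_trig_iff[OF assms])
  show "commutator (Dirac_trunc \<Delta> \<gamma>) (matrix_op \<Delta> T) (trig \<Delta> v) = trig \<Delta> (mat_commutator \<gamma> \<Delta> T v)" for v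
    unfolding commutator_trig[OF assms] mat_commutator_def[abs_def] clifford_def ..
  show "mat_commutator \<gamma> \<Delta> T (\<lambda>l. c *s v l) k = c *s mat_commutator \<gamma> \<Delta> T v k" for c v k
    by (simp add: mat_commutator_def clifford_scale scale_sum_right vector_smult_assoc mult.commute)
qed

lemma fejer_kernel_minus: "fejer_kernel m (- z) = fejer_kernel m z"
proof -
  have "(\<Sum>a\<in>cube m. torus_char a (- z)) = cnj (\<Sum>a\<in>cube m. torus_char a z)"
    by (simp add: torus_char_minus_right)
  then show ?thesis unfolding fejer_kernel_def by (simp only: complex_mod_cnj)
qed

text \<open>The mean of \<open>g\<close> against the kernel at \<open>x\<close> converges to \<open>g x\<close>.\<close>

lemma fejer_kernel_localise:
  fixes g :: "real^'d \<Rightarrow> real"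
  assumes g: "continuous_on UNIV g" "periodic g"
    and le: "\<And>m. m > 0 \<Longrightarrow> (LINT y|torus_measure. fejer_kernel m (x - y) * g y) \<le> C"
  shows "g x \<le> C"
proof (rule field_le_epsilon)
  fix \<epsilon> :: real assume "\<epsilon> > 0"
  let ?f = "\<lambda>y. complex_of_real (g y)"
  have f: "continuous_on UNIV ?f" "periodic ?f"
    using g by (auto intro!: continuous_intros simp: periodic_def)
  obtain m where m: "m > 0" "cmod (fejer_sum m (fourier ?f) x - ?f x) \<le> \<epsilon>"
    using fejer_sum_uniform[OF f(2,1) \<open>\<epsilon> > 0\<close>] by blast
  have "fejer_sum m (fourier ?f) x = (LINT y|torus_measure. complex_of_real (fejer_kernel m (x - y) * g y))"
    unfolding fejer_sum_eq_integral[OF f(1)] by (simp add: mult.commute)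
  also have "\<dots> = complex_of_real (LINT y|torus_measure. fejer_kernel m (x - y) * g y)"
    by (rule integral_complex_of_real)
  finally have "\<bar>(LINT y|torus_measure. fejer_kernel m (x - y) * g y) - g x\<bar> \<le> \<epsilon>"
    using m(2) by (simp only: of_real_diff[symmetric] norm_of_real)
  then show "g x \<le> C + \<epsilon>" using le[OF m(1)] by linarith
qed

text \<open>An operator that acts in the fibres is tested on \<open>s u\<close>, where \<open>u\<close> is a fixed vector and \<open>s\<close> is the sum of
  the characters in a cube, translated by \<open>x\<close>.  As \<open>|s|\<^sup>2\<close> is a multiple of the Fejer kernel at \<open>x\<close>, the norm
  bound becomes a bound for the mean of \<open>(G y u)\<^sup>2\<close> against the kernel.\<close>

lemma operator_norm_pointwise:
  fixes A :: "('d::finite, 's::finite) spinor \<Rightarrow> ('d, 's) spinor"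
  assumes A: "operator_norm H A \<le> 1" and H: "\<And>\<Delta> v. trig \<Delta> v \<in> H"
    and G: "\<And>\<Delta> v y. norm (A (trig \<Delta> v) y) = G y (trig \<Delta> v y)"
    and hom: "\<And>y c u. G y (c *s u) = cmod c * G y u"
    and cont [continuous_intros]: "\<And>u. continuous_on UNIV (\<lambda>y. G y u)" and per: "\<And>u. periodic (\<lambda>y. G y u)"
  shows "(G x u)\<^sup>2 \<le> (norm u)\<^sup>2"
proof (rule fejer_kernel_localise[where g = "\<lambda>y. (G y u)\<^sup>2"])
  show "continuous_on UNIV (\<lambda>y. (G y u)\<^sup>2)" by (intro continuous_intros)
  show "periodic (\<lambda>y. (G y u)\<^sup>2)" using per[of u] by (simp add: periodic_def)
  fix m :: nat assume m: "m > 0"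
  define M where "M = real (card (cube m :: (int^'d) set))"
  have "M > 0" using card_cube_pos[OF m, where 'a='d] by (simp add: M_def)
  define \<psi> where "\<psi> t = trig (cube m) (\<lambda>a. (complex_of_real t * torus_char a (- x)) *s u)" for t
  define s where "s y = (\<Sum>a\<in>cube m. torus_char a (y - x))" for y
  have \<psi>: "\<psi> t y = (complex_of_real t * s y) *s u" for t y
    by (simp add: \<psi>_def trig_def s_def torus_char_diff_right torus_char_minus_right vector_smult_assoc
        sum_distrib_left mult_ac flip: bounded_bilinear.sum_left[OF bounded_bilinear_scale])
  have s: "(cmod (s y))\<^sup>2 = M * fejer_kernel m (x - y)" for y
  proof -
    have "fejer_kernel m (y - x) = fejer_kernel m (x - y)" using fejer_kernel_minus[of m "x - y"] by simp
    moreover have "(cmod (s y))\<^sup>2 = M * fejer_kernel m (y - x)"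
      unfolding fejer_kernel_def s_def M_def[symmetric] using \<open>M > 0\<close> by simp
    ultimately show ?thesis by simp
  qed
  have "M * (LINT y|torus_measure. fejer_kernel m (x - y) * (G y u)\<^sup>2) \<le> M * (norm u)\<^sup>2"
  proof (rule operator_norm_leD[OF A, of \<psi>])
    fix t
    show "\<psi> t \<in> H" unfolding \<psi>_def by (rule H)
    have "Re (spinor_inner (\<psi> t) (\<psi> t)) = (LINT y|torus_measure. t\<^sup>2 * M * (norm u)\<^sup>2 * fejer_kernel m (x - y))"
      unfolding Re_spinor_inner_self \<psi> norm_scale norm_mult power_mult_distrib s by (simp add: mult_ac)
    also have "\<dots> = t\<^sup>2 * M * (norm u)\<^sup>2" by (simp add: fejer_kernel_integral[OF m])
    finally show "Re (spinor_inner (\<psi> t) (\<psi> t)) = t\<^sup>2 * (M * (norm u)\<^sup>2)" by simp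
    have "norm (A (\<psi> t) y) = cmod (complex_of_real t * s y) * G y u" for y
      using G[of "cube m" _ y] \<psi>[of t y] hom by (simp add: \<psi>_def)
    then have "Re (spinor_inner (A (\<psi> t)) (A (\<psi> t)))
        = (LINT y|torus_measure. (t\<^sup>2 * M) * (fejer_kernel m (x - y) * (G y u)\<^sup>2))"
      unfolding Re_spinor_inner_self by (simp add: norm_mult power_mult_distrib s mult_ac)
    then show "Re (spinor_inner (A (\<psi> t)) (A (\<psi> t)))
        = t\<^sup>2 * (M * (LINT y|torus_measure. fejer_kernel m (x - y) * (G y u)\<^sup>2))" by simp
  qed (use \<open>M > 0\<close> in simp)
  then show "(LINT y|torus_measure. fejer_kernel m (x - y) * (G y u)\<^sup>2) \<le> (norm u)\<^sup>2"
    using \<open>M > 0\<close> by (simp only: mult_le_cancel_left_pos)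
qed

lemma exists_unit_spinor: "\<exists>u :: complex^'s::finite. norm u = 1"
proof -
  have "complex_of_real ((norm (axis undefined 1 :: complex^'s))\<^sup>2) = 1"
    unfolding hdot_self[symmetric] hdot_def by (simp add: axis_def if_distrib cong: if_cong)
  then have "(norm (axis undefined 1 :: complex^'s))\<^sup>2 = 1" by (simp only: of_real_eq_1_iff)
  then show ?thesis by (metis norm_ge_zero power2_eq_1_iff neg_0_le_iff_le not_one_le_zero)
qed

lemma operator_norm_mult_opD:
  assumes f: "f \<in> torus_smooth"
    and norm: "operator_norm (L2_spinors :: ('d::finite, 's::finite) spinor set) (mult_op f) \<le> 1"
  shows "cmod (f x) \<le> 1"
proof -
  obtain u :: "complex^'s" where u: "norm u = 1" using exists_unit_spinor by blast
  note [continuous_intros] = torus_smoothD(3)[OF f]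
  have "(cmod (f x) * norm u)\<^sup>2 \<le> (norm u)\<^sup>2"
    using torus_smoothD(1)[OF f]
    by (intro operator_norm_pointwise[OF norm trig_L2, of "\<lambda>y v. cmod (f y) * norm v"] continuous_intros)
      (auto simp: mult_op_def norm_scale periodic_def)
  then show ?thesis by (simp add: u abs_square_le_1)
qed

lemma operator_norm_mult_opI:
  assumes "\<And>x. cmod (f x) \<le> 1"
  shows "operator_norm (L2_spinors :: ('d::finite, 's::finite) spinor set) (mult_op f) \<le> 1"
proof (rule operator_norm_leI)
  fix \<psi> :: "('d, 's) spinor" assume "\<psi> \<in> L2_spinors"
  then have "integrable torus_measure (\<lambda>x. (norm (\<psi> x))\<^sup>2)" by (simp add: L2_spinors_def)
  then show "Re (spinor_inner (mult_op f \<psi>) (mult_op f \<psi>)) \<le> Re (spinor_inner \<psi> \<psi>)"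
    unfolding Re_spinor_inner_self
  proof (rule integral_mono_AE')
    show "AE x in torus_measure. (norm (mult_op f \<psi> x))\<^sup>2 \<le> (norm (\<psi> x))\<^sup>2"
      using assms by (intro AE_I2) (simp add: mult_op_def norm_scale power_mult_distrib mult_left_le_one_le power_le_one)
  qed simp
qed

lemma partial_deriv_scale:
  fixes \<psi> :: "real^'d \<Rightarrow> complex^'s::finite"
  assumes "f differentiable (at x)" "\<psi> differentiable (at x)"
  shows "partial_deriv \<mu> (\<lambda>x. f x *s \<psi> x) x = f x *s partial_deriv \<mu> \<psi> x + partial_deriv \<mu> f x *s \<psi> x"
proof -
  obtain f' \<psi>' where d: "(f has_derivative f') (at x)" "(\<psi> has_derivative \<psi>') (at x)"
    using assms by (auto simp: differentiable_def)
  show ?thesis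
    using partial_deriv_eq[OF bounded_bilinear.FDERIV[OF bounded_bilinear_scale d]]
    by (simp add: partial_deriv_eq[OF d(1)] partial_deriv_eq[OF d(2)])
qed

lemma commutator_mult_op:
  assumes "f differentiable (at x)" "\<psi> differentiable (at x)"
  shows "commutator (Dirac \<gamma>) (mult_op f) \<psi> x = (- \<i>) *s clifford \<gamma> (\<lambda>\<mu>. partial_deriv \<mu> f x) (\<psi> x)"
proof -
  have m: "mult_op f \<psi> = (\<lambda>x. f x *s \<psi> x)" by (rule ext) (simp add: mult_op_def)
  have "Dirac \<gamma> (mult_op f \<psi>) x = (- \<i>) *s ((\<Sum>\<mu>\<in>UNIV. f x *s (\<gamma> \<mu> *v partial_deriv \<mu> \<psi> x))
      + clifford \<gamma> (\<lambda>\<mu>. partial_deriv \<mu> f x) (\<psi> x))"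
    unfolding Dirac_def m partial_deriv_scale[OF assms] clifford_def
    by (simp add: matrix_vector_right_distrib matrix_scale sum.distrib)
  moreover have "mult_op f (Dirac \<gamma> \<psi>) x = (- \<i>) *s (\<Sum>\<mu>\<in>UNIV. f x *s (\<gamma> \<mu> *v partial_deriv \<mu> \<psi> x))"
    by (simp add: mult_op_def Dirac_def scale_sum_right vector_smult_assoc mult.commute)
  ultimately show ?thesis by (simp add: commutator_def vector_add_ldistrib)
qed

lemma continuous_clifford [continuous_intros]:
  "(\<And>\<mu>. continuous_on S (c \<mu>)) \<Longrightarrow> continuous_on S (\<lambda>x. clifford \<gamma> (\<lambda>\<mu>. c \<mu> x) v)"
  unfolding clifford_def by (intro continuous_intros)

lemma operator_norm_commutatorD:
  fixes \<gamma> :: "'d::finite \<Rightarrow> complex^'s^'s::finite"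
  assumes f: "f \<in> torus_smooth" and norm: "operator_norm smooth_spinors (commutator (Dirac \<gamma>) (mult_op f)) \<le> 1"
  shows "norm (clifford \<gamma> (\<lambda>\<mu>. partial_deriv \<mu> f x) u) \<le> norm u"
proof -
  note [continuous_intros] = torus_smoothD(5)[OF f]
  let ?G = "\<lambda>y v. norm (clifford \<gamma> (\<lambda>\<mu>. partial_deriv \<mu> f y) v)"
  have "(?G x u)\<^sup>2 \<le> (norm u)\<^sup>2"
  proof (rule operator_norm_pointwise[OF norm trig_smooth_spinor])
    show "norm (commutator (Dirac \<gamma>) (mult_op f) (trig \<Delta> v) y) = ?G y (trig \<Delta> v y)" for \<Delta> v y
      by (subst commutator_mult_op[OF torus_smoothD(2)[OF f] differentiableI[OF has_derivative_trig]])
        (simp add: norm_scale)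
    show "?G y (c *s u) = cmod c * ?G y u" for y c u by (simp add: clifford_scale norm_scale)
    show "continuous_on UNIV (\<lambda>y. ?G y u)" for u by (intro continuous_intros)
    show "periodic (\<lambda>y. ?G y u)" for u
      using periodic_partial_deriv[OF torus_smoothD(1)[OF f]] by (simp add: periodic_def)
  qed
  then show ?thesis by (simp add: power2_le_iff_abs_le)
qed

lemma operator_norm_commutatorI:
  fixes \<gamma> :: "'d::finite \<Rightarrow> complex^'s^'s::finite"
  assumes f: "f \<in> torus_smooth" and le: "\<And>x u. norm (clifford \<gamma> (\<lambda>\<mu>. partial_deriv \<mu> f x) u) \<le> norm u"
  shows "operator_norm smooth_spinors (commutator (Dirac \<gamma>) (mult_op f)) \<le> 1"
proof (rule operator_norm_leI)
  fix \<psi> :: "('d, 's) spinor" assume "\<psi> \<in> smooth_spinors"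
  then have "foldr partial_deriv [] \<psi> differentiable (at x)" for x unfolding smooth_spinors_def smooth_def by blast
  then have diff: "\<psi> differentiable (at x)" for x by simp
  note [continuous_intros] = differentiable_imp_continuous[OF diff]
  have "integrable torus_measure (\<lambda>x. (norm (\<psi> x))\<^sup>2)" by (intro integrable_torus continuous_intros)
  then show "Re (spinor_inner (commutator (Dirac \<gamma>) (mult_op f) \<psi>) (commutator (Dirac \<gamma>) (mult_op f) \<psi>))
      \<le> Re (spinor_inner \<psi> \<psi>)"
    unfolding Re_spinor_inner_self
  proof (rule integral_mono_AE')
    show "AE x in torus_measure. (norm (commutator (Dirac \<gamma>) (mult_op f) \<psi> x))\<^sup>2 \<le> (norm (\<psi> x))\<^sup>2"
      by (intro AE_I2 power_mono) (simp_all add: commutator_mult_op[OF torus_smoothD(2)[OF f] diff] norm_scale le)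
  qed simp
qed

text \<open>Anticommuting with \<open>\<gamma> \<nu>\<close>, which is unitary, isolates the coefficient.\<close>

lemma norm_coefficient_le_clifford:
  fixes \<gamma> :: "'d::finite \<Rightarrow> complex^'s^'s::finite"
  assumes \<gamma>: "gamma_matrices \<gamma>" and le: "\<And>u. norm (clifford \<gamma> c u) \<le> norm u"
  shows "cmod (c \<nu>) \<le> 1"
proof -
  obtain u :: "complex^'s" where u: "norm u = 1" using exists_unit_spinor by blast
  have "2 * c \<nu> * hdot u u = hdot (clifford \<gamma> c u) (\<gamma> \<nu> *v u) + hdot (clifford \<gamma> c (\<gamma> \<nu> *v u)) u"
    unfolding clifford_def by (rule gamma_extract[OF \<gamma>, symmetric])
  also have "cmod \<dots> \<le> norm (clifford \<gamma> c u) * norm (\<gamma> \<nu> *v u) + norm (clifford \<gamma> c (\<gamma> \<nu> *v u)) * norm u"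
    by (intro order_trans[OF norm_triangle_ineq] add_mono hdot_Cauchy_Schwarz)
  also have "\<dots> \<le> 1 + 1"
    using le[of u] le[of "\<gamma> \<nu> *v u"] by (simp add: norm_gamma[OF \<gamma>] u)
  finally show ?thesis by (simp add: hdot_self u norm_mult)
qed

section \<open>Compression and symbol maps\<close>

text \<open>The matrix of \<open>Q f Q\<close>.\<close>

definition compress :: "(int^'d) set \<Rightarrow> (real^'d \<Rightarrow> complex) \<Rightarrow> (int^'d) \<times> (int^'d) \<Rightarrow> complex" where
  "compress \<Delta> f = (\<lambda>(k, l). if k \<in> \<Delta> \<and> l \<in> \<Delta> then fourier f (k - l) else 0)"

text \<open>The expectation of \<open>T\<close> in the normalised sum of the characters in the cube, translated by \<open>x\<close>.\<close>

definition symbol :: "nat \<Rightarrow> ((int^'d) \<times> (int^'d) \<Rightarrow> complex) \<Rightarrow> real^'d \<Rightarrow> complex" where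
  "symbol m T x = (\<Sum>a\<in>cube m. \<Sum>b\<in>cube m. T (a, b) * torus_char (a - b) x) / of_nat (card (cube m :: (int^'d) set))"

lemma compress_toeplitz: "compress \<Delta> f \<in> toeplitz \<Delta>"
  by (auto simp: toeplitz_def compress_def)

lemma fourier_lincomb:
  assumes [continuous_intros]: "continuous_on UNIV f" "continuous_on UNIV g"
  shows "fourier (\<lambda>x. \<alpha> * f x + \<beta> * g x) n = \<alpha> * fourier f n + \<beta> * fourier g n"
proof -
  have "fourier (\<lambda>x. \<alpha> * f x + \<beta> * g x) n
      = (LINT x|torus_measure. \<alpha> * (f x * cnj (torus_char n x)) + \<beta> * (g x * cnj (torus_char n x)))"
    by (simp add: fourier_def ring_distribs mult.assoc)
  also have "\<dots> = (LINT x|torus_measure. \<alpha> * (f x * cnj (torus_char n x))) + (LINT x|torus_measure. \<beta> * (g x * cnj (torus_char n x)))"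
    by (rule Bochner_Integration.integral_add) (intro integrable_torus continuous_intros)+
  finally show ?thesis by (simp add: fourier_def)
qed

lemma compress_lincomb:
  assumes "continuous_on UNIV f" "continuous_on UNIV g"
  shows "compress \<Delta> (\<lambda>x. \<alpha> * f x + \<beta> * g x) = (\<lambda>i. \<alpha> * compress \<Delta> f i + \<beta> * compress \<Delta> g i)"
  by (rule ext) (simp add: compress_def fourier_lincomb[OF assms] split: prod.split)

lemma compress_one: "compress \<Delta> (\<lambda>_. 1) = identity_matrix \<Delta>"
  by (rule ext) (auto simp: compress_def identity_matrix_def fourier_one)

lemma symbol_lincomb: "symbol m (\<lambda>i. \<alpha> * S i + \<beta> * T i) = (\<lambda>x. \<alpha> * symbol m S x + \<beta> * symbol m T x)"
  by (rule ext) (simp add: symbol_def ring_distribs sum.distrib add_divide_distrib mult.assoc flip: sum_distrib_left)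

lemma symbol_identity:
  fixes \<Delta> :: "(int^'d) set"
  assumes "cube m \<subseteq> \<Delta>" "m > 0"
  shows "symbol m (identity_matrix \<Delta>) = (\<lambda>_. 1)"
proof
  fix x
  have "(\<Sum>a\<in>cube m. \<Sum>b\<in>cube m. identity_matrix \<Delta> (a, b) * torus_char (a - b) x)
      = (\<Sum>a\<in>(cube m :: (int^'d) set). \<Sum>b\<in>cube m. if b = a then 1 else 0)"
    using assms(1) by (intro sum.cong refl) (auto simp: identity_matrix_def)
  also have "\<dots> = of_nat (card (cube m :: (int^'d) set))" by simp
  finally show "symbol m (identity_matrix \<Delta>) x = 1"
    using zero_in_cube[OF assms(2), where 'a='d] by (auto simp: symbol_def)
qed

lemma symbol_eq_trig_poly:
  "symbol m T = trig_poly (cube m \<times> cube m) (\<lambda>(a, b). a - b)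
     (\<lambda>(a, b). T (a, b) / of_nat (card (cube m :: (int^'d) set)))"
  for T :: "(int^'d) \<times> (int^'d) \<Rightarrow> complex"
  by (rule ext) (simp add: symbol_def trig_poly_def sum_divide_distrib sum.cartesian_product case_prod_beta)

lemma symbol_torus_smooth: "symbol m T \<in> torus_smooth"
  unfolding symbol_eq_trig_poly by (rule trig_poly_torus_smooth)

lemma symbol_compress:
  assumes "cube m \<subseteq> \<Delta>"
  shows "symbol m (compress \<Delta> f) = fejer_sum m (fourier f)"
proof
  fix x
  show "symbol m (compress \<Delta> f) x = fejer_sum m (fourier f) x"
    unfolding symbol_def fejer_sum_def using assms
    by (intro arg_cong2[of _ _ _ _ "(/)"] sum.cong refl) (auto simp: compress_def)
qed

definition mat_form :: "(int^'d) set \<Rightarrow> ((int^'d) \<times> (int^'d) \<Rightarrow> complex) \<Rightarrow> (int^'d \<Rightarrow> complex^'s::finite) \<Rightarrow>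
    (int^'d \<Rightarrow> complex^'s) \<Rightarrow> complex" where
  "mat_form \<Delta> T v w = (\<Sum>k\<in>\<Delta>. \<Sum>l\<in>\<Delta>. T (k, l) * hdot (v l) (w k))"

lemma mat_form_eq: "mat_form \<Delta> T v w = (\<Sum>k\<in>\<Delta>. hdot (mat_apply \<Delta> T v k) (w k))"
  by (simp add: mat_form_def mat_apply_def hdot_sum_left hdot_scale_left)

lemma sum_hdot_bound: "cmod (\<Sum>k\<in>\<Delta>. hdot (v k) (w k)) \<le> (sqnorm \<Delta> v + sqnorm \<Delta> w) / 2"
proof -
  have "cmod (\<Sum>k\<in>\<Delta>. hdot (v k) (w k)) \<le> (\<Sum>k\<in>\<Delta>. ((norm (v k))\<^sup>2 + (norm (w k))\<^sup>2) / 2)"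
    by (rule sum_norm_le) (rule hdot_amgm)
  then show ?thesis by (simp add: sqnorm_def sum.distrib flip: sum_divide_distrib)
qed

lemma sqnorm_hdot: "complex_of_real (sqnorm \<Delta> w) = (\<Sum>k\<in>\<Delta>. hdot (w k) (w k))"
  by (simp only: sqnorm_def of_real_sum hdot_self)

lemma integral_trig_bound:
  assumes fin: "finite \<Delta>" and h: "continuous_on UNIV h"
    and le: "\<And>x. cmod (h x) \<le> norm (trig \<Delta> v x) * norm (trig \<Delta> w x)"
  shows "cmod (LINT x|torus_measure. h x) \<le> (sqnorm \<Delta> v + sqnorm \<Delta> w) / 2"
proof -
  have "cmod (LINT x|torus_measure. h x)
      \<le> (LINT x|torus_measure. ((norm (trig \<Delta> v x))\<^sup>2 + (norm (trig \<Delta> w x))\<^sup>2) / 2)"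
  proof (rule Bochner_Integration.integral_norm_bound_integral)
    fix x
    show "cmod (h x) \<le> ((norm (trig \<Delta> v x))\<^sup>2 + (norm (trig \<Delta> w x))\<^sup>2) / 2"
      using le[of x] sum_squares_bound[of "norm (trig \<Delta> v x)" "norm (trig \<Delta> w x)"] by simp
  qed (auto intro!: integrable_torus continuous_intros h)
  also have "\<dots> = ((LINT x|torus_measure. (norm (trig \<Delta> v x))\<^sup>2) + (LINT x|torus_measure. (norm (trig \<Delta> w x))\<^sup>2)) / 2"
    by (subst integral_divide_zero, subst Bochner_Integration.integral_add)
      (auto intro!: integrable_torus continuous_intros)
  finally show ?thesis by (simp add: norm_trig[OF fin] sqnorm_def)
qed

text \<open>For \<open>w = Q f Q v\<close> the square norm of \<open>w\<close> is the integral of \<open>f \<langle>v, w\<rangle>\<close>, hence at most the mean of the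
  square norms of \<open>v\<close> and \<open>w\<close>.\<close>

lemma sqnorm_compress_le:
  assumes fin: "finite \<Delta>" and f [continuous_intros]: "continuous_on UNIV f" and le: "\<And>x. cmod (f x) \<le> 1"
  shows "sqnorm \<Delta> (mat_apply \<Delta> (compress \<Delta> f) v) \<le> sqnorm \<Delta> v"
proof -
  define w where "w = mat_apply \<Delta> (compress \<Delta> f) v"
  have "complex_of_real (sqnorm \<Delta> w) = mat_form \<Delta> (compress \<Delta> f) v w"
    unfolding sqnorm_hdot mat_form_eq w_def ..
  also have "\<dots> = (\<Sum>k\<in>\<Delta>. \<Sum>l\<in>\<Delta>. fourier f (k - l) * hdot (v l) (w k))"
    unfolding mat_form_def by (intro sum.cong refl) (simp add: compress_def)
  also have "\<dots> = (LINT x|torus_measure. f x * hdot (trig \<Delta> v x) (trig \<Delta> w x))"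
    by (rule spinor_inner_mult_trig[OF f, symmetric])
  finally have "sqnorm \<Delta> w = cmod (LINT x|torus_measure. f x * hdot (trig \<Delta> v x) (trig \<Delta> w x))"
    by (metis norm_of_real abs_of_nonneg sqnorm_nonneg)
  also have "\<dots> \<le> (sqnorm \<Delta> v + sqnorm \<Delta> w) / 2"
  proof (rule integral_trig_bound[OF fin])
    fix x
    have "cmod (f x) * cmod (hdot (trig \<Delta> v x) (trig \<Delta> w x)) \<le> 1 * (norm (trig \<Delta> v x) * norm (trig \<Delta> w x))"
      by (intro mult_mono le hdot_Cauchy_Schwarz) auto
    then show "cmod (f x * hdot (trig \<Delta> v x) (trig \<Delta> w x)) \<le> norm (trig \<Delta> v x) * norm (trig \<Delta> w x)"
      by (simp add: norm_mult)
  qed (intro continuous_intros)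
  finally show ?thesis by (simp add: w_def)
qed

text \<open>The factors \<open>k - l\<close> turn the Fourier coefficients of \<open>f\<close> into those of its derivatives, so the matrix is
  the compression of \<open>[D, f]\<close> and the argument for \<open>f\<close> applies to it.\<close>

lemma sqnorm_compress_commutator_le:
  fixes \<gamma> :: "'d::finite \<Rightarrow> complex^'s^'s::finite"
  assumes fin: "finite \<Delta>" and f: "f \<in> torus_smooth"
    and le: "\<And>x u. norm (clifford \<gamma> (\<lambda>\<mu>. partial_deriv \<mu> f x) u) \<le> norm u"
  shows "sqnorm \<Delta> (mat_commutator \<gamma> \<Delta> (compress \<Delta> f) v) \<le> sqnorm \<Delta> v"
proof -
  note [continuous_intros] = torus_smoothD(5)[OF f]
  define w where "w = mat_commutator \<gamma> \<Delta> (compress \<Delta> f) v"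
  let ?g = "\<lambda>\<mu> x. partial_deriv \<mu> f x * hdot (trig \<Delta> (\<lambda>l. \<gamma> \<mu> *v v l) x) (trig \<Delta> w x)"
  have four: "of_int (n $ \<mu>) * fourier f n = - \<i> * fourier (partial_deriv \<mu> f) n" for \<mu> n
    by (subst fourier_partial_deriv) (simp_all add: torus_smoothD[OF f] mult.assoc)
  have "complex_of_real (sqnorm \<Delta> w) = (\<Sum>k\<in>\<Delta>. \<Sum>l\<in>\<Delta>. \<Sum>\<mu>\<in>UNIV.
      (of_int ((k - l) $ \<mu>) * fourier f (k - l)) * hdot (\<gamma> \<mu> *v v l) (w k))"
    unfolding sqnorm_hdot
  proof (intro sum.cong refl)
    fix k assume k: "k \<in> \<Delta>"
    have "hdot (w k) (w k) = (\<Sum>l\<in>\<Delta>. compress \<Delta> f (k, l) * (\<Sum>\<mu>\<in>UNIV. of_int (k $ \<mu> - l $ \<mu>) * hdot (\<gamma> \<mu> *v v l) (w k)))"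
      by (subst w_def) (simp only: mat_commutator_def clifford_def hdot_sum_left hdot_scale_left)
    also have "\<dots> = (\<Sum>l\<in>\<Delta>. \<Sum>\<mu>\<in>UNIV. (of_int ((k - l) $ \<mu>) * fourier f (k - l)) * hdot (\<gamma> \<mu> *v v l) (w k))"
      using k by (intro sum.cong refl) (simp add: compress_def sum_distrib_left mult_ac)
    finally show "hdot (w k) (w k) = (\<Sum>l\<in>\<Delta>. \<Sum>\<mu>\<in>UNIV. (of_int ((k - l) $ \<mu>) * fourier f (k - l)) * hdot (\<gamma> \<mu> *v v l) (w k))" .
  qed
  also have "\<dots> = (\<Sum>k\<in>\<Delta>. \<Sum>\<mu>\<in>UNIV. \<Sum>l\<in>\<Delta>. - \<i> * (fourier (partial_deriv \<mu> f) (k - l) * hdot (\<gamma> \<mu> *v v l) (w k)))"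
    unfolding four by (subst (2) sum.swap) (simp add: mult.assoc)
  also have "\<dots> = (\<Sum>\<mu>\<in>UNIV. - \<i> * (\<Sum>k\<in>\<Delta>. \<Sum>l\<in>\<Delta>. fourier (partial_deriv \<mu> f) (k - l) * hdot (\<gamma> \<mu> *v v l) (w k)))"
    by (subst sum.swap) (simp add: sum_distrib_left)
  also have "\<dots> = (\<Sum>\<mu>\<in>UNIV. - \<i> * (LINT x|torus_measure. ?g \<mu> x))"
    by (simp only: spinor_inner_mult_trig[OF torus_smoothD(5)[OF f]])
  also have "\<dots> = (LINT x|torus_measure. (\<Sum>\<mu>\<in>UNIV. - \<i> * ?g \<mu> x))"
    by (subst Bochner_Integration.integral_sum) (auto intro!: integrable_torus continuous_intros simp del: mult_minus_left)
  also have "\<dots> = (LINT x|torus_measure. - \<i> * hdot (clifford \<gamma> (\<lambda>\<mu>. partial_deriv \<mu> f x) (trig \<Delta> v x)) (trig \<Delta> w x))"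
  proof -
    have "trig \<Delta> (\<lambda>l. \<gamma> \<mu> *v v l) x = \<gamma> \<mu> *v trig \<Delta> v x" for \<mu> x
      by (simp add: trig_def matrix_sum matrix_scale)
    then show ?thesis
      by (simp add: clifford_def hdot_sum_left hdot_scale_left sum_distrib_left)
  qed
  finally have eq: "complex_of_real (sqnorm \<Delta> w) = (LINT x|torus_measure. - \<i> * hdot (clifford \<gamma> (\<lambda>\<mu>. partial_deriv \<mu> f x) (trig \<Delta> v x)) (trig \<Delta> w x))" .
  have "sqnorm \<Delta> w = cmod (LINT x|torus_measure. - \<i> * hdot (clifford \<gamma> (\<lambda>\<mu>. partial_deriv \<mu> f x) (trig \<Delta> v x)) (trig \<Delta> w x))"
    unfolding eq[symmetric] by simp
  also have "\<dots> \<le> (sqnorm \<Delta> v + sqnorm \<Delta> w) / 2"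
  proof (rule integral_trig_bound[OF fin])
    fix x
    have "cmod (hdot (clifford \<gamma> (\<lambda>\<mu>. partial_deriv \<mu> f x) (trig \<Delta> v x)) (trig \<Delta> w x))
        \<le> norm (clifford \<gamma> (\<lambda>\<mu>. partial_deriv \<mu> f x) (trig \<Delta> v x)) * norm (trig \<Delta> w x)" by (rule hdot_Cauchy_Schwarz)
    also have "\<dots> \<le> norm (trig \<Delta> v x) * norm (trig \<Delta> w x)" by (intro mult_right_mono le) simp
    finally show "cmod (- \<i> * hdot (clifford \<gamma> (\<lambda>\<mu>. partial_deriv \<mu> f x) (trig \<Delta> v x)) (trig \<Delta> w x))
        \<le> norm (trig \<Delta> v x) * norm (trig \<Delta> w x)" by (simp add: norm_mult)
  next
    show "continuous_on UNIV (\<lambda>x. - \<i> * hdot (clifford \<gamma> (\<lambda>\<mu>. partial_deriv \<mu> f x) (trig \<Delta> v x)) (trig \<Delta> w x))"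
      unfolding clifford_def
      by (intro continuous_intros bounded_linear.continuous_on[OF bounded_linear_matrix])
  qed
  finally show ?thesis by (simp add: w_def)
qed

lemma double_sum_divide:
  "(\<Sum>a\<in>A. \<Sum>b\<in>B. X a b) / c = (\<Sum>p\<in>A \<times> B. X (fst p) (snd p) / c)" for c :: "'c::field"
  by (simp add: sum.cartesian_product case_prod_beta sum_divide_distrib)

text \<open>The coefficients of the unit vector at which the symbol at \<open>x\<close> is an expectation, tensored with \<open>u\<close>.\<close>

definition peak :: "nat \<Rightarrow> real^'d \<Rightarrow> complex^'s \<Rightarrow> int^'d \<Rightarrow> complex^'s" where
  "peak m x u l = (if l \<in> cube m then (cnj (torus_char l x) / complex_of_real (sqrt (card (cube m :: (int^'d) set)))) *s u else 0)"

context
  fixes m :: nat and \<Delta> :: "(int^'d::finite) set"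
  assumes m: "m > 0" and fin: "finite \<Delta>" and sub: "cube m \<subseteq> \<Delta>"
begin

lemma sqnorm_peak: "sqnorm \<Delta> (peak m x u) = (norm u)\<^sup>2"
proof -
  have "sqnorm \<Delta> (peak m x u) = (\<Sum>l\<in>cube m. (norm (peak m x u l))\<^sup>2)"
    unfolding sqnorm_def by (rule sum.mono_neutral_right[OF fin sub]) (simp add: peak_def)
  also have "\<dots> = (\<Sum>l\<in>(cube m :: (int^'d) set). (norm u)\<^sup>2 / card (cube m :: (int^'d) set))"
    by (intro sum.cong refl) (simp add: peak_def norm_scale norm_divide power_mult_distrib power_divide)
  finally show ?thesis using zero_in_cube[OF m, where 'a='d] by auto
qed

lemma peak_form:
  assumes F: "\<And>k l c u. F k l (c *s u) = c *s F k l u"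
  shows "(\<Sum>k\<in>\<Delta>. \<Sum>l\<in>\<Delta>. T (k, l) * hdot (F k l (peak m x u l)) (peak m x u' k))
     = (\<Sum>a\<in>cube m. \<Sum>b\<in>cube m. T (a, b) * torus_char (a - b) x * hdot (F a b u) u') / of_nat (card (cube m :: (int^'d) set))"
proof -
  let ?C = "cube m :: (int^'d) set"
  let ?r = "complex_of_real (sqrt (card ?C))"
  have "?r * ?r = complex_of_real (sqrt (card ?C) * sqrt (card ?C))" by (simp only: of_real_mult)
  then have r: "?r * ?r = of_nat (card ?C)" by simp
  have F0: "F k l 0 = 0" for k l using F[of k l 0 0] by simp
  have "(\<Sum>k\<in>\<Delta>. \<Sum>l\<in>\<Delta>. T (k, l) * hdot (F k l (peak m x u l)) (peak m x u' k))
      = (\<Sum>k\<in>?C. \<Sum>l\<in>\<Delta>. T (k, l) * hdot (F k l (peak m x u l)) (peak m x u' k))"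
    by (rule sum.mono_neutral_right[OF fin sub]) (simp add: peak_def)
  also have "\<dots> = (\<Sum>k\<in>?C. \<Sum>l\<in>?C. T (k, l) * hdot (F k l (peak m x u l)) (peak m x u' k))"
    by (rule sum.cong[OF refl], rule sum.mono_neutral_right[OF fin sub]) (simp add: peak_def F0)
  also have "\<dots> = (\<Sum>a\<in>?C. \<Sum>b\<in>?C. T (a, b) * torus_char (a - b) x * hdot (F a b u) u' / of_nat (card ?C))"
    by (intro sum.cong refl)
      (simp add: peak_def F hdot_scale_left hdot_scale_right torus_char_diff flip: r)
  finally show ?thesis by (simp add: sum_divide_distrib)
qed

lemma symbol_form: "mat_form \<Delta> T (peak m x u) (peak m x u') = symbol m T x * hdot u u'"
  using peak_form[of "\<lambda>_ _ u. u" T x u u']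
  by (simp add: mat_form_def symbol_def sum_distrib_right)

text \<open>Differentiating the symbol multiplies the coefficient at \<open>a - b\<close> by \<open>\<i> (a - b)\<close>: the commutator with the
  symbol is the symbol of the commutator.\<close>

lemma symbol_commutator_form:
  "(\<Sum>k\<in>\<Delta>. hdot (mat_commutator \<gamma> \<Delta> T (peak m x u) k) (peak m x u' k))
     = hdot ((- \<i>) *s clifford \<gamma> (\<lambda>\<mu>. partial_deriv \<mu> (symbol m T) x) u) u'"
proof -
  let ?C = "cube m :: (int^'d) set"
  have "(\<Sum>k\<in>\<Delta>. hdot (mat_commutator \<gamma> \<Delta> T (peak m x u) k) (peak m x u' k))
     = (\<Sum>a\<in>?C. \<Sum>b\<in>?C. T (a, b) * torus_char (a - b) x * hdot (clifford \<gamma> (\<lambda>\<mu>. of_int (a $ \<mu> - b $ \<mu>)) u) u') / of_nat (card ?C)"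
    using peak_form[of "\<lambda>k l. clifford \<gamma> (\<lambda>\<mu>. of_int (k $ \<mu> - l $ \<mu>))" T x u u', OF clifford_scale]
    by (simp only: mat_commutator_def hdot_sum_left hdot_scale_left)
  also have "\<dots> = (\<Sum>p\<in>?C\<times>?C. T (fst p, snd p) * torus_char (fst p - snd p) x *
      hdot (clifford \<gamma> (\<lambda>\<mu>. of_int (fst p $ \<mu> - snd p $ \<mu>)) u) u' / of_nat (card ?C))"
    by (rule double_sum_divide)
  also have "\<dots> = (\<Sum>p\<in>?C\<times>?C. \<Sum>\<mu>\<in>UNIV. of_int ((fst p - snd p) $ \<mu>) * (T p / of_nat (card ?C)) * torus_char (fst p - snd p) x * hdot (\<gamma> \<mu> *v u) u')"
    by (intro sum.cong refl) (simp add: clifford_def hdot_sum_left hdot_scale_left sum_distrib_left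
        sum_divide_distrib mult_ac del: of_int_diff)
  also have "\<dots> = (\<Sum>\<mu>\<in>UNIV. (- \<i> * partial_deriv \<mu> (symbol m T) x) * hdot (\<gamma> \<mu> *v u) u')"
    unfolding symbol_eq_trig_poly partial_deriv_trig_poly trig_poly_def
    by (subst sum.swap, intro sum.cong refl)
      (simp add: case_prod_beta sum_distrib_right sum_distrib_left mult.assoc sum_negf)
  finally show ?thesis
    by (simp only: clifford_def hdot_sum_left hdot_scale_left sum_distrib_left mult.assoc)
qed

lemma symbol_le:
  assumes "\<And>v :: int^'d \<Rightarrow> complex^'s::finite. sqnorm \<Delta> (mat_apply \<Delta> T v) \<le> sqnorm \<Delta> v"
  shows "cmod (symbol m T x) \<le> 1"
proof -
  obtain u :: "complex^'s" where u: "norm u = 1" using exists_unit_spinor by blast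
  have "symbol m T x = mat_form \<Delta> T (peak m x u) (peak m x u)"
    by (simp add: symbol_form hdot_self u)
  also have "cmod \<dots> \<le> (sqnorm \<Delta> (mat_apply \<Delta> T (peak m x u)) + sqnorm \<Delta> (peak m x u)) / 2"
    unfolding mat_form_eq by (rule sum_hdot_bound)
  also have "\<dots> \<le> 1" using assms[of "peak m x u"] by (simp add: sqnorm_peak u)
  finally show ?thesis .
qed

lemma symbol_commutator_le:
  fixes \<gamma> :: "'d \<Rightarrow> complex^'s^'s::finite"
  assumes "\<And>v. sqnorm \<Delta> (mat_commutator \<gamma> \<Delta> T v) \<le> sqnorm \<Delta> v"
  shows "norm (clifford \<gamma> (\<lambda>\<mu>. partial_deriv \<mu> (symbol m T) x) u) \<le> norm u"
proof -
  define u' where "u' = (- \<i>) *s clifford \<gamma> (\<lambda>\<mu>. partial_deriv \<mu> (symbol m T) x) u"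
  have "complex_of_real ((norm u')\<^sup>2) = (\<Sum>k\<in>\<Delta>. hdot (mat_commutator \<gamma> \<Delta> T (peak m x u) k) (peak m x u' k))"
    unfolding symbol_commutator_form hdot_self[symmetric] u'_def ..
  then have "(norm u')\<^sup>2 = cmod (\<Sum>k\<in>\<Delta>. hdot (mat_commutator \<gamma> \<Delta> T (peak m x u) k) (peak m x u' k))"
    by (metis norm_of_real abs_of_nonneg zero_le_power2)
  also have "\<dots> \<le> (sqnorm \<Delta> (mat_commutator \<gamma> \<Delta> T (peak m x u)) + sqnorm \<Delta> (peak m x u')) / 2"
    by (rule sum_hdot_bound)
  also have "\<dots> \<le> ((norm u)\<^sup>2 + (norm u')\<^sup>2) / 2"
    using assms[of "peak m x u"] by (simp add: sqnorm_peak)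
  finally have "(norm u')\<^sup>2 \<le> (norm u)\<^sup>2" by simp
  then have "norm u' \<le> norm u" by (rule power2_le_imp_le) simp
  then show ?thesis by (simp add: u'_def norm_scale)
qed

text \<open>Conjugating \<open>T\<close> by \<open>diag(e\<^sub>k(y))\<close> makes its quadratic form at \<open>v\<close> a function \<open>p\<close> on the torus.  Its partial
  derivatives are quadratic forms of \<open>[D, T]\<close>, up to one anticommutation, at vectors of the same norm.  As \<open>T\<close> is
  a Toeplitz matrix, replacing \<open>T\<close> by the compression of its symbol replaces \<open>p 0\<close> by a Fejer mean of \<open>p\<close>.\<close>

lemma compress_symbol_approx:
  fixes \<gamma> :: "'d \<Rightarrow> complex^'s^'s::finite" and v :: "int^'d \<Rightarrow> complex^'s"
  assumes \<gamma>: "gamma_matrices \<gamma>" and T: "T \<in> toeplitz \<Delta>"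
    and le: "\<And>v. sqnorm \<Delta> (mat_commutator \<gamma> \<Delta> T v) \<le> sqnorm \<Delta> v"
  shows "cmod (mat_form \<Delta> (\<lambda>i. compress \<Delta> (symbol m T) i - T i) v v)
    \<le> (3 * real CARD('d) / sqrt (real m)) * sqnorm \<Delta> v"
proof -
  let ?C = "cube m :: (int^'d) set"
  let ?c = "\<lambda>(k, l). T (k, l) * hdot (v l) (v k)"
  (* p y is the quadratic form at v of T conjugated by the characters at y *)
  define p where "p = trig_poly (\<Delta> \<times> \<Delta>) (\<lambda>(k, l). k - l) ?c"
  have deriv: "cmod (partial_deriv \<nu> p y) \<le> sqnorm \<Delta> v" for \<nu> y
  proof -
    define w where "w l = cnj (torus_char l y) *s v l" for l
    have gen: "(A + s) / 2 + (B + s) / 2 \<le> 2 * s" if "A \<le> s" "B \<le> s" for A B s :: real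
      using that by (simp add: field_simps)
    have sq: "sqnorm \<Delta> w = sqnorm \<Delta> v" "sqnorm \<Delta> (\<lambda>l. \<gamma> \<nu> *v w l) = sqnorm \<Delta> v"
      by (simp_all add: sqnorm_def w_def norm_scale norm_gamma[OF \<gamma>])
    have "2 * (- \<i> * partial_deriv \<nu> p y) = (\<Sum>k\<in>\<Delta>. \<Sum>l\<in>\<Delta>. T (k, l) * (2 * of_int (k $ \<nu> - l $ \<nu>) * hdot (w l) (w k)))"
      by (simp add: p_def partial_deriv_trig_poly trig_poly_def sum.cartesian_product case_prod_beta
          w_def hdot_scale_left hdot_scale_right torus_char_diff sum_distrib_left mult_ac del: of_int_diff)
    also have "\<dots> = (\<Sum>k\<in>\<Delta>. \<Sum>l\<in>\<Delta>. T (k, l) * (hdot (clifford \<gamma> (\<lambda>\<mu>. of_int (k $ \<mu> - l $ \<mu>)) (w l)) (\<gamma> \<nu> *v w k)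
        + hdot (clifford \<gamma> (\<lambda>\<mu>. of_int (k $ \<mu> - l $ \<mu>)) (\<gamma> \<nu> *v w l)) (w k)))"
      unfolding clifford_def gamma_extract[OF \<gamma>] ..
    also have "\<dots> = (\<Sum>k\<in>\<Delta>. hdot (mat_commutator \<gamma> \<Delta> T w k) (\<gamma> \<nu> *v w k))
        + (\<Sum>k\<in>\<Delta>. hdot (mat_commutator \<gamma> \<Delta> T (\<lambda>l. \<gamma> \<nu> *v w l) k) (w k))"
      by (simp add: mat_commutator_def hdot_sum_left hdot_scale_left ring_distribs sum.distrib)
    also have "cmod \<dots> \<le> (sqnorm \<Delta> (mat_commutator \<gamma> \<Delta> T w) + sqnorm \<Delta> (\<lambda>l. \<gamma> \<nu> *v w l)) / 2
        + (sqnorm \<Delta> (mat_commutator \<gamma> \<Delta> T (\<lambda>l. \<gamma> \<nu> *v w l)) + sqnorm \<Delta> w) / 2"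
      by (intro order_trans[OF norm_triangle_ineq] add_mono sum_hdot_bound)
    also have "\<dots> \<le> 2 * sqnorm \<Delta> v"
      unfolding sq by (rule gen[OF le[of w, unfolded sq] le[of "\<lambda>l. \<gamma> \<nu> *v w l", unfolded sq]])
    finally show ?thesis by (simp add: norm_mult)
  qed
  have p0: "p 0 = mat_form \<Delta> T v v"
    by (simp add: p_def trig_poly_def mat_form_def sum.cartesian_product case_prod_beta)
  have toep: "T (k, l) = T (a, b)" if "k \<in> \<Delta>" "l \<in> \<Delta>" "a \<in> \<Delta>" "b \<in> \<Delta>" "k - l = a - b" for k l a b
    using T that by (auto simp: toeplitz_def)
  have "fejer_sum m (fourier p) 0 = (\<Sum>a\<in>?C. \<Sum>b\<in>?C. \<Sum>q\<in>\<Delta>\<times>\<Delta>. if fst q - snd q = a - b then ?c q else 0) / of_nat (card ?C)"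
    using fin by (simp add: fejer_sum_def p_def fourier_trig_poly case_prod_beta)
  also have "\<dots> = (\<Sum>r\<in>?C\<times>?C. \<Sum>q\<in>\<Delta>\<times>\<Delta>. if fst q - snd q = fst r - snd r then ?c q / of_nat (card ?C) else 0)"
    unfolding double_sum_divide
    by (intro sum.cong refl) (simp add: sum_divide_distrib if_distrib[of "\<lambda>x. x / _"] cong: if_cong)
  also have "\<dots> = (\<Sum>q\<in>\<Delta>\<times>\<Delta>. \<Sum>r\<in>?C\<times>?C. if fst q - snd q = fst r - snd r then ?c q / of_nat (card ?C) else 0)"
    by (rule sum.swap)
  also have "\<dots> = (\<Sum>q\<in>\<Delta>\<times>\<Delta>. \<Sum>r\<in>?C\<times>?C. if fst r - snd r = fst q - snd q
      then T r / of_nat (card ?C) * hdot (v (snd q)) (v (fst q)) else 0)"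
  proof (intro sum.cong refl)
    fix q r assume q: "q \<in> \<Delta> \<times> \<Delta>" and "r \<in> ?C \<times> ?C"
    then have "r \<in> \<Delta> \<times> \<Delta>" using sub by auto
    with q show "(if fst q - snd q = fst r - snd r then ?c q / of_nat (card ?C) else 0)
        = (if fst r - snd r = fst q - snd q then T r / of_nat (card ?C) * hdot (v (snd q)) (v (fst q)) else 0)"
      using toep[of "fst q" "snd q" "fst r" "snd r"] by (auto simp: case_prod_beta)
  qed
  also have "\<dots> = (\<Sum>q\<in>\<Delta>\<times>\<Delta>. compress \<Delta> (symbol m T) q * hdot (v (snd q)) (v (fst q)))"
  proof (rule sum.cong[OF refl])
    fix q assume "q \<in> \<Delta> \<times> \<Delta>"
    then have "compress \<Delta> (symbol m T) q = fourier (symbol m T) (fst q - snd q)"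
      by (auto simp: compress_def)
    also have "\<dots> = (\<Sum>r\<in>?C\<times>?C. if fst r - snd r = fst q - snd q then T r / of_nat (card ?C) else 0)"
      unfolding symbol_eq_trig_poly by (subst fourier_trig_poly) (simp_all add: case_prod_beta cong: if_cong)
    finally show "(\<Sum>r\<in>?C\<times>?C. if fst r - snd r = fst q - snd q
        then T r / of_nat (card ?C) * hdot (v (snd q)) (v (fst q)) else 0)
      = compress \<Delta> (symbol m T) q * hdot (v (snd q)) (v (fst q))"
      by (simp add: sum_distrib_right if_distrib[of "\<lambda>x. x * _"] cong: if_cong)
  qed
  also have "\<dots> = mat_form \<Delta> (compress \<Delta> (symbol m T)) v v"
    by (simp add: mat_form_def sum.cartesian_product case_prod_beta)
  finally have "fejer_sum m (fourier p) 0 - p 0 = mat_form \<Delta> (\<lambda>i. compress \<Delta> (symbol m T) i - T i) v v"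
    unfolding p0 by (simp add: mat_form_def left_diff_distrib sum_subtractf)
  moreover have "cmod (fejer_sum m (fourier p) 0 - p 0) \<le> sqnorm \<Delta> v * (3 * real CARD('d) / sqrt (real m))"
    by (rule fejer_sum_lipschitz[OF m _ _ deriv])
      (simp_all add: p_def periodic_trig_poly differentiableI[OF has_derivative_trig_poly])
  ultimately show ?thesis by (simp add: mult.commute)
qed

end

section \<open>Completely positive maps on Toeplitz matrices\<close>

definition adjoint_matrix :: "((int^'d) \<times> (int^'d) \<Rightarrow> complex) \<Rightarrow> (int^'d) \<times> (int^'d) \<Rightarrow> complex" where
  "adjoint_matrix T = (\<lambda>(k, l). cnj (T (l, k)))"

lemma lin_closed_toeplitz: "lin_closed (toeplitz \<Delta>)"
  unfolding lin_closed_def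
proof (intro ballI allI)
  fix S T :: "(int^'a) \<times> (int^'a) \<Rightarrow> complex" and \<alpha> \<beta> assume "S \<in> toeplitz \<Delta>" "T \<in> toeplitz \<Delta>"
  then obtain s t where "\<forall>k l. S (k, l) = (if k \<in> \<Delta> \<and> l \<in> \<Delta> then s (k - l) else 0)"
      "\<forall>k l. T (k, l) = (if k \<in> \<Delta> \<and> l \<in> \<Delta> then t (k - l) else 0)" by (auto simp: toeplitz_def)
  then show "(\<lambda>i. \<alpha> * S i + \<beta> * T i) \<in> toeplitz \<Delta>"
    by (auto simp: toeplitz_def intro!: exI[of _ "\<lambda>n. \<alpha> * s n + \<beta> * t n"])
qed

lemma identity_toeplitz: "identity_matrix \<Delta> \<in> toeplitz \<Delta>"
  by (auto simp: toeplitz_def identity_matrix_def intro!: exI[of _ "\<lambda>n. if n = 0 then 1 else 0"])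

lemma adjoint_toeplitz:
  assumes "T \<in> toeplitz \<Delta>"
  shows "adjoint_matrix T \<in> toeplitz \<Delta>"
proof -
  obtain t where "\<forall>k l. T (k, l) = (if k \<in> \<Delta> \<and> l \<in> \<Delta> then t (k - l) else 0)"
    using assms by (auto simp: toeplitz_def)
  then show ?thesis
    by (auto simp: toeplitz_def adjoint_matrix_def intro!: exI[of _ "\<lambda>n. cnj (t (- n))"])
qed

lemma mat_form_lincomb:
  "mat_form \<Delta> (\<lambda>i. \<alpha> * S i + \<beta> * T i) v w = \<alpha> * mat_form \<Delta> S v w + \<beta> * mat_form \<Delta> T v w"
  by (simp add: mat_form_def ring_distribs sum.distrib sum_distrib_left mult.assoc)

lemma mat_form_identity:
  assumes "finite \<Delta>"
  shows "mat_form \<Delta> (identity_matrix \<Delta>) v v = complex_of_real (sqnorm \<Delta> v)"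
proof -
  have "mat_form \<Delta> (identity_matrix \<Delta>) v v = (\<Sum>k\<in>\<Delta>. \<Sum>l\<in>\<Delta>. if l = k then hdot (v k) (v k) else 0)"
    unfolding mat_form_def by (intro sum.cong refl) (auto simp: identity_matrix_def)
  then show ?thesis using assms by (simp add: sqnorm_hdot)
qed

lemma cnj_hdot: "cnj (hdot v w) = hdot w v"
  by (metis hdot_commute)

lemma mat_form_adjoint: "mat_form \<Delta> (adjoint_matrix T) v v = cnj (mat_form \<Delta> T v v)"
proof -
  have "cnj (mat_form \<Delta> T v v) = (\<Sum>k\<in>\<Delta>. \<Sum>l\<in>\<Delta>. cnj (T (k, l)) * hdot (v k) (v l))"
    unfolding mat_form_def cnj_sum complex_cnj_mult by (intro sum.cong refl) (simp only: cnj_hdot)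
  also have "\<dots> = (\<Sum>l\<in>\<Delta>. \<Sum>k\<in>\<Delta>. cnj (T (k, l)) * hdot (v k) (v l))" by (rule sum.swap)
  finally show ?thesis by (simp add: mat_form_def adjoint_matrix_def)
qed

lemma spinor_inner_matrix_op:
  assumes "finite \<Delta>"
  shows "spinor_inner (matrix_op \<Delta> T (trig \<Delta> v)) (trig \<Delta> w) = mat_form \<Delta> T v w"
  unfolding matrix_op_trig[OF assms] spinor_inner_trig[OF assms] mat_form_eq mat_apply_def ..

lemma UCP_toeplitz_bound:
  assumes fin: "finite \<Delta>" and \<phi>: "\<phi> \<in> UCP_toeplitz TYPE('s::finite) \<Delta>" and T: "T \<in> toeplitz \<Delta>"
    and le: "\<And>v :: int^'d \<Rightarrow> complex^'s. cmod (mat_form \<Delta> T v v) \<le> M * sqnorm \<Delta> v"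
  shows "cmod (qform (\<phi> T) x) \<le> M * (norm x)\<^sup>2"
proof (rule ucp_maps_numerical_radius[OF \<phi>[unfolded UCP_toeplitz_def] lin_closed_toeplitz identity_toeplitz T adjoint_toeplitz[OF T],
      where n = "\<lambda>\<xi>. Re (spinor_inner \<xi> \<xi>)" and z = "\<lambda>\<xi>. spinor_inner (matrix_op \<Delta> T \<xi>) \<xi>"])
  fix \<xi> :: "('d, 's) spinor" assume "\<xi> \<in> trig_spinors \<Delta>"
  then obtain v where v: "\<xi> = trig \<Delta> v" by (auto simp: trig_spinors_eq)
  show "spinor_inner (matrix_op \<Delta> (\<lambda>i. \<alpha> * identity_matrix \<Delta> i + 1 * (\<beta> * T i + \<gamma> * adjoint_matrix T i)) \<xi>) \<xi>
      = \<alpha> * complex_of_real (Re (spinor_inner \<xi> \<xi>)) + \<beta> * spinor_inner (matrix_op \<Delta> T \<xi>) \<xi>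
        + \<gamma> * cnj (spinor_inner (matrix_op \<Delta> T \<xi>) \<xi>)" for \<alpha> \<beta> \<gamma>
    unfolding v spinor_inner_matrix_op[OF fin] mat_form_lincomb mat_form_adjoint mat_form_identity[OF fin]
      Re_spinor_inner_trig[OF fin] by simp
  show "cmod (spinor_inner (matrix_op \<Delta> T \<xi>) \<xi>) \<le> M * Re (spinor_inner \<xi> \<xi>)"
    unfolding v spinor_inner_matrix_op[OF fin] Re_spinor_inner_trig[OF fin] by (rule le)
qed

lemma UCP_toeplitz_contractive:
  assumes fin: "finite \<Delta>" and \<phi>: "\<phi> \<in> UCP_toeplitz TYPE('s::finite) \<Delta>" and T: "T \<in> toeplitz \<Delta>"
    and le: "operator_norm (trig_spinors \<Delta> :: ('d::finite, 's) spinor set) (matrix_op \<Delta> T) \<le> 1"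
  shows "cmod (qform (\<phi> T) x) \<le> (norm x)\<^sup>2"
proof -
  have "cmod (qform (\<phi> T) x) \<le> 1 * (norm x)\<^sup>2"
  proof (rule UCP_toeplitz_bound[OF fin \<phi> T])
    fix v :: "int^'d \<Rightarrow> complex^'s"
    have "cmod (mat_form \<Delta> T v v) \<le> (sqnorm \<Delta> (mat_apply \<Delta> T v) + sqnorm \<Delta> v) / 2"
      unfolding mat_form_eq by (rule sum_hdot_bound)
    also have "sqnorm \<Delta> (mat_apply \<Delta> T v) \<le> sqnorm \<Delta> v"
      using le unfolding operator_norm_matrix_iff[OF fin] by blast
    finally show "cmod (mat_form \<Delta> T v v) \<le> 1 * sqnorm \<Delta> v" by simp
  qed
  then show ?thesis by simp
qed

text \<open>A crude bound, which suffices to see that every matrix has finite norm.\<close>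

lemma sqnorm_le_of_kernel:
  assumes fin: "finite \<Delta>" and B: "\<And>k l. 0 \<le> B k l"
    and le: "\<And>k. k \<in> \<Delta> \<Longrightarrow> norm (w k) \<le> (\<Sum>l\<in>\<Delta>. B k l * norm (v l))"
  shows "sqnorm \<Delta> w \<le> (\<Sum>k\<in>\<Delta>. (\<Sum>l\<in>\<Delta>. B k l)\<^sup>2) * sqnorm \<Delta> v"
proof -
  let ?r = "sqrt (sqnorm \<Delta> v)"
  have r: "?r\<^sup>2 = sqnorm \<Delta> v" by simp
  have v: "norm (v l) \<le> ?r" if "l \<in> \<Delta>" for l
  proof (rule real_le_rsqrt)
    show "(norm (v l))\<^sup>2 \<le> sqnorm \<Delta> v"
      unfolding sqnorm_def by (rule member_le_sum[OF that]) (use fin in auto)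
  qed
  have "(norm (w k))\<^sup>2 \<le> (\<Sum>l\<in>\<Delta>. B k l)\<^sup>2 * sqnorm \<Delta> v" if k: "k \<in> \<Delta>" for k
  proof -
    have "norm (w k) \<le> (\<Sum>l\<in>\<Delta>. B k l * ?r)"
      by (rule order_trans[OF le[OF k]]) (intro sum_mono mult_left_mono v B)
    then have "(norm (w k))\<^sup>2 \<le> ((\<Sum>l\<in>\<Delta>. B k l) * ?r)\<^sup>2"
      by (intro power_mono) (simp_all add: sum_distrib_right)
    then show ?thesis unfolding power_mult_distrib r .
  qed
  then show ?thesis
    unfolding sqnorm_def[of \<Delta> w] sum_distrib_right by (rule sum_mono)
qed

lemma sqnorm_scale: "sqnorm \<Delta> (\<lambda>k. complex_of_real c *s w k) = c\<^sup>2 * sqnorm \<Delta> w"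
  by (simp add: sqnorm_def norm_scale power_mult_distrib sum_distrib_left)

text \<open>In finite dimension both norms are finite, so the unit ball for the two norms spans.\<close>

lemma toeplitz_scale_into_ball:
  fixes \<gamma> :: "'d::finite \<Rightarrow> complex^'s^'s::finite"
  assumes fin: "finite \<Delta>" and \<gamma>: "gamma_matrices \<gamma>"
  shows "\<exists>c>0. operator_norm (trig_spinors \<Delta> :: ('d, 's) spinor set) (matrix_op \<Delta> (\<lambda>i. complex_of_real c * T i)) \<le> 1 \<and>
    operator_norm (trig_spinors \<Delta>) (commutator (Dirac_trunc \<Delta> \<gamma>) (matrix_op \<Delta> (\<lambda>i. complex_of_real c * T i))) \<le> 1"
proof -
  define B where "B k l = cmod (T (k, l))" for k l
  define B' where "B' k l = cmod (T (k, l)) * (\<Sum>\<mu>\<in>(UNIV :: 'd set). cmod (of_int (k $ \<mu> - l $ \<mu>)))" for k l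
  define C where "C = (\<Sum>k\<in>\<Delta>. (\<Sum>l\<in>\<Delta>. B k l)\<^sup>2)"
  define C' where "C' = (\<Sum>k\<in>\<Delta>. (\<Sum>l\<in>\<Delta>. B' k l)\<^sup>2)"
  have C: "0 \<le> C" "0 \<le> C'" by (simp_all add: C_def C'_def sum_nonneg)
  have 1: "sqnorm \<Delta> (mat_apply \<Delta> T v) \<le> C * sqnorm \<Delta> v" for v :: "int^'d \<Rightarrow> complex^'s"
    unfolding C_def
  proof (rule sqnorm_le_of_kernel[OF fin])
    show "norm (mat_apply \<Delta> T v k) \<le> (\<Sum>l\<in>\<Delta>. B k l * norm (v l))" for k
      unfolding mat_apply_def B_def by (rule sum_norm_le) (simp add: norm_scale)
  qed (simp add: B_def)
  have 2: "sqnorm \<Delta> (mat_commutator \<gamma> \<Delta> T v) \<le> C' * sqnorm \<Delta> v" for v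
    unfolding C'_def
  proof (rule sqnorm_le_of_kernel[OF fin])
    fix k
    show "norm (mat_commutator \<gamma> \<Delta> T v k) \<le> (\<Sum>l\<in>\<Delta>. B' k l * norm (v l))"
      unfolding mat_commutator_def
    proof (rule sum_norm_le)
      fix l
      have "norm (clifford \<gamma> (\<lambda>\<mu>. of_int (k $ \<mu> - l $ \<mu>)) (v l)) \<le> (\<Sum>\<mu>\<in>UNIV. cmod (of_int (k $ \<mu> - l $ \<mu>)) * norm (v l))"
        unfolding clifford_def by (rule sum_norm_le) (simp add: norm_scale norm_gamma[OF \<gamma>] del: of_int_diff)
      then show "norm (T (k, l) *s clifford \<gamma> (\<lambda>\<mu>. of_int (k $ \<mu> - l $ \<mu>)) (v l)) \<le> B' k l * norm (v l)"
        unfolding norm_scale B'_def mult.assoc sum_distrib_right by (rule mult_left_mono) simp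
    qed
  qed (simp add: B'_def sum_nonneg)
  define c where "c = 1 / (1 + C + C')"
  have c: "0 < c" "c \<le> 1" "c * C \<le> 1" "c * C' \<le> 1" using C by (simp_all add: c_def field_simps)
  have sc: "c\<^sup>2 * K * S \<le> S" if "c * K \<le> 1" "0 \<le> K" "0 \<le> S" for K S
  proof -
    have "c * (c * K) \<le> 1 * 1" using c that by (intro mult_mono) auto
    then have "c\<^sup>2 * K \<le> 1" by (simp add: power2_eq_square mult.assoc)
    then show ?thesis using that(3) mult_right_mono[of "c\<^sup>2 * K" 1 S] by simp
  qed
  have "sqnorm \<Delta> (mat_apply \<Delta> (\<lambda>i. complex_of_real c * T i) v) \<le> sqnorm \<Delta> v" for v :: "int^'d \<Rightarrow> complex^'s"
  proof -
    have "mat_apply \<Delta> (\<lambda>i. complex_of_real c * T i) v = (\<lambda>k. complex_of_real c *s mat_apply \<Delta> T v k)"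
      by (rule ext) (simp add: mat_apply_def scale_sum_right vector_smult_assoc)
    then have "sqnorm \<Delta> (mat_apply \<Delta> (\<lambda>i. complex_of_real c * T i) v) = c\<^sup>2 * sqnorm \<Delta> (mat_apply \<Delta> T v)"
      by (simp only: sqnorm_scale)
    also have "\<dots> \<le> c\<^sup>2 * (C * sqnorm \<Delta> v)" by (rule mult_left_mono[OF 1]) simp
    also have "\<dots> \<le> sqnorm \<Delta> v" using sc[OF c(3) C(1) sqnorm_nonneg[of \<Delta> v]] by (simp add: mult.assoc)
    finally show ?thesis .
  qed
  moreover have "sqnorm \<Delta> (mat_commutator \<gamma> \<Delta> (\<lambda>i. complex_of_real c * T i) v) \<le> sqnorm \<Delta> v" for v
  proof -
    have "mat_commutator \<gamma> \<Delta> (\<lambda>i. complex_of_real c * T i) v = (\<lambda>k. complex_of_real c *s mat_commutator \<gamma> \<Delta> T v k)"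
      by (rule ext) (simp add: mat_commutator_def scale_sum_right vector_smult_assoc)
    then have "sqnorm \<Delta> (mat_commutator \<gamma> \<Delta> (\<lambda>i. complex_of_real c * T i) v) = c\<^sup>2 * sqnorm \<Delta> (mat_commutator \<gamma> \<Delta> T v)"
      by (simp only: sqnorm_scale)
    also have "\<dots> \<le> c\<^sup>2 * (C' * sqnorm \<Delta> v)" by (rule mult_left_mono[OF 2]) simp
    also have "\<dots> \<le> sqnorm \<Delta> v" using sc[OF c(4) C(2) sqnorm_nonneg[of \<Delta> v]] by (simp add: mult.assoc)
    finally show ?thesis .
  qed
  ultimately show ?thesis
    unfolding operator_norm_matrix_iff[OF fin] operator_norm_matrix_commutator_iff[OF fin] using c(1) by blast
qed

lemma toeplitz_entry_le:
  assumes fin: "finite \<Delta>" and kl: "k \<in> \<Delta>" "l \<in> \<Delta>"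
    and le: "operator_norm (trig_spinors \<Delta> :: ('d::finite, 's::finite) spinor set) (matrix_op \<Delta> T) \<le> 1"
  shows "cmod (T (k, l)) \<le> 1"
proof -
  obtain u :: "complex^'s" where u: "norm u = 1" using exists_unit_spinor by blast
  define v where "v n = (if n = l then u else 0)" for n
  have "mat_apply \<Delta> T v k = (\<Sum>n\<in>\<Delta>. if n = l then T (k, l) *s u else 0)"
    unfolding mat_apply_def by (intro sum.cong refl) (simp add: v_def)
  then have "mat_apply \<Delta> T v k = T (k, l) *s u" using fin kl by simp
  then have "(cmod (T (k, l)))\<^sup>2 = (norm (mat_apply \<Delta> T v k))\<^sup>2" by (simp add: norm_scale u)
  also have "\<dots> \<le> sqnorm \<Delta> (mat_apply \<Delta> T v)"
    unfolding sqnorm_def by (rule member_le_sum[OF kl(1)]) (use fin in auto)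
  also have "\<dots> \<le> sqnorm \<Delta> v" using le unfolding operator_norm_matrix_iff[OF fin] by blast
  also have "\<dots> = (\<Sum>n\<in>\<Delta>. if n = l then 1 else 0)"
    unfolding sqnorm_def by (intro sum.cong refl) (simp add: v_def u)
  also have "\<dots> = 1" using fin kl by simp
  finally show ?thesis by (simp add: abs_square_le_1)
qed

lemma zero_in_toeplitz: "(\<lambda>_. 0) \<in> toeplitz \<Delta>"
  by (auto simp: toeplitz_def intro!: exI[of _ "\<lambda>_. 0"])

lemma toeplitz_zero_ball:
  fixes \<gamma> :: "'d::finite \<Rightarrow> complex^'s^'s::finite"
  assumes fin: "finite \<Delta>"
  shows "operator_norm (trig_spinors \<Delta> :: ('d, 's) spinor set) (matrix_op \<Delta> (\<lambda>_. 0)) \<le> 1"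
    and "operator_norm (trig_spinors \<Delta>) (commutator (Dirac_trunc \<Delta> \<gamma>) (matrix_op \<Delta> (\<lambda>_. 0))) \<le> 1"
  unfolding operator_norm_matrix_iff[OF fin] operator_norm_matrix_commutator_iff[OF fin]
  by (simp_all add: mat_apply_def mat_commutator_def sqnorm_def sum_nonneg)

context
  fixes k :: "nat \<Rightarrow> 'k::complex_hilbert_space" and \<gamma> :: "'d::finite \<Rightarrow> complex^'s^'s::finite"
  assumes dense: "closure (k ` {1..}) = cball 0 1" and \<gamma>: "gamma_matrices \<gamma>"
begin

lemma norm_k_le_1: "p \<ge> 1 \<Longrightarrow> norm (k p) \<le> 1"
proof -
  assume "p \<ge> 1"
  then have "k p \<in> closure (k ` {1..})" by (intro closure_subset[THEN subsetD]) auto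
  then show ?thesis unfolding dense by simp
qed

lemma metric_on_UCP_toeplitz:
  assumes fin: "finite \<Delta>"
  shows "metric_on (UCP_toeplitz TYPE('s) \<Delta>) (dist_toeplitz \<gamma> k \<Delta>)"
  unfolding dist_toeplitz_def
proof (rule metric_on_ucp_dist[where ?f0.0 = "\<lambda>_. 0"])
  show "norm (k p) \<le> 1" if "p \<ge> 1" for p using that by (rule norm_k_le_1)
  show "cmod (qform (\<phi> T) x) \<le> (norm x)\<^sup>2"
    if "\<phi> \<in> UCP_toeplitz TYPE('s) \<Delta>" "T \<in> toeplitz \<Delta>"
      "operator_norm (trig_spinors \<Delta> :: ('d, 's) spinor set) (matrix_op \<Delta> T) \<le> 1" for \<phi> T x
    using that by (rule UCP_toeplitz_contractive[OF fin])
  fix \<phi> \<psi>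
  assume \<phi>: "\<phi> \<in> UCP_toeplitz TYPE('s) \<Delta>" and \<psi>: "\<psi> \<in> UCP_toeplitz TYPE('s) \<Delta>"
    and z: "\<And>T. T \<in> toeplitz \<Delta> \<Longrightarrow> operator_norm (trig_spinors \<Delta> :: ('d, 's) spinor set) (matrix_op \<Delta> T) \<le> 1 \<Longrightarrow>
      operator_norm (trig_spinors \<Delta>) (commutator (Dirac_trunc \<Delta> \<gamma>) (matrix_op \<Delta> T)) \<le> 1 \<Longrightarrow>
      weighted_form k (\<phi> T - \<psi> T) = 0"
  note \<phi>' = \<phi>[unfolded UCP_toeplitz_def] and \<psi>' = \<psi>[unfolded UCP_toeplitz_def]
  have eq: "\<phi> T = \<psi> T" if T: "T \<in> toeplitz \<Delta>" for T
  proof (rule operator_eqI_qform)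
    show "\<phi> T \<in> bounded_operators" "\<psi> T \<in> bounded_operators"
      using \<phi>' \<psi>' T unfolding ucp_maps_def by auto
    fix x
    obtain c where c: "c > 0" "operator_norm (trig_spinors \<Delta> :: ('d, 's) spinor set) (matrix_op \<Delta> (\<lambda>i. complex_of_real c * T i)) \<le> 1"
      "operator_norm (trig_spinors \<Delta>) (commutator (Dirac_trunc \<Delta> \<gamma>) (matrix_op \<Delta> (\<lambda>i. complex_of_real c * T i))) \<le> 1"
      using toeplitz_scale_into_ball[OF fin \<gamma>] by blast
    let ?S = "\<lambda>i. complex_of_real c * T i"
    have S: "?S \<in> toeplitz \<Delta>" using lin_closedD[OF lin_closed_toeplitz T T, of "complex_of_real c" 0] by simp
    have q: "qform (\<omega> ?S) x = c * qform (\<omega> T) x"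
      if "\<omega> \<in> ucp_maps (toeplitz \<Delta>) (identity_matrix \<Delta>) (matrix_op \<Delta>) (trig_spinors \<Delta> :: ('d, 's) spinor set)" for \<omega> :: "_ \<Rightarrow> 'k \<Rightarrow>\<^sub>L 'k"
      using ucp_maps_qform_lincomb[OF that T T, of "complex_of_real c" 0 x] by simp
    (* the metric only tests multiples of T that lie in the unit ball *)
    have "qform (\<phi> ?S - \<psi> ?S) x = 0"
      by (rule qform_eq_0_of_dense[OF dense]) (rule weighted_form_eq_0D[OF norm_k_le_1 z[OF S c(2,3)]])
    then show "qform (\<phi> T) x = qform (\<psi> T) x"
      using c(1) by (simp add: qform_diff q[OF \<phi>'] q[OF \<psi>'])
  qed
  show "\<phi> = \<psi>"
    using \<phi>' \<psi>' eq unfolding ucp_maps_def by (intro PiE_ext[of \<phi> "toeplitz \<Delta>"]) auto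
qed (rule zero_in_toeplitz toeplitz_zero_ball[OF fin])+

text \<open>A Toeplitz matrix in the unit ball is a combination, with coefficients of modulus at most one, of the
  finitely many matrices with a single diagonal of ones.  The coordinates are the values of a map on these, tested
  on finitely many of the vectors \<open>k p\<close>.\<close>

lemma totally_bounded_UCP_toeplitz:
  assumes fin: "finite \<Delta>"
  shows "totally_bounded_on (UCP_toeplitz TYPE('s) \<Delta>) (dist_toeplitz \<gamma> k \<Delta>)"
proof (rule totally_bounded_onI_coordinates)
  fix e :: real assume e: "e > 0"
  define Ds where "Ds = (\<lambda>(a, b). a - b) ` (\<Delta> \<times> \<Delta>)"
  have finD: "finite Ds" using fin by (simp add: Ds_def)
  define E where "E n = (\<lambda>(a, b). if a \<in> \<Delta> \<and> b \<in> \<Delta> \<and> a - b = n then 1 else 0 :: complex)" for n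
  have E: "E n \<in> toeplitz \<Delta>" for n
    by (auto simp: toeplitz_def E_def intro!: exI[of _ "\<lambda>i. if i = n then 1 else 0"])
  (* P bounds the tail 2 / 2 ^ P of the weighted sum by e / 4 *)
  obtain P :: nat where P: "8 / e < 2 ^ P" using real_arch_pow[of 2 "8 / e"] by auto
  define N where "N = real P * real (card Ds) + 1"
  have N: "N > 0" by (simp add: N_def add_nonneg_pos)
  define \<delta> where "\<delta> = e / (2 * N)"
  have \<delta>: "\<delta> > 0" using e N by (simp add: \<delta>_def)
  define c where "c = (\<lambda>(n, p) (\<phi> :: _ \<Rightarrow> 'k \<Rightarrow>\<^sub>L 'k). qform (\<phi> (E n)) (k (Suc p)))"
  have bdd: "bounded (c j ` UCP_toeplitz TYPE('s) \<Delta>)" for j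
  proof -
    obtain n p where j: "j = (n, p)" by fastforce
    obtain r where r: "r > 0" "operator_norm (trig_spinors \<Delta> :: ('d, 's) spinor set) (matrix_op \<Delta> (\<lambda>i. complex_of_real r * E n i)) \<le> 1"
      using toeplitz_scale_into_ball[OF fin \<gamma>] by blast
    have S: "(\<lambda>i. complex_of_real r * E n i) \<in> toeplitz \<Delta>"
      using lin_closedD[OF lin_closed_toeplitz E E, of "complex_of_real r" n 0] by simp
    show ?thesis
    proof (rule boundedI)
      fix y assume "y \<in> c j ` UCP_toeplitz TYPE('s) \<Delta>"
      then obtain \<phi> where \<phi>: "\<phi> \<in> UCP_toeplitz TYPE('s) \<Delta>" and y: "y = qform (\<phi> (E n)) (k (Suc p))"
        by (auto simp: c_def j)
      have "cmod (qform (\<phi> (\<lambda>i. complex_of_real r * E n i)) (k (Suc p))) \<le> (norm (k (Suc p)))\<^sup>2"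
        by (rule UCP_toeplitz_contractive[OF fin \<phi> S r(2)])
      also have "qform (\<phi> (\<lambda>i. complex_of_real r * E n i)) (k (Suc p)) = r * y"
        using ucp_maps_qform_lincomb[OF \<phi>[unfolded UCP_toeplitz_def] E[of n] E[of n], of "complex_of_real r" 0] by (simp add: y)
      also have "(norm (k (Suc p)))\<^sup>2 \<le> 1" using norm_k_le_1[of "Suc p"] by (simp add: power_le_one)
      finally have "r * cmod y \<le> 1" using r(1) by (simp add: norm_mult)
      then show "norm y \<le> 1 / r" using r(1) by (simp add: field_simps)
    qed
  qed
  have "dist_toeplitz \<gamma> k \<Delta> \<phi> \<psi> < e"
    if \<phi>: "\<phi> \<in> UCP_toeplitz TYPE('s) \<Delta>" and \<psi>: "\<psi> \<in> UCP_toeplitz TYPE('s) \<Delta>"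
      and close: "\<forall>j\<in>Ds \<times> {..<P}. dist (c j \<phi>) (c j \<psi>) < \<delta>" for \<phi> \<psi>
  proof -
    have "dist_toeplitz \<gamma> k \<Delta> \<phi> \<psi> \<le> real P * (real (card Ds) * \<delta>) + 2 / 2 ^ P"
      unfolding dist_toeplitz_def
    proof (rule ucp_dist_least[where ?f0.0 = "\<lambda>_. 0"])
      fix T assume T: "T \<in> toeplitz \<Delta>" and norm: "operator_norm (trig_spinors \<Delta> :: ('d, 's) spinor set) (matrix_op \<Delta> T) \<le> 1"
      obtain t where t: "\<And>a b. T (a, b) = (if a \<in> \<Delta> \<and> b \<in> \<Delta> then t (a - b) else 0)"
        using T by (auto simp: toeplitz_def)
      have t1: "cmod (t n) \<le> 1" if n: "n \<in> Ds" for n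
      proof -
        obtain a b where "a \<in> \<Delta>" "b \<in> \<Delta>" "n = a - b" using n by (auto simp: Ds_def)
        then show ?thesis using toeplitz_entry_le[OF fin _ _ norm, of a b] by (simp add: t)
      qed
      have Teq: "T = (\<lambda>i. \<Sum>n\<in>Ds. t n * E n i)"
      proof
        fix i :: "(int^'d) \<times> (int^'d)"
        obtain a b where i: "i = (a, b)" by fastforce
        have "(\<Sum>n\<in>Ds. t n * E n i) = (\<Sum>n\<in>Ds. if n = a - b then (if a \<in> \<Delta> \<and> b \<in> \<Delta> then t (a - b) else 0) else 0)"
          by (intro sum.cong refl) (auto simp: E_def i)
        also have "\<dots> = T i" using finD by (auto simp: i t Ds_def)
        finally show "T i = (\<Sum>n\<in>Ds. t n * E n i)" ..
      qed
      have q: "qform (\<omega> T) x = (\<Sum>n\<in>Ds. t n * qform (\<omega> (E n)) x)"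
        if "\<omega> \<in> UCP_toeplitz TYPE('s) \<Delta>" for \<omega> and x :: 'k
        unfolding Teq using that E finD
        by (intro ucp_maps_qform_sum[THEN conjunct2, OF _ lin_closed_toeplitz identity_toeplitz]) (auto simp: UCP_toeplitz_def)
      have "weighted_form k (\<phi> T - \<psi> T) \<le> (\<Sum>p<P. cmod (qform (\<phi> T - \<psi> T) (k (Suc p)))) + 2 / 2 ^ P"
      proof (rule weighted_form_le_partial[OF norm_k_le_1])
        fix x
        have "cmod (qform (\<phi> T) x) \<le> (norm x)\<^sup>2" "cmod (qform (\<psi> T) x) \<le> (norm x)\<^sup>2"
          by (rule UCP_toeplitz_contractive[OF fin _ T norm]; fact)+
        then show "cmod (qform (\<phi> T - \<psi> T) x) \<le> 2 * (norm x)\<^sup>2"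
          unfolding qform_diff using norm_triangle_ineq4[of "qform (\<phi> T) x" "qform (\<psi> T) x"] by linarith
      qed simp_all
      also have "(\<Sum>p<P. cmod (qform (\<phi> T - \<psi> T) (k (Suc p)))) \<le> (\<Sum>p<P. real (card Ds) * \<delta>)"
      proof (rule sum_mono)
        fix p assume p: "p \<in> {..<P}"
        have "qform (\<phi> T - \<psi> T) (k (Suc p)) = (\<Sum>n\<in>Ds. t n * (c (n, p) \<phi> - c (n, p) \<psi>))"
          by (simp add: qform_diff q[OF \<phi>] q[OF \<psi>] c_def right_diff_distrib sum_subtractf)
        also have "cmod \<dots> \<le> (\<Sum>n\<in>Ds. \<delta>)"
        proof (rule sum_norm_le)
          fix n assume n: "n \<in> Ds"
          have "cmod (t n) * cmod (c (n, p) \<phi> - c (n, p) \<psi>) \<le> 1 * \<delta>"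
            using t1[OF n] close n p by (intro mult_mono) (auto simp: dist_norm less_imp_le)
          then show "cmod (t n * (c (n, p) \<phi> - c (n, p) \<psi>)) \<le> \<delta>" by (simp add: norm_mult)
        qed
        finally show "cmod (qform (\<phi> T - \<psi> T) (k (Suc p))) \<le> real (card Ds) * \<delta>" by simp
      qed
      finally show "weighted_form k (\<phi> T - \<psi> T) \<le> real P * (real (card Ds) * \<delta>) + 2 / 2 ^ P" by simp
    qed (rule zero_in_toeplitz toeplitz_zero_ball[OF fin])+
    also have "real P * (real (card Ds) * \<delta>) \<le> N * \<delta>" using \<delta> by (simp add: N_def algebra_simps)
    also have "N * \<delta> = e / 2" using N by (simp add: \<delta>_def)
    also have "2 / 2 ^ P < e / 2"
    proof -
      have "8 < 2 ^ P * e" using P e by (simp add: pos_divide_less_eq)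
      then have "4 < 2 ^ P * e" by linarith
      then show ?thesis by (simp add: field_simps)
    qed
    finally show ?thesis by simp
  qed
  then show "\<exists>J (c :: (int^'d) \<times> nat \<Rightarrow> (((int^'d) \<times> (int^'d) \<Rightarrow> complex) \<Rightarrow> 'k \<Rightarrow>\<^sub>L 'k) \<Rightarrow> complex) \<delta>. finite J \<and> \<delta> > 0 \<and>
      (\<forall>j\<in>J. bounded (c j ` UCP_toeplitz TYPE('s) \<Delta>)) \<and>
      (\<forall>\<phi>\<in>UCP_toeplitz TYPE('s) \<Delta>. \<forall>\<psi>\<in>UCP_toeplitz TYPE('s) \<Delta>. (\<forall>j\<in>J. dist (c j \<phi>) (c j \<psi>) < \<delta>) \<longrightarrow> dist_toeplitz \<gamma> k \<Delta> \<phi> \<psi> < e)"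
    using \<delta> finD bdd by (intro exI[of _ "Ds \<times> {..<P}"] exI[of _ c] exI[of _ \<delta>]) auto
qed

end

section \<open>Completely positive maps on continuous functions\<close>

lemma lin_closed_torus_continuous: "lin_closed torus_continuous"
  by (auto simp: lin_closed_def torus_continuous_def periodic_def intro!: continuous_intros)

lemma one_torus_continuous: "(\<lambda>_. 1) \<in> torus_continuous"
  by (auto simp: torus_continuous_def periodic_def)

lemma cnj_torus_continuous: "f \<in> torus_continuous \<Longrightarrow> (\<lambda>x. cnj (f x)) \<in> torus_continuous"
  by (auto simp: torus_continuous_def periodic_def intro!: continuous_intros)

text \<open>The integrand is bounded by a multiple of \<open>(\<parallel>\<xi>\<parallel>\<^sup>2 + \<parallel>\<eta>\<parallel>\<^sup>2) / 2\<close>.\<close>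

lemma integrable_L2_hdot:
  assumes \<xi>: "\<xi> \<in> L2_spinors" and \<eta>: "\<eta> \<in> L2_spinors" and h: "h \<in> torus_continuous"
  shows "integrable torus_measure (\<lambda>x. h x * hdot (\<xi> x) (\<eta> x))"
proof -
  have hc: "continuous_on UNIV h" "periodic h" using h by (auto simp: torus_continuous_def)
  obtain B where B: "B > 0" "\<And>x. cmod (h x) \<le> B" using continuous_periodic_bounded[OF hc] by blast
  have [measurable]: "h \<in> borel_measurable borel" by (rule borel_measurable_continuous_onI[OF hc(1)])
  have comp: "(\<lambda>x. \<psi> x $ s) \<in> borel_measurable borel" if "\<psi> \<in> L2_spinors" for \<psi> :: "('a, 'b) spinor" and s
  proof -
    have "\<psi> \<in> borel_measurable borel" using that by (simp add: L2_spinors_def)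
    moreover have "(\<lambda>v :: complex^'b. v $ s) \<in> borel_measurable borel"
      by (intro borel_measurable_continuous_onI continuous_intros)
    ultimately show ?thesis by (rule measurable_compose)
  qed
  have cnj: "cnj \<in> borel_measurable borel" by (intro borel_measurable_continuous_onI continuous_intros)
  have meas: "(\<lambda>x. hdot (\<xi> x) (\<eta> x)) \<in> borel_measurable borel"
    unfolding hdot_def by (intro borel_measurable_sum borel_measurable_times comp \<xi> \<eta> measurable_compose[OF comp cnj])
  show ?thesis
  proof (rule Bochner_Integration.integrable_bound)
    show "integrable torus_measure (\<lambda>x. B * (((norm (\<xi> x))\<^sup>2 + (norm (\<eta> x))\<^sup>2) / 2))"
      using \<xi> \<eta> by (simp add: L2_spinors_def)
    show "(\<lambda>x. h x * hdot (\<xi> x) (\<eta> x)) \<in> borel_measurable torus_measure"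
      using meas by simp
    have le: "cmod (h x * hdot (\<xi> x) (\<eta> x)) \<le> B * (((norm (\<xi> x))\<^sup>2 + (norm (\<eta> x))\<^sup>2) / 2)" for x
      unfolding norm_mult using B(1) by (intro mult_mono B(2) hdot_amgm) auto
    show "AE x in torus_measure. norm (h x * hdot (\<xi> x) (\<eta> x)) \<le> norm (B * (((norm (\<xi> x))\<^sup>2 + (norm (\<eta> x))\<^sup>2) / 2))"
      by (intro AE_I2, unfold real_norm_def) (rule order_trans[OF le abs_ge_self])
  qed
qed

lemma spinor_inner_mult_op: "spinor_inner (mult_op f \<xi>) \<eta> = (LINT x|torus_measure. f x * hdot (\<xi> x) (\<eta> x))"
  by (simp add: spinor_inner_hdot mult_op_def hdot_scale_left)

lemma UCP_torus_bound:
  fixes f :: "real^'d \<Rightarrow> complex"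
  assumes \<phi>: "\<phi> \<in> UCP_torus TYPE('s::finite)" and f: "f \<in> torus_continuous"
    and le: "\<And>x. cmod (f x) \<le> M"
  shows "cmod (qform (\<phi> f) y) \<le> M * (norm y)\<^sup>2"
proof (rule ucp_maps_numerical_radius[OF \<phi>[unfolded UCP_torus_def] lin_closed_torus_continuous one_torus_continuous f cnj_torus_continuous[OF f],
      where n = "\<lambda>\<xi>. (LINT x|torus_measure. (norm (\<xi> x))\<^sup>2)" and z = "\<lambda>\<xi>. (LINT x|torus_measure. f x * hdot (\<xi> x) (\<xi> x))"])
  fix \<xi> :: "('d, 's) spinor" assume \<xi>: "\<xi> \<in> L2_spinors"
  let ?N = "\<lambda>x. hdot (\<xi> x) (\<xi> x)"
  note int1 = integrable_L2_hdot[OF \<xi> \<xi> one_torus_continuous] and intf = integrable_L2_hdot[OF \<xi> \<xi> f]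
    and intc = integrable_L2_hdot[OF \<xi> \<xi> cnj_torus_continuous[OF f]]
  have n: "(LINT x|torus_measure. ?N x) = complex_of_real (LINT x|torus_measure. (norm (\<xi> x))\<^sup>2)"
    by (simp add: hdot_self del: of_real_power)
  have c: "(LINT x|torus_measure. cnj (f x) * ?N x) = cnj (LINT x|torus_measure. f x * ?N x)"
  proof -
    have "(LINT x|torus_measure. cnj (f x) * ?N x) = (LINT x|torus_measure. cnj (f x * ?N x))"
      unfolding complex_cnj_mult cnj_hdot ..
    also have "\<dots> = cnj (LINT x|torus_measure. f x * ?N x)"
      by (rule integral_bounded_linear[OF bounded_linear_cnj intf])
    finally show ?thesis .
  qed
  show "spinor_inner (mult_op (\<lambda>x. \<alpha> * 1 + 1 * (\<beta> * f x + \<gamma> * cnj (f x))) \<xi>) \<xi>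
      = \<alpha> * complex_of_real (LINT x|torus_measure. (norm (\<xi> x))\<^sup>2) + \<beta> * (LINT x|torus_measure. f x * ?N x)
        + \<gamma> * cnj (LINT x|torus_measure. f x * ?N x)" for \<alpha> \<beta> \<gamma>
  proof -
    have "spinor_inner (mult_op (\<lambda>x. \<alpha> * 1 + 1 * (\<beta> * f x + \<gamma> * cnj (f x))) \<xi>) \<xi>
        = (LINT x|torus_measure. (\<alpha> * (1 * ?N x) + \<beta> * (f x * ?N x)) + \<gamma> * (cnj (f x) * ?N x))"
      unfolding spinor_inner_mult_op by (intro Bochner_Integration.integral_cong refl) (simp add: algebra_simps)
    also have "\<dots> = (LINT x|torus_measure. \<alpha> * (1 * ?N x) + \<beta> * (f x * ?N x)) + (LINT x|torus_measure. \<gamma> * (cnj (f x) * ?N x))"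
      by (intro Bochner_Integration.integral_add Bochner_Integration.integrable_add integrable_mult_right impI int1 intf intc)
    also have "(LINT x|torus_measure. \<alpha> * (1 * ?N x) + \<beta> * (f x * ?N x))
        = (LINT x|torus_measure. \<alpha> * (1 * ?N x)) + (LINT x|torus_measure. \<beta> * (f x * ?N x))"
      by (intro Bochner_Integration.integral_add integrable_mult_right impI int1 intf)
    finally show ?thesis unfolding integral_mult_right_zero mult_1 n c .
  qed
  have "cmod (LINT x|torus_measure. f x * ?N x) \<le> (LINT x|torus_measure. M * (norm (\<xi> x))\<^sup>2)"
  proof (rule Bochner_Integration.integral_norm_bound_integral[OF intf])
    show "integrable torus_measure (\<lambda>x. M * (norm (\<xi> x))\<^sup>2)" using \<xi> by (simp add: L2_spinors_def)
    show "cmod (f x * ?N x) \<le> M * (norm (\<xi> x))\<^sup>2" for x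
      unfolding norm_mult hdot_self norm_of_real abs_of_nonneg[OF zero_le_power2]
      by (rule mult_right_mono[OF le zero_le_power2])
  qed
  then show "cmod (LINT x|torus_measure. f x * ?N x) \<le> M * (LINT x|torus_measure. (norm (\<xi> x))\<^sup>2)" by simp
qed

section \<open>Pulling back unital completely positive maps\<close>

definition torus_pullback :: "(int^'d) set \<Rightarrow> (((int^'d) \<times> (int^'d) \<Rightarrow> complex) \<Rightarrow> 'b) \<Rightarrow> (real^'d \<Rightarrow> complex) \<Rightarrow> 'b" where
  "torus_pullback \<Delta> \<phi> = (\<lambda>f\<in>torus_continuous. \<phi> (compress \<Delta> f))"

definition toeplitz_pullback :: "nat \<Rightarrow> (int^'d) set \<Rightarrow> ((real^'d \<Rightarrow> complex) \<Rightarrow> 'b) \<Rightarrow> ((int^'d) \<times> (int^'d) \<Rightarrow> complex) \<Rightarrow> 'b" where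
  "toeplitz_pullback m \<Delta> \<psi> = (\<lambda>T\<in>toeplitz \<Delta>. \<psi> (symbol m T))"

text \<open>Precomposition with a unital linear map that preserves positivity of matrices.\<close>

lemma ucp_maps_pullback:
  assumes \<phi>: "\<phi> \<in> ucp_maps E u \<pi> H"
    and F: "lin_closed F" "w \<in> F"
    and R: "\<And>f. f \<in> F \<Longrightarrow> R f \<in> E" "R w = u"
      "\<And>f g \<alpha> \<beta>. f \<in> F \<Longrightarrow> g \<in> F \<Longrightarrow> R (\<lambda>i. \<alpha> * f i + \<beta> * g i) = (\<lambda>i. \<alpha> * R f i + \<beta> * R g i)"
    and pos: "\<And>n a. (\<And>i j. i < n \<Longrightarrow> j < n \<Longrightarrow> a i j \<in> F) \<Longrightarrow> matrix_positive \<rho> K n a \<Longrightarrow>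
      matrix_positive \<pi> H n (\<lambda>i j. R (a i j))"
  shows "(\<lambda>f\<in>F. \<phi> (R f)) \<in> ucp_maps F w \<rho> K"
  unfolding ucp_maps_def
proof (intro CollectI conjI ballI allI impI)
  have lin: "\<forall>f\<in>E. \<forall>g\<in>E. \<forall>\<alpha> \<beta> x. blinfun_apply (\<phi> (\<lambda>i. \<alpha> * f i + \<beta> * g i)) x
      = \<alpha> *\<^sub>C blinfun_apply (\<phi> f) x + \<beta> *\<^sub>C blinfun_apply (\<phi> g) x"
    using \<phi> unfolding ucp_maps_def mem_Collect_eq by (elim conjE)
  have \<phi>1: "\<phi> T \<in> bounded_operators" if "T \<in> E" for T using \<phi> that unfolding ucp_maps_def by auto
  show "(\<lambda>f\<in>F. \<phi> (R f)) \<in> F \<rightarrow>\<^sub>E bounded_operators" using \<phi>1 R(1) by auto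
  show "(\<lambda>f\<in>F. \<phi> (R f)) w = id_blinfun" using \<phi> F(2) by (simp add: R(2) ucp_maps_def)
  fix f g \<alpha> \<beta> x assume f: "f \<in> F" and g: "g \<in> F"
  have "blinfun_apply (\<phi> (\<lambda>i. \<alpha> * R f i + \<beta> * R g i)) x
      = \<alpha> *\<^sub>C blinfun_apply (\<phi> (R f)) x + \<beta> *\<^sub>C blinfun_apply (\<phi> (R g)) x"
    by (rule lin[rule_format, OF R(1)[OF f] R(1)[OF g]])
  then show "blinfun_apply ((\<lambda>f\<in>F. \<phi> (R f)) (\<lambda>i. \<alpha> * f i + \<beta> * g i)) x
      = \<alpha> *\<^sub>C blinfun_apply ((\<lambda>f\<in>F. \<phi> (R f)) f) x + \<beta> *\<^sub>C blinfun_apply ((\<lambda>f\<in>F. \<phi> (R f)) g) x"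
    using f g lin_closedD[OF F(1) f g, of \<alpha> \<beta>] by (simp add: R(3))
next
  fix n a assume a: "\<forall>i<n. \<forall>j<n. a i j \<in> F" and p: "matrix_positive \<rho> K n a"
  have "matrix_positive \<pi> H n (\<lambda>i j. R (a i j))" by (rule pos[OF _ p]) (use a in blast)
  moreover have "\<forall>i<n. \<forall>j<n. R (a i j) \<in> E" using a R(1) by blast
  moreover have "\<forall>n a. (\<forall>i<n. \<forall>j<n. a i j \<in> E) \<longrightarrow> matrix_positive \<pi> H n a \<longrightarrow>
      operator_matrix_positive n (\<lambda>i j. \<phi> (a i j))"
    using \<phi> unfolding ucp_maps_def mem_Collect_eq by (elim conjE)
  ultimately have "operator_matrix_positive n (\<lambda>i j. \<phi> (R (a i j)))" by simp
  moreover have "(\<Sum>i<n. \<Sum>j<n. cinner (blinfun_apply ((\<lambda>f\<in>F. \<phi> (R f)) (a i j)) (\<eta> j)) (\<eta> i))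
      = (\<Sum>i<n. \<Sum>j<n. cinner (blinfun_apply (\<phi> (R (a i j))) (\<eta> j)) (\<eta> i))" for \<eta>
    by (intro sum.cong refl) (use a in simp)
  ultimately show "operator_matrix_positive n (\<lambda>i j. (\<lambda>f\<in>F. \<phi> (R f)) (a i j))"
    unfolding operator_matrix_positive_def by (simp only: simp_thms)
qed

text \<open>On spinors with modes in \<open>\<Delta>\<close> the compression of a function has the same matrix elements as the function.\<close>

lemma torus_pullback_UCP:
  fixes \<Delta> :: "(int^'d) set" and \<phi> :: "_ \<Rightarrow> 'k::complex_hilbert_space \<Rightarrow>\<^sub>L 'k"
  assumes fin: "finite \<Delta>" and \<phi>: "\<phi> \<in> UCP_toeplitz TYPE('s::finite) \<Delta>"
  shows "torus_pullback \<Delta> \<phi> \<in> UCP_torus TYPE('s)"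
  unfolding torus_pullback_def UCP_torus_def
proof (rule ucp_maps_pullback[where R = "compress \<Delta>", OF \<phi>[unfolded UCP_toeplitz_def]
      lin_closed_torus_continuous one_torus_continuous])
  show "compress \<Delta> f \<in> toeplitz \<Delta>" for f by (rule compress_toeplitz)
  show "compress \<Delta> (\<lambda>_. 1) = identity_matrix \<Delta>" by (rule compress_one)
  fix n and a :: "nat \<Rightarrow> nat \<Rightarrow> real^'d \<Rightarrow> complex"
  assume a: "\<And>i j. i < n \<Longrightarrow> j < n \<Longrightarrow> a i j \<in> torus_continuous"
    and pos: "matrix_positive mult_op (L2_spinors :: ('d, 's) spinor set) n a"
  show "matrix_positive (matrix_op \<Delta>) (trig_spinors \<Delta> :: ('d, 's) spinor set) n (\<lambda>i j. compress \<Delta> (a i j))"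
    unfolding matrix_positive_def
  proof (intro allI impI)
    fix \<xi> :: "nat \<Rightarrow> ('d, 's) spinor" assume "\<forall>i<n. \<xi> i \<in> trig_spinors \<Delta>"
    then have "\<forall>i. \<exists>v. i < n \<longrightarrow> \<xi> i = trig \<Delta> v" by (auto simp: trig_spinors_eq)
    then obtain v where v: "\<And>i. i < n \<Longrightarrow> \<xi> i = trig \<Delta> (v i)" by metis
    have eq: "spinor_inner (matrix_op \<Delta> (compress \<Delta> (a i j)) (\<xi> j)) (\<xi> i) = spinor_inner (mult_op (a i j) (\<xi> j)) (\<xi> i)"
      if "i < n" "j < n" for i j
    proof -
      have "continuous_on UNIV (a i j)" using a[OF that] by (simp add: torus_continuous_def)
      from spinor_inner_mult_trig[OF this, of \<Delta> "v j" "v i"] show ?thesis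
        unfolding v[OF that(1)] v[OF that(2)] spinor_inner_matrix_op[OF fin] spinor_inner_mult_op
        by (simp add: mat_form_def compress_def)
    qed
    have "\<forall>i<n. \<xi> i \<in> L2_spinors" using v trig_L2 by metis
    then have "(\<Sum>i<n. \<Sum>j<n. spinor_inner (mult_op (a i j) (\<xi> j)) (\<xi> i)) \<in> \<real>\<^sub>\<ge>\<^sub>0"
      using pos unfolding matrix_positive_def by blast
    then show "(\<Sum>i<n. \<Sum>j<n. spinor_inner (matrix_op \<Delta> (compress \<Delta> (a i j)) (\<xi> j)) (\<xi> i)) \<in> \<real>\<^sub>\<ge>\<^sub>0"
      by (simp add: eq)
  qed
next
  show "compress \<Delta> (\<lambda>i. \<alpha> * f i + \<beta> * g i) = (\<lambda>i. \<alpha> * compress \<Delta> f i + \<beta> * compress \<Delta> g i)"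
    if "f \<in> torus_continuous" "g \<in> torus_continuous" for f g \<alpha> \<beta>
    by (rule compress_lincomb) (use that in \<open>simp_all add: torus_continuous_def\<close>)
qed

text \<open>Positivity holds at every point of the torus: the symbols at \<open>x\<close>, applied to the values of spinors at \<open>x\<close>, are
  the matrix elements of the Toeplitz matrices at the corresponding peaks.\<close>

lemma toeplitz_pullback_UCP:
  fixes \<Delta> :: "(int^'d) set" and \<psi> :: "_ \<Rightarrow> 'k::complex_hilbert_space \<Rightarrow>\<^sub>L 'k"
  assumes m: "m > 0" and fin: "finite \<Delta>" and sub: "cube m \<subseteq> \<Delta>" and \<psi>: "\<psi> \<in> UCP_torus TYPE('s::finite)"
  shows "toeplitz_pullback m \<Delta> \<psi> \<in> UCP_toeplitz TYPE('s) \<Delta>"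
  unfolding toeplitz_pullback_def UCP_toeplitz_def
proof (rule ucp_maps_pullback[where R = "symbol m", OF \<psi>[unfolded UCP_torus_def] lin_closed_toeplitz identity_toeplitz])
  show "symbol m T \<in> torus_continuous" for T :: "(int^'d) \<times> (int^'d) \<Rightarrow> complex"
    by (rule torus_smooth_continuous[OF symbol_torus_smooth])
  show "symbol m (identity_matrix \<Delta>) = (\<lambda>_. 1)" by (rule symbol_identity[OF sub m])
  show "symbol m (\<lambda>i. \<alpha> * S i + \<beta> * T i) = (\<lambda>i. \<alpha> * symbol m S i + \<beta> * symbol m T i)"
    for S T :: "(int^'d) \<times> (int^'d) \<Rightarrow> complex" and \<alpha> \<beta> by (rule symbol_lincomb)
  fix n and a :: "nat \<Rightarrow> nat \<Rightarrow> (int^'d) \<times> (int^'d) \<Rightarrow> complex"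
  assume pos: "matrix_positive (matrix_op \<Delta>) (trig_spinors \<Delta> :: ('d, 's) spinor set) n a"
  show "matrix_positive mult_op (L2_spinors :: ('d, 's) spinor set) n (\<lambda>i j. symbol m (a i j))"
    unfolding matrix_positive_def
  proof (intro allI impI)
    fix \<xi> :: "nat \<Rightarrow> ('d, 's) spinor" assume \<xi>: "\<forall>i<n. \<xi> i \<in> L2_spinors"
    let ?S = "\<lambda>x. \<Sum>i<n. \<Sum>j<n. symbol m (a i j) x * hdot (\<xi> j x) (\<xi> i x)"
    have S: "?S x \<in> \<real>\<^sub>\<ge>\<^sub>0" for x
    proof -
      have "(\<Sum>i<n. \<Sum>j<n. spinor_inner (matrix_op \<Delta> (a i j) (trig \<Delta> (peak m x (\<xi> j x)))) (trig \<Delta> (peak m x (\<xi> i x)))) \<in> \<real>\<^sub>\<ge>\<^sub>0"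
        using pos[unfolded matrix_positive_def, rule_format, of "\<lambda>i. trig \<Delta> (peak m x (\<xi> i x))"] by simp
      then show ?thesis unfolding spinor_inner_matrix_op[OF fin] symbol_form[OF m fin sub] .
    qed
    have int: "integrable torus_measure (\<lambda>x. symbol m (a i j) x * hdot (\<xi> j x) (\<xi> i x))" if "i < n" "j < n" for i j
      using \<xi> that by (intro integrable_L2_hdot torus_smooth_continuous symbol_torus_smooth) auto
    have "(\<Sum>i<n. \<Sum>j<n. spinor_inner (mult_op (symbol m (a i j)) (\<xi> j)) (\<xi> i))
        = (\<Sum>i<n. (LINT x|torus_measure. (\<Sum>j<n. symbol m (a i j) x * hdot (\<xi> j x) (\<xi> i x))))"
      unfolding spinor_inner_mult_op
      by (intro sum.cong refl Bochner_Integration.integral_sum[symmetric] int) auto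
    also have "\<dots> = (LINT x|torus_measure. ?S x)"
      by (intro Bochner_Integration.integral_sum[symmetric] Bochner_Integration.integrable_sum int) auto
    also have "\<dots> = (LINT x|torus_measure. complex_of_real (Re (?S x)))"
      using S by (intro Bochner_Integration.integral_cong refl) (simp add: complex_nonneg_Reals_iff complex_eq_iff)
    also have "\<dots> = complex_of_real (LINT x|torus_measure. Re (?S x))" by (rule integral_complex_of_real)
    also have "\<dots> \<in> \<real>\<^sub>\<ge>\<^sub>0"
    proof -
      have "0 \<le> Re (?S x)" for x using S[of x] by (simp only: complex_nonneg_Reals_iff)
      then have "0 \<le> (LINT x|torus_measure. Re (?S x))" by (intro integral_nonneg_AE AE_I2)
      then show ?thesis by (simp only: complex_nonneg_Reals_iff Re_complex_of_real Im_complex_of_real)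
    qed
    finally show "(\<Sum>i<n. \<Sum>j<n. spinor_inner (mult_op (symbol m (a i j)) (\<xi> j)) (\<xi> i)) \<in> \<real>\<^sub>\<ge>\<^sub>0" .
  qed
qed

lemma compress_ball:
  fixes \<gamma> :: "'d::finite \<Rightarrow> complex^'s^'s::finite"
  assumes fin: "finite \<Delta>" and f: "f \<in> torus_smooth"
    and norm: "operator_norm (L2_spinors :: ('d, 's) spinor set) (mult_op f) \<le> 1"
    and lip: "operator_norm smooth_spinors (commutator (Dirac \<gamma>) (mult_op f)) \<le> 1"
  shows "operator_norm (trig_spinors \<Delta> :: ('d, 's) spinor set) (matrix_op \<Delta> (compress \<Delta> f)) \<le> 1"
    and "operator_norm (trig_spinors \<Delta>) (commutator (Dirac_trunc \<Delta> \<gamma>) (matrix_op \<Delta> (compress \<Delta> f))) \<le> 1"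
  unfolding operator_norm_matrix_iff[OF fin] operator_norm_matrix_commutator_iff[OF fin]
  using sqnorm_compress_le[OF fin torus_smoothD(3)[OF f] operator_norm_mult_opD[OF f norm]]
    sqnorm_compress_commutator_le[OF fin f operator_norm_commutatorD[OF f lip]] by blast+

lemma symbol_ball:
  fixes \<gamma> :: "'d::finite \<Rightarrow> complex^'s^'s::finite"
  assumes m: "m > 0" and fin: "finite \<Delta>" and sub: "cube m \<subseteq> \<Delta>"
    and norm: "operator_norm (trig_spinors \<Delta> :: ('d, 's) spinor set) (matrix_op \<Delta> T) \<le> 1"
    and lip: "operator_norm (trig_spinors \<Delta>) (commutator (Dirac_trunc \<Delta> \<gamma>) (matrix_op \<Delta> T)) \<le> 1"
  shows "operator_norm (L2_spinors :: ('d, 's) spinor set) (mult_op (symbol m T)) \<le> 1"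
    and "operator_norm smooth_spinors (commutator (Dirac \<gamma>) (mult_op (symbol m T))) \<le> 1"
proof -
  have 1: "sqnorm \<Delta> (mat_apply \<Delta> T v) \<le> sqnorm \<Delta> v" for v :: "int^'d \<Rightarrow> complex^'s"
    using norm unfolding operator_norm_matrix_iff[OF fin] by blast
  have 2: "sqnorm \<Delta> (mat_commutator \<gamma> \<Delta> T v) \<le> sqnorm \<Delta> v" for v
    using lip unfolding operator_norm_matrix_commutator_iff[OF fin] by blast
  show "operator_norm (L2_spinors :: ('d, 's) spinor set) (mult_op (symbol m T)) \<le> 1"
    by (rule operator_norm_mult_opI[OF symbol_le[OF m fin sub 1]])
  show "operator_norm smooth_spinors (commutator (Dirac \<gamma>) (mult_op (symbol m T))) \<le> 1"
    by (rule operator_norm_commutatorI[OF symbol_torus_smooth symbol_commutator_le[OF m fin sub 2]])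
qed

lemma zero_torus_smooth: "(\<lambda>_. 0) \<in> torus_smooth"
  using trig_poly_torus_smooth[of "{}"] by (simp add: trig_poly_def[abs_def])

lemma torus_zero_ball:
  fixes \<gamma> :: "'d::finite \<Rightarrow> complex^'s^'s::finite"
  shows "operator_norm (L2_spinors :: ('d, 's) spinor set) (mult_op (\<lambda>_. 0)) \<le> 1"
    and "operator_norm smooth_spinors (commutator (Dirac \<gamma>) (mult_op (\<lambda>_. 0))) \<le> 1"
proof -
  show "operator_norm (L2_spinors :: ('d, 's) spinor set) (mult_op (\<lambda>_. 0)) \<le> 1"
    by (rule operator_norm_mult_opI) simp
  have "partial_deriv \<mu> (\<lambda>_ :: real^'d. 0 :: complex) x = 0" for \<mu> x
    by (subst partial_deriv_eq[OF has_derivative_const]) simp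
  then show "operator_norm smooth_spinors (commutator (Dirac \<gamma>) (mult_op (\<lambda>_. 0))) \<le> 1"
    by (intro operator_norm_commutatorI[OF zero_torus_smooth]) (simp add: clifford_def)
qed

section \<open>Convergence\<close>

text \<open>The bound of \<open>fejer_sum_lipschitz\<close> for functions whose partial derivatives are at most one.\<close>

definition approx_error :: "'d::finite itself \<Rightarrow> nat \<Rightarrow> real" where
  "approx_error _ m = 3 * real CARD('d) / sqrt (real m)"

lemma approx_error_pos: "m > 0 \<Longrightarrow> 0 < approx_error TYPE('d::finite) m"
  by (simp add: approx_error_def)

lemma approx_error_small:
  assumes "\<epsilon> > 0"
  shows "\<exists>m>0. approx_error TYPE('d::finite) m < \<epsilon>"
proof -
  obtain m :: nat where m: "(3 * real CARD('d) / \<epsilon>)\<^sup>2 < real m" using reals_Archimedean2 by blast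
  have c: "0 < 3 * real CARD('d) / \<epsilon>" using assms by simp
  have "0 < real m" using m by (rule le_less_trans[OF zero_le_power2])
  moreover have "3 * real CARD('d) / \<epsilon> < sqrt (real m)" using m c by (intro real_less_rsqrt)
  ultimately have "approx_error TYPE('d) m < \<epsilon>" using assms by (simp add: approx_error_def field_simps)
  then show ?thesis using \<open>0 < real m\<close> by auto
qed

context
  fixes k :: "nat \<Rightarrow> 'k::complex_hilbert_space" and \<gamma> :: "'d::finite \<Rightarrow> complex^'s^'s::finite"
  assumes dense: "closure (k ` {1..}) = cball 0 1" and \<gamma>: "gamma_matrices \<gamma>"
begin

lemma UCP_torus_contractive:
  assumes "\<phi> \<in> UCP_torus TYPE('s)" "f \<in> torus_smooth"
    "operator_norm (L2_spinors :: ('d, 's) spinor set) (mult_op f) \<le> 1"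
  shows "cmod (qform (\<phi> f) x) \<le> (norm x)\<^sup>2"
  using UCP_torus_bound[OF assms(1) torus_smooth_continuous[OF assms(2)] operator_norm_mult_opD[OF assms(2,3)], of x]
  by simp

lemma weighted_form_le_dist_torus:
  assumes "\<phi> \<in> UCP_torus TYPE('s)" "\<psi> \<in> UCP_torus TYPE('s)" "f \<in> torus_smooth"
    "operator_norm (L2_spinors :: ('d, 's) spinor set) (mult_op f) \<le> 1"
    "operator_norm smooth_spinors (commutator (Dirac \<gamma>) (mult_op f)) \<le> 1"
  shows "weighted_form k (\<phi> f - \<psi> f) \<le> dist_torus \<gamma> k \<phi> \<psi>"
  unfolding dist_torus_def
  by (rule weighted_form_le_ucp_dist[where X = "UCP_torus TYPE('s)"])
    (use assms in \<open>auto intro: norm_k_le_1[OF dense \<gamma>] UCP_torus_contractive\<close>)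

lemma weighted_form_le_dist_toeplitz:
  assumes "finite \<Delta>" "\<phi> \<in> UCP_toeplitz TYPE('s) \<Delta>" "\<psi> \<in> UCP_toeplitz TYPE('s) \<Delta>" "T \<in> toeplitz \<Delta>"
    "operator_norm (trig_spinors \<Delta> :: ('d, 's) spinor set) (matrix_op \<Delta> T) \<le> 1"
    "operator_norm (trig_spinors \<Delta>) (commutator (Dirac_trunc \<Delta> \<gamma>) (matrix_op \<Delta> T)) \<le> 1"
  shows "weighted_form k (\<phi> T - \<psi> T) \<le> dist_toeplitz \<gamma> k \<Delta> \<phi> \<psi>"
  unfolding dist_toeplitz_def
  by (rule weighted_form_le_ucp_dist[where X = "UCP_toeplitz TYPE('s) \<Delta>"])
    (use assms in \<open>auto intro: norm_k_le_1[OF dense \<gamma>] UCP_toeplitz_contractive\<close>)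

lemma torus_pullback_nonexpansive:
  assumes fin: "finite \<Delta>" and "\<phi> \<in> UCP_toeplitz TYPE('s) \<Delta>" "\<phi>' \<in> UCP_toeplitz TYPE('s) \<Delta>"
  shows "dist_torus \<gamma> k (torus_pullback \<Delta> \<phi>) (torus_pullback \<Delta> \<phi>') \<le> dist_toeplitz \<gamma> k \<Delta> \<phi> \<phi>'"
  unfolding dist_torus_def
proof (rule ucp_dist_least[where ?f0.0 = "\<lambda>_. 0"])
  fix f assume f: "f \<in> torus_smooth" "operator_norm (L2_spinors :: ('d, 's) spinor set) (mult_op f) \<le> 1"
    "operator_norm smooth_spinors (commutator (Dirac \<gamma>) (mult_op f)) \<le> 1"
  show "weighted_form k (torus_pullback \<Delta> \<phi> f - torus_pullback \<Delta> \<phi>' f) \<le> dist_toeplitz \<gamma> k \<Delta> \<phi> \<phi>'"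
    using weighted_form_le_dist_toeplitz[OF assms compress_toeplitz compress_ball[OF fin f]] torus_smooth_continuous[OF f(1)]
    by (simp add: torus_pullback_def)
qed (rule zero_torus_smooth torus_zero_ball)+

context
  fixes m :: nat and \<Delta> :: "(int^'d) set"
  assumes m: "m > 0" and fin: "finite \<Delta>" and sub: "cube m \<subseteq> \<Delta>"
begin

lemma toeplitz_pullback_nonexpansive:
  assumes "\<psi> \<in> UCP_torus TYPE('s)" "\<psi>' \<in> UCP_torus TYPE('s)"
  shows "dist_toeplitz \<gamma> k \<Delta> (toeplitz_pullback m \<Delta> \<psi>) (toeplitz_pullback m \<Delta> \<psi>') \<le> dist_torus \<gamma> k \<psi> \<psi>'"
  unfolding dist_toeplitz_def
proof (rule ucp_dist_least[where ?f0.0 = "\<lambda>_. 0"])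
  fix T assume T: "T \<in> toeplitz \<Delta>" "operator_norm (trig_spinors \<Delta> :: ('d, 's) spinor set) (matrix_op \<Delta> T) \<le> 1"
    "operator_norm (trig_spinors \<Delta>) (commutator (Dirac_trunc \<Delta> \<gamma>) (matrix_op \<Delta> T)) \<le> 1"
  show "weighted_form k (toeplitz_pullback m \<Delta> \<psi> T - toeplitz_pullback m \<Delta> \<psi>' T) \<le> dist_torus \<gamma> k \<psi> \<psi>'"
    using weighted_form_le_dist_torus[OF assms symbol_torus_smooth symbol_ball[OF m fin sub T(2,3)]] T(1)
    by (simp add: toeplitz_pullback_def)
qed (rule zero_in_toeplitz toeplitz_zero_ball[OF fin])+

lemma toeplitz_pullback_torus_pullback:
  assumes \<phi>: "\<phi> \<in> UCP_toeplitz TYPE('s) \<Delta>"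
  shows "dist_toeplitz \<gamma> k \<Delta> \<phi> (toeplitz_pullback m \<Delta> (torus_pullback \<Delta> \<phi>)) \<le> approx_error TYPE('d) m"
  unfolding dist_toeplitz_def
proof (rule ucp_dist_least[where ?f0.0 = "\<lambda>_. 0"])
  fix T assume T: "T \<in> toeplitz \<Delta>" and lip: "operator_norm (trig_spinors \<Delta>) (commutator (Dirac_trunc \<Delta> \<gamma>) (matrix_op \<Delta> T)) \<le> 1"
  let ?T' = "compress \<Delta> (symbol m T)"
  have T': "?T' \<in> toeplitz \<Delta>" by (rule compress_toeplitz)
  have d: "(\<lambda>i. ?T' i - T i) \<in> toeplitz \<Delta>"
    using lin_closedD[OF lin_closed_toeplitz T' T, of 1 "-1"] by simp
  have comm: "sqnorm \<Delta> (mat_commutator \<gamma> \<Delta> T v) \<le> sqnorm \<Delta> v" for v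
    using lip unfolding operator_norm_matrix_commutator_iff[OF fin] by blast
  have eq: "toeplitz_pullback m \<Delta> (torus_pullback \<Delta> \<phi>) T = \<phi> ?T'"
    using T torus_smooth_continuous[OF symbol_torus_smooth[of m T]] by (simp add: toeplitz_pullback_def torus_pullback_def)
  show "weighted_form k (\<phi> T - toeplitz_pullback m \<Delta> (torus_pullback \<Delta> \<phi>) T) \<le> approx_error TYPE('d) m"
    unfolding eq
  proof (rule weighted_form_le[OF norm_k_le_1[OF dense \<gamma>]])
    fix x
    have "cmod (qform (\<phi> (\<lambda>i. ?T' i - T i)) x) \<le> approx_error TYPE('d) m * (norm x)\<^sup>2"
      unfolding approx_error_def
      by (rule UCP_toeplitz_bound[OF fin \<phi> d compress_symbol_approx[OF m fin sub \<gamma> T comm]])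
    then show "cmod (qform (\<phi> T - \<phi> ?T') x) \<le> approx_error TYPE('d) m * (norm x)\<^sup>2"
      unfolding qform_diff ucp_maps_qform_diff[OF \<phi>[unfolded UCP_toeplitz_def] T' T]
      by (simp only: norm_minus_commute)
  qed (use approx_error_pos[OF m, where 'd='d] in simp_all)
qed (rule zero_in_toeplitz toeplitz_zero_ball[OF fin])+

lemma torus_pullback_toeplitz_pullback_eq:
  assumes "f \<in> torus_continuous"
  shows "torus_pullback \<Delta> (toeplitz_pullback m \<Delta> \<psi>) f = \<psi> (symbol m (compress \<Delta> f))"
  using assms compress_toeplitz[of \<Delta> f] by (simp add: toeplitz_pullback_def torus_pullback_def)

lemma torus_pullback_toeplitz_pullback:
  assumes \<psi>: "\<psi> \<in> UCP_torus TYPE('s)"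
  shows "dist_torus \<gamma> k (torus_pullback \<Delta> (toeplitz_pullback m \<Delta> \<psi>)) \<psi> \<le> approx_error TYPE('d) m"
  unfolding dist_torus_def
proof (rule ucp_dist_least[where ?f0.0 = "\<lambda>_. 0"])
  fix f assume f: "f \<in> torus_smooth" and lip: "operator_norm smooth_spinors (commutator (Dirac \<gamma>) (mult_op f)) \<le> 1"
  let ?f' = "symbol m (compress \<Delta> f)"
  have fc: "f \<in> torus_continuous" "?f' \<in> torus_continuous"
    using f symbol_torus_smooth by (auto intro: torus_smooth_continuous)
  have d: "(\<lambda>i. ?f' i - f i) \<in> torus_continuous"
    using lin_closedD[OF lin_closed_torus_continuous fc(2,1), of 1 "-1"] by simp
  have L: "cmod (partial_deriv \<mu> f x) \<le> 1" for \<mu> x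
    by (rule norm_coefficient_le_clifford[OF \<gamma> operator_norm_commutatorD[OF f lip]])
  have le: "cmod (?f' x - f x) \<le> approx_error TYPE('d) m" for x
    using fejer_sum_lipschitz[OF m torus_smoothD(1,2)[OF f] L, of x]
    by (simp add: symbol_compress[OF sub] approx_error_def)
  show "weighted_form k (torus_pullback \<Delta> (toeplitz_pullback m \<Delta> \<psi>) f - \<psi> f) \<le> approx_error TYPE('d) m"
    unfolding torus_pullback_toeplitz_pullback_eq[OF fc(1)]
  proof (rule weighted_form_le[OF norm_k_le_1[OF dense \<gamma>]])
    fix x
    have "cmod (qform (\<psi> (\<lambda>i. ?f' i - f i)) x) \<le> approx_error TYPE('d) m * (norm x)\<^sup>2"
      by (rule UCP_torus_bound[OF \<psi> d le])
    then show "cmod (qform (\<psi> ?f' - \<psi> f) x) \<le> approx_error TYPE('d) m * (norm x)\<^sup>2"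
      unfolding qform_diff ucp_maps_qform_diff[OF \<psi>[unfolded UCP_torus_def] fc(2,1)] .
  qed (use approx_error_pos[OF m, where 'd='d] in simp_all)
qed (rule zero_torus_smooth torus_zero_ball)+

end

text \<open>The maps have the same pullback to every cube, since the pullbacks have distance zero.  Hence they
  agree on the Fejer sums of any continuous function, and by the uniform bound on the function itself.\<close>

lemma UCP_torus_separation:
  assumes \<phi>: "\<phi> \<in> UCP_torus TYPE('s)" and \<psi>: "\<psi> \<in> UCP_torus TYPE('s)"
    and zero: "\<And>f. f \<in> torus_smooth \<Longrightarrow> operator_norm (L2_spinors :: ('d, 's) spinor set) (mult_op f) \<le> 1 \<Longrightarrow>
      operator_norm smooth_spinors (commutator (Dirac \<gamma>) (mult_op f)) \<le> 1 \<Longrightarrow> weighted_form k (\<phi> f - \<psi> f) = 0"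
  shows "\<phi> = \<psi>"
proof -
  note \<phi>' = \<phi>[unfolded UCP_torus_def] and \<psi>' = \<psi>[unfolded UCP_torus_def]
  have trig: "toeplitz_pullback m (cube m) \<phi> = toeplitz_pullback m (cube m) \<psi>" if m: "m > 0" for m
  proof -
    let ?P = "toeplitz_pullback m (cube m)"
    have "dist_toeplitz \<gamma> k (cube m) (?P \<phi>) (?P \<psi>) \<le> 0"
      unfolding dist_toeplitz_def
    proof (rule ucp_dist_least[where ?f0.0 = "\<lambda>_. 0"])
      fix T assume T: "T \<in> toeplitz (cube m)"
        "operator_norm (trig_spinors (cube m) :: ('d, 's) spinor set) (matrix_op (cube m) T) \<le> 1"
        "operator_norm (trig_spinors (cube m)) (commutator (Dirac_trunc (cube m) \<gamma>) (matrix_op (cube m) T)) \<le> 1"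
      show "weighted_form k (?P \<phi> T - ?P \<psi> T) \<le> 0"
        using zero[OF symbol_torus_smooth symbol_ball[OF m finite_cube subset_refl T(2,3)]] T(1)
        by (simp add: toeplitz_pullback_def)
    qed (rule zero_in_toeplitz toeplitz_zero_ball[OF finite_cube])+
    moreover have P: "?P \<phi> \<in> UCP_toeplitz TYPE('s) (cube m)" "?P \<psi> \<in> UCP_toeplitz TYPE('s) (cube m)"
      by (rule toeplitz_pullback_UCP[OF m finite_cube subset_refl]; fact)+
    ultimately show ?thesis
      using metric_on_UCP_toeplitz[OF dense \<gamma> finite_cube, of m] unfolding metric_on_def
      by (metis order_antisym)
  qed
  have eq: "\<phi> f = \<psi> f" if f: "f \<in> torus_continuous" for f
  proof (rule operator_eqI_qform)
    show "\<phi> f \<in> bounded_operators" "\<psi> f \<in> bounded_operators"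
      using \<phi>' \<psi>' f unfolding ucp_maps_def by auto
    fix x
    have fc: "periodic f" "continuous_on UNIV f" using f by (auto simp: torus_continuous_def)
    have bound: "cmod (qform (\<phi> f) x - qform (\<psi> f) x) \<le> \<epsilon> * (2 * (norm x)\<^sup>2)" if \<epsilon>: "\<epsilon> > 0" for \<epsilon>
    proof -
      obtain m where m: "m > 0" and le: "\<And>y. cmod (fejer_sum m (fourier f) y - f y) \<le> \<epsilon>"
        using fejer_sum_uniform[OF fc \<epsilon>] by blast
      let ?f' = "symbol m (compress (cube m) f)"
      have f': "?f' \<in> torus_continuous" using symbol_torus_smooth by (rule torus_smooth_continuous)
      have d: "(\<lambda>i. ?f' i - f i) \<in> torus_continuous"
        using lin_closedD[OF lin_closed_torus_continuous f' f, of 1 "-1"] by simp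
      have "\<phi> ?f' = \<psi> ?f'"
        using fun_cong[OF trig[OF m], of "compress (cube m) f"] compress_toeplitz[of "cube m" f]
        by (simp add: toeplitz_pullback_def)
      moreover have "cmod (qform (\<phi> ?f') x - qform (\<phi> f) x) \<le> \<epsilon> * (norm x)\<^sup>2"
        unfolding ucp_maps_qform_diff[OF \<phi>' f' f, symmetric]
        by (rule UCP_torus_bound[OF \<phi> d]) (simp add: symbol_compress le)
      moreover have "cmod (qform (\<psi> ?f') x - qform (\<psi> f) x) \<le> \<epsilon> * (norm x)\<^sup>2"
        unfolding ucp_maps_qform_diff[OF \<psi>' f' f, symmetric]
        by (rule UCP_torus_bound[OF \<psi> d]) (simp add: symbol_compress le)
      ultimately show ?thesis
        using norm_triangle_ineq4[of "qform (\<psi> ?f') x - qform (\<psi> f) x" "qform (\<phi> ?f') x - qform (\<phi> f) x"] by simp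
    qed
    have "cmod (qform (\<phi> f) x - qform (\<psi> f) x) \<le> 0"
    proof (rule field_le_epsilon)
      fix e :: real assume "e > 0"
      let ?K = "2 * (norm x)\<^sup>2 + 1"
      have K: "?K > 0" by (simp add: add_nonneg_pos)
      have "cmod (qform (\<phi> f) x - qform (\<psi> f) x) \<le> e / ?K * (2 * (norm x)\<^sup>2)"
        using K \<open>e > 0\<close> by (intro bound) simp
      also have "\<dots> \<le> e / ?K * ?K" using K \<open>e > 0\<close> by (intro mult_left_mono) auto
      also have "\<dots> = 0 + e" using K by simp
      finally show "cmod (qform (\<phi> f) x - qform (\<psi> f) x) \<le> 0 + e" .
    qed
    then show "qform (\<phi> f) x = qform (\<psi> f) x" by simp
  qed
  show "\<phi> = \<psi>"
    using \<phi>' \<psi>' eq unfolding ucp_maps_def by (intro PiE_ext[of \<phi> torus_continuous]) auto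
qed

lemma metric_on_UCP_torus: "metric_on (UCP_torus TYPE('s)) (dist_torus \<gamma> k)"
  unfolding dist_torus_def
proof (rule metric_on_ucp_dist[where ?f0.0 = "\<lambda>_. 0"])
  show "norm (k p) \<le> 1" if "p \<ge> 1" for p using that by (rule norm_k_le_1[OF dense \<gamma>])
  show "cmod (qform (\<phi> f) x) \<le> (norm x)\<^sup>2"
    if "\<phi> \<in> UCP_torus TYPE('s)" "f \<in> torus_smooth"
      "operator_norm (L2_spinors :: ('d, 's) spinor set) (mult_op f) \<le> 1" for \<phi> f x
    using that by (rule UCP_torus_contractive)
  show "\<phi> = \<psi>"
    if "\<phi> \<in> UCP_torus TYPE('s)" "\<psi> \<in> UCP_torus TYPE('s)"
      "\<And>f. f \<in> torus_smooth \<Longrightarrow> operator_norm (L2_spinors :: ('d, 's) spinor set) (mult_op f) \<le> 1 \<Longrightarrow>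
        operator_norm smooth_spinors (commutator (Dirac \<gamma>) (mult_op f)) \<le> 1 \<Longrightarrow> weighted_form k (\<phi> f - \<psi> f) = 0"
    for \<phi> \<psi>
    using that by (rule UCP_torus_separation)
qed (rule zero_torus_smooth torus_zero_ball)+

text \<open>A net for the Toeplitz matrices over a cube yields one for the torus; the cube depends on \<open>e\<close>.\<close>

lemma totally_bounded_UCP_torus: "totally_bounded_on (UCP_torus TYPE('s)) (dist_torus \<gamma> k)"
  unfolding totally_bounded_on_def
proof (intro allI impI)
  fix e :: real assume "e > 0"
  then obtain m where m: "m > 0" "approx_error TYPE('d) m < e / 2"
    using approx_error_small[of "e / 2"] by auto
  note cube = finite_cube[of m] subset_refl[of "cube m"]
  have "\<exists>F. finite F \<and> F \<subseteq> UCP_torus TYPE('s) \<and>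
      (\<forall>\<psi>\<in>UCP_torus TYPE('s). \<exists>\<psi>'\<in>F. dist_torus \<gamma> k \<psi> \<psi>' < 2 * (e / 2))"
  proof (rule finite_cover_of_approximation[OF metric_on_UCP_torus totally_bounded_UCP_toeplitz[OF dense \<gamma> finite_cube[of m]]])
    show "toeplitz_pullback m (cube m) \<psi> \<in> UCP_toeplitz TYPE('s) (cube m)" if "\<psi> \<in> UCP_torus TYPE('s)" for \<psi> :: "_ \<Rightarrow> 'k \<Rightarrow>\<^sub>L 'k"
      by (rule toeplitz_pullback_UCP[OF m(1) cube that])
    show "torus_pullback (cube m) \<phi> \<in> UCP_torus TYPE('s)" if "\<phi> \<in> UCP_toeplitz TYPE('s) (cube m)" for \<phi> :: "_ \<Rightarrow> 'k \<Rightarrow>\<^sub>L 'k"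
      by (rule torus_pullback_UCP[OF cube(1) that])
    show "dist_torus \<gamma> k (torus_pullback (cube m) \<phi>) (torus_pullback (cube m) \<phi>') \<le> dist_toeplitz \<gamma> k (cube m) \<phi> \<phi>'"
      if "\<phi> \<in> UCP_toeplitz TYPE('s) (cube m)" "\<phi>' \<in> UCP_toeplitz TYPE('s) (cube m)" for \<phi> \<phi>'
      by (rule torus_pullback_nonexpansive[OF cube(1) that])
    show "dist_torus \<gamma> k \<psi> (torus_pullback (cube m) (toeplitz_pullback m (cube m) \<psi>)) \<le> e / 2"
      if \<psi>: "\<psi> \<in> UCP_torus TYPE('s)" for \<psi>
    proof -
      let ?\<psi>' = "torus_pullback (cube m) (toeplitz_pullback m (cube m) \<psi>)"
      have "?\<psi>' \<in> UCP_torus TYPE('s)"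
        by (intro torus_pullback_UCP[OF cube(1)] toeplitz_pullback_UCP[OF m(1) cube] \<psi>)
      then have "dist_torus \<gamma> k \<psi> ?\<psi>' = dist_torus \<gamma> k ?\<psi>' \<psi>"
        using metric_on_UCP_torus \<psi> unfolding metric_on_def by blast
      also have "\<dots> \<le> approx_error TYPE('d) m"
        by (rule torus_pullback_toeplitz_pullback[OF m(1) cube \<psi>])
      finally show ?thesis using m(2) by linarith
    qed
    show "e / 2 > 0" using \<open>e > 0\<close> by simp
  qed
  then show "\<exists>F. finite F \<and> F \<subseteq> UCP_torus TYPE('s) \<and> (\<forall>\<psi>\<in>UCP_torus TYPE('s). \<exists>\<psi>'\<in>F. dist_torus \<gamma> k \<psi> \<psi>' < e)"
    by simp
qed

lemma gromov_hausdorff_UCP_le: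
  assumes m: "m > 0" and fin: "finite \<Delta>" and sub: "cube m \<subseteq> \<Delta>"
  shows "gromov_hausdorff (UCP_toeplitz TYPE('s) \<Delta>) (dist_toeplitz \<gamma> k \<Delta>) (UCP_torus TYPE('s)) (dist_torus \<gamma> k)
    \<le> ennreal (2 * approx_error TYPE('d) m)"
  by (rule gromov_hausdorff_le_approximate_inverse[where p = "torus_pullback \<Delta>" and q = "toeplitz_pullback m \<Delta>",
        OF metric_on_UCP_toeplitz[OF dense \<gamma> fin] totally_bounded_UCP_toeplitz[OF dense \<gamma> fin]
          metric_on_UCP_torus totally_bounded_UCP_torus])
    (assumption | rule torus_pullback_UCP[OF fin] torus_pullback_nonexpansive[OF fin]
      toeplitz_pullback_UCP[OF m fin sub] toeplitz_pullback_nonexpansive[OF m fin sub]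
      toeplitz_pullback_torus_pullback[OF m fin sub] torus_pullback_toeplitz_pullback[OF m fin sub]
      approx_error_pos[OF m])+

end

lemma finite_dilation:
  fixes W :: "(int^'d) set"
  assumes "finite W"
  shows "finite (dilation W N)"
proof -
  have "bounded (convex hull ((\<lambda>a. real N *\<^sub>R lattice_point a) ` W))"
    using assms by (intro finite_imp_bounded_convex_hull) auto
  then obtain B where B: "\<And>x. x \<in> convex hull ((\<lambda>a. real N *\<^sub>R lattice_point a) ` W) \<Longrightarrow> norm x \<le> B"
    unfolding bounded_iff by blast
  have "dilation W N \<subseteq> {n. \<forall>i. n $ i \<in> {- \<lceil>B\<rceil>..\<lceil>B\<rceil>}}"
  proof
    fix n assume "n \<in> dilation W N"
    then have "norm (lattice_point n) \<le> B" unfolding dilation_def by (intro B) simp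
    then have "\<bar>real_of_int (n $ i)\<bar> \<le> B" for i
      using component_le_norm_cart[of "lattice_point n" i] by (simp add: lattice_point_def)
    then have "n $ i \<in> {- \<lceil>B\<rceil>..\<lceil>B\<rceil>}" for i
      by (smt (verit) atLeastAtMost_iff le_of_int_ceiling of_int_le_iff of_int_minus)
    then show "n \<in> {n. \<forall>i. n $ i \<in> {- \<lceil>B\<rceil>..\<lceil>B\<rceil>}}" by blast
  qed
  then show ?thesis by (rule finite_subset) (rule finite_int_box)
qed

text \<open>A ball around the origin lies in the polyhedron, and its dilations absorb the cube.\<close>

lemma eventually_cube_subset_dilation:
  fixes W :: "(int^'d) set"
  assumes W: "0 \<in> interior (convex hull (lattice_point ` W))"
  shows "\<forall>\<^sub>F N in sequentially. cube m \<subseteq> dilation W N"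
proof -
  obtain r where r: "r > 0" "cball 0 r \<subseteq> convex hull (lattice_point ` W)"
    using W unfolding mem_interior_cball by blast
  have "bounded (lattice_point ` (cube m :: (int^'d) set))" by (intro finite_imp_bounded finite_imageI finite_cube)
  then obtain B where B: "\<And>n. n \<in> (cube m :: (int^'d) set) \<Longrightarrow> norm (lattice_point n) \<le> B"
    unfolding bounded_iff by blast
  have "\<forall>\<^sub>F N in sequentially. max 1 (B / r) \<le> real N"
    using filterlim_real_sequentially by (rule filterlim_at_top[THEN iffD1, rule_format])
  then show ?thesis
  proof eventually_elim
    case (elim N)
    then have N: "real N > 0" "B \<le> real N * r" using r(1) by (auto simp: field_simps)
    show "cube m \<subseteq> dilation W N"
    proof
      fix n :: "int^'d" assume "n \<in> cube m"
      then have "norm (lattice_point n /\<^sub>R real N) \<le> r"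
        using B[of n] N by (simp add: field_simps)
      then have "lattice_point n /\<^sub>R real N \<in> convex hull (lattice_point ` W)" using r(2) by auto
      then have "real N *\<^sub>R (lattice_point n /\<^sub>R real N) \<in> (\<lambda>x. real N *\<^sub>R x) ` (convex hull (lattice_point ` W))"
        by (rule imageI)
      then have "lattice_point n \<in> convex hull ((\<lambda>x. real N *\<^sub>R x) ` lattice_point ` W)"
        using N(1) by (simp add: convex_hull_scaling)
      then show "n \<in> dilation W N" by (simp add: dilation_def image_image)
    qed
  qed
qed

theorem corollary4p7:
  fixes k :: "nat \<Rightarrow> 'k::complex_hilbert_space"
    and \<gamma> :: "'d::finite \<Rightarrow> complex^'s^'s::finite"
    and W :: "(int^'d) set"
  assumes "closure (k ` {1..}) = cball 0 1"
    and "CARD('s) = 2 ^ (CARD('d) div 2)"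
    and "gamma_matrices \<gamma>"
    and "summability_polyhedron W"
  shows "(\<lambda>N. gromov_hausdorff
            (UCP_toeplitz TYPE('s) (dilation W N)) (dist_toeplitz \<gamma> k (dilation W N))
            (UCP_torus TYPE('s)) (dist_torus \<gamma> k))
         \<longlonglongrightarrow> 0"
proof (rule order_tendstoI)
  fix e :: ennreal assume "0 < e"
  obtain \<epsilon> :: real where \<epsilon>: "\<epsilon> > 0" "ennreal \<epsilon> \<le> e"
  proof (cases e)
    case (real r)
    with \<open>0 < e\<close> show ?thesis by (intro that[of r]) auto
  next
    case top
    then show ?thesis by (intro that[of 1]) auto
  qed
  obtain m where m: "m > 0" "approx_error TYPE('d) m < \<epsilon> / 2"
    using approx_error_small[of "\<epsilon> / 2"] \<epsilon>(1) by auto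
  have W: "finite W" "0 \<in> interior (convex hull (lattice_point ` W))"
    using assms(4) by (auto simp: summability_polyhedron_def)
  show "\<forall>\<^sub>F N in sequentially. gromov_hausdorff
            (UCP_toeplitz TYPE('s) (dilation W N)) (dist_toeplitz \<gamma> k (dilation W N))
            (UCP_torus TYPE('s)) (dist_torus \<gamma> k) < e"
    using eventually_cube_subset_dilation[OF W(2), of m]
  proof eventually_elim
    case (elim N)
    have "gromov_hausdorff (UCP_toeplitz TYPE('s) (dilation W N)) (dist_toeplitz \<gamma> k (dilation W N))
        (UCP_torus TYPE('s)) (dist_torus \<gamma> k) \<le> ennreal (2 * approx_error TYPE('d) m)"
      by (rule gromov_hausdorff_UCP_le[OF assms(1,3) m(1) finite_dilation[OF W(1)] elim])
    also have "\<dots> < ennreal \<epsilon>" using m(2) \<epsilon>(1) by (intro ennreal_lessI) auto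
    also have "\<dots> \<le> e" by (rule \<epsilon>(2))
    finally show ?case .
  qed
qed simp

end
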